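(* Let $\Omega\subset\mathbb{R}^n$ be a bounded Lipschitz domain, let $\Gamma(t)=1+t^2$, and for $i=1,\dots,n$ let $q_i^+>1$, $q_i^->1$ be real exponents with $\underline{q}_i:=\min\{q_i^+,q_i^-\}$, $\overline{q}_i:=\max\{q_i^+,q_i^-\}$. Suppose that the functions $f_i:\mathbb{R}\to[0,\infty)$, $i=1,\dots,n$, satisfy the following. (i) $f_i\in C^2(\mathbb{R})$, $f_i''(t)>0$ for all $t\in\mathbb{R}$, $\lim_{t\to\pm\infty}|f_i'(t)|=\infty$, and for some $s>0$ and some finite constant $c$ we have $f_i(t)\le c|t|^s$ for $|t|$ sufficiently large. (ii) There are exponents $\delta_i\ge0$, $\theta_i\ge0$ with $\theta_i<1-\delta_i$ and positive constants $c_1,c_2,c_3$ such that for all $|t|$ sufficiently large $$c_1\Gamma^{1-\delta_i}(|t|)f_i''(t)\le f_i(t)\le c_2 f_i''(t)\Gamma^{1+\theta_i}(|t|),\qquad |f_i'(t)|^2\le c_3 f_i''(t)f_i(t)\Gamma^{\theta_i}(|t|).$$ (iii) There are positive constants $c_4,c_5$ such that for $|t|$ sufficiently large $$c_4\Gamma^{\frac{q_i^-}{2}}(|t|)\le f_i(t)\le c_5\Gamma^{\frac{q_i^-}{2}}(|t|)\ \text{ if } t<0,\qquad c_4\Gamma^{\frac{q_i^+}{2}}(|t|)\le f_i(t)\le c_5\Gamma^{\frac{q_i^+}{2}}(|t|)\ \text{ if } t\ge0.$$ Assume in addition that for every fixed $1\le i\le n$ $$\overline{q}_j<\frac{2\underline{q}_i(1-\delta_i)}{1+2\theta_i}+2(1-\delta_i)\qquad\text{for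 all } i<j\le n,$$ $$\overline{q}_j<\frac{2}{1+2\theta_i}\Big[\frac{\underline{q}_i}{2}(1-\delta_i)\Big(2+\frac{1}{1-\delta_i}\Big)-\theta_i(1+\overline{q}_j)\Big]+2(1-\delta_i)\qquad\text{for all } 1\le j<i.$$ Let $u\in L^\infty(\Omega)\cap E_f(\Omega)$ be a local minimizer of $$J[w]=\int_\Omega\Big[\sum_{i=1}^n f_i(\partial_i w)\Big]\,dx .$$ Then there exists a real number $\delta>-1/2$ such that for every $1\le i\le n$, for every ball $B=B_{2r}(x_0)$ compactly contained in $\Omega$, every $\eta\in C_0^\infty(B)$ with $0\le\eta\le1$, $\eta\equiv1$ on $B_r(x_0)$ and $|\nabla\eta|\le c/r$, and all sufficiently large $k>0$, there is a finite constant $c$ with $$\int_B f_i(\partial_i u)\,\Gamma^{1+\delta}(|\partial_i u|)\,\eta^{2k}\,dx\le c .$$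
   Context: Notation: $\Gamma^{\alpha}(|t|)$ means $(1+t^2)^{\alpha}$. With $f(Z):=\sum_{i=1}^n f_i(Z_i)$ for $Z\in\mathbb{R}^n$, the energy class is $$E_f(\Omega):=\Big\{w\in W^{1,1}(\Omega):\ \int_\Omega f(\nabla w)\,dx<\infty\Big\}.$$ A function $u\in E_f(\Omega)$ is a local minimizer of $J$ if $\int_\Omega f(\nabla u)\,dx\le\int_\Omega f(\nabla w)\,dx$ for all $w\in E_f(\Omega)$ such that $\operatorname{spt}(u-w)$ is compactly contained in $\Omega$. *)

theory Defs
  imports "HOL-Analysis.Analysis"
begin

text \<open>Points are vectors in \<^typ>\<open>real ^ 'n\<close>. Where the order of the coordinate directions matters,
  the index type \<^typ>\<open>'n\<close> is a finite linear order, playing the role of \<open>1 < \<dots> < n\<close>.\<close>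

definition Gam :: "real \<Rightarrow> real" where
  "Gam t = 1 + t\<^sup>2"

definition compactly_contained :: "'a::topological_space set \<Rightarrow> 'a set \<Rightarrow> bool" where
  "compactly_contained A \<Omega> \<longleftrightarrow> compact (closure A) \<and> closure A \<subseteq> \<Omega>"

text \<open>Near each boundary point, after a rotation taking the last coordinate direction to a unit
  vector \<open>e\<close>, the domain is the part of a ball lying strictly above the graph of a Lipschitz
  function \<open>\<gamma>\<close> on the hyperplane orthogonal to \<open>e\<close>.\<close>

definition lipschitz_boundary :: "'a::euclidean_space set \<Rightarrow> bool" where
  "lipschitz_boundary \<Omega> \<longleftrightarrow>
     (\<forall>p\<in>frontier \<Omega>. \<exists>e r L. \<exists>\<gamma> :: 'a \<Rightarrow> real.
        norm e = 1 \<and> r > 0 \<and> L-lipschitz_on {y. y \<bullet> e = 0} \<gamma> \<and>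
        \<Omega> \<inter> ball p r = {x \<in> ball p r. \<gamma> (x - (x \<bullet> e) *\<^sub>R e) < x \<bullet> e})"

definition bounded_lipschitz_domain :: "'a::euclidean_space set \<Rightarrow> bool" where
  "bounded_lipschitz_domain \<Omega> \<longleftrightarrow>
     open \<Omega> \<and> connected \<Omega> \<and> \<Omega> \<noteq> {} \<and> bounded \<Omega> \<and> lipschitz_boundary \<Omega>"

primrec Ck :: "nat \<Rightarrow> ('a::euclidean_space \<Rightarrow> real) \<Rightarrow> bool" where
  "Ck 0 f \<longleftrightarrow> continuous_on UNIV f"
| "Ck (Suc k) f \<longleftrightarrow> (\<forall>x. f differentiable (at x)) \<and>
     (\<forall>b\<in>Basis. Ck k (\<lambda>x. frechet_derivative f (at x) b))"

definition test_functions :: "'a::euclidean_space set \<Rightarrow> ('a \<Rightarrow> real) set" where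
  "test_functions \<Omega> = {\<phi>. (\<forall>k. Ck k \<phi>) \<and> compactly_contained {x. \<phi> x \<noteq> 0} \<Omega>}"

definition grad :: "(real ^ 'n \<Rightarrow> real) \<Rightarrow> real ^ 'n \<Rightarrow> real ^ 'n" where
  "grad \<phi> x = (\<chi> i. frechet_derivative \<phi> (at x) (axis i 1))"

definition has_L1_weak_gradient ::
    "(real ^ 'n) set \<Rightarrow> (real ^ 'n \<Rightarrow> real) \<Rightarrow> (real ^ 'n \<Rightarrow> real ^ 'n) \<Rightarrow> bool" where
  "has_L1_weak_gradient \<Omega> u g \<longleftrightarrow>
     integrable (lebesgue_on \<Omega>) g \<and>
     (\<forall>\<phi>\<in>test_functions \<Omega>. \<forall>i.
        (LINT x|lebesgue_on \<Omega>. u x * grad \<phi> x $ i) = - (LINT x|lebesgue_on \<Omega>. g x $ i * \<phi> x))"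

definition W11 :: "(real ^ 'n) set \<Rightarrow> (real ^ 'n \<Rightarrow> real) set" where
  "W11 \<Omega> = {u. integrable (lebesgue_on \<Omega>) u \<and> (\<exists>g. has_L1_weak_gradient \<Omega> u g)}"

text \<open>Elements of \<open>W11\<close> are functions rather than equivalence classes, and their weak gradient is
  unique only up to null sets; every use below is insensitive to the representative.\<close>

definition weak_grad :: "(real ^ 'n) set \<Rightarrow> (real ^ 'n \<Rightarrow> real) \<Rightarrow> real ^ 'n \<Rightarrow> real ^ 'n" where
  "weak_grad \<Omega> u = (SOME g. has_L1_weak_gradient \<Omega> u g)"

definition Linfty :: "'a::euclidean_space set \<Rightarrow> ('a \<Rightarrow> real) set" where
  "Linfty \<Omega> = {u \<in> borel_measurable (lebesgue_on \<Omega>). \<exists>M. AE x in lebesgue_on \<Omega>. \<bar>u x\<bar> \<le> M}"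

text \<open>The support of an almost everywhere defined function, as a relatively closed subset of \<open>\<Omega>\<close>.\<close>

definition ess_support :: "'a::euclidean_space set \<Rightarrow> ('a \<Rightarrow> real) \<Rightarrow> 'a set" where
  "ess_support \<Omega> v = {x \<in> \<Omega>. \<forall>e>0. \<not> (AE y in lebesgue_on (\<Omega> \<inter> ball x e). v y = 0)}"

definition J_energy ::
    "(real ^ 'n) set \<Rightarrow> ('n \<Rightarrow> real \<Rightarrow> real) \<Rightarrow> (real ^ 'n \<Rightarrow> real) \<Rightarrow> ennreal" where
  "J_energy \<Omega> f w = (\<integral>\<^sup>+x\<in>\<Omega>. ennreal (\<Sum>i\<in>UNIV. f i (weak_grad \<Omega> w x $ i)) \<partial>lebesgue)"

definition energy_class ::
    "(real ^ 'n) set \<Rightarrow> ('n \<Rightarrow> real \<Rightarrow> real) \<Rightarrow> (real ^ 'n \<Rightarrow> real) set" where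
  "energy_class \<Omega> f = {w \<in> W11 \<Omega>. J_energy \<Omega> f w < \<infinity>}"

definition local_minimizer ::
    "(real ^ 'n) set \<Rightarrow> ('n \<Rightarrow> real \<Rightarrow> real) \<Rightarrow> (real ^ 'n \<Rightarrow> real) \<Rightarrow> bool" where
  "local_minimizer \<Omega> f u \<longleftrightarrow>
     u \<in> energy_class \<Omega> f \<and>
     (\<forall>w\<in>energy_class \<Omega> f.
        compactly_contained (ess_support \<Omega> (\<lambda>x. u x - w x)) \<Omega> \<longrightarrow>
        J_energy \<Omega> f u \<le> J_energy \<Omega> f w)"

end

theory Submission
  imports Defs
begin

text \<open>
  Difference quotients are applied to the minimizer itself, without regularising the problem.
  Write \<open>p\<^sub>j = \<partial>\<^sub>j u\<close> and \<open>v\<^sub>h(x) = u(x + h e\<^sub>i) - u(x)\<close>. Since \<open>u\<close> is bounded and the energy is convex and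
  splits, \<open>u + t \<eta> g(v\<^sub>h)\<close> with \<open>g(s) = max(s, 0)\<^sup>1\<^sup>+\<^sup>\<gamma>\<close> is an admissible competitor. Comparing \<open>u\<close> and its translate
  with such competitors gives
  \<open>\<integral> \<eta> g'(v\<^sub>h) (f\<^sub>i'(p\<^sub>i(x + h e\<^sub>i)) - f\<^sub>i'(p\<^sub>i(x))) (p\<^sub>i(x + h e\<^sub>i) - p\<^sub>i(x)) dx \<le> \<integral> g(v\<^sub>h) \<Sum>\<^sub>j \<bar>\<partial>\<^sub>j\<eta>\<bar> (\<bar>f\<^sub>j'(p\<^sub>j(x))\<bar> + \<bar>f\<^sub>j'(p\<^sub>j(x + h e\<^sub>i))\<bar>) dx\<close>.

  Let \<open>Q\<close> bound all growth exponents, so that \<open>\<bar>f\<^sub>j'\<bar> \<le> C (1 + f\<^sub>j)\<^sup>1\<^sup>-\<^sup>1\<^sup>/\<^sup>Q\<close>. If all \<open>f\<^sub>j(p\<^sub>j)\<close> lie locally in \<open>L\<^sup>1\<^sup>+\<^sup>b\<close>, the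
  right-hand side is \<open>O(h\<^sup>\<gamma>\<^sup>+\<^sup>e)\<close> for \<open>\<gamma> + e = q\<^sub>i (b + 1/Q)\<close>. Multiply by \<open>h\<^sup>-\<^sup>\<gamma>\<^sup>-\<^sup>1\<close> and integrate over \<open>h\<close>. At a point where
  \<open>p\<^sub>i = A\<close> is large, \<open>v\<^sub>h / h\<close> starts near \<open>A\<close> but has to become small before \<open>h\<close> reaches a multiple of \<open>\<parallel>u\<parallel>\<^sub>\<infinity> / A\<close>;
  hence \<open>p\<^sub>i\<close> must drop on the way, and superlinear growth turns the drop into a contribution of at least
  \<open>c A\<^sup>q\<^sup>+\<^sup>\<gamma>\<close>. So \<open>f\<^sub>i(p\<^sub>i)\<close> lies locally in \<open>L\<close> to the power \<open>1 + b + 1/(2Q)\<close>, and iterating gives every power.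
\<close>

section \<open>Translations in Lebesgue space\<close>

text \<open>The obstacle is that a competitor must have finite energy. The gradient of u + \<tau>
  \<eta> g(v_h) consists of p_j, the term \<tau> \<eta> g'(v_h) (p_j(x + h e_i) - p_j(x)) and a
  bounded term, with the same weight in every direction. Since u is bounded, \<tau> can be chosen so
  that this weight is at most 1; the new gradient is then a convex combination of two gradients of
  locally finite energy, shifted by a bounded amount, and power growth absorbs the shift. The order
  in h of the error comes from g(v_h) alone: a power 1 - e of v_h is bounded by means of u, the rest
  is a power of h times an average of p_i over a segment. The exponents b + 1/Q of that average,
  measured on the scale of f_i, and 1 - 1/Q of f_j' add up to 1 + b, so directions with different
  growth may be mixed. Half of the reserve 1/Q makes the integral over h converge at 0, the other
  half is the gain, which does not depend on b. Large negative p_i are covered by the symmetry that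
  replaces u by -u and f_j(t) by f_j(-t). All cutoffs are rescaled copies of the \<eta> of the
  statement.\<close>

lemma lborel_eq_distr_shift: "lborel = distr lborel borel (\<lambda>x. x + (c::'a::euclidean_space))"
proof -
  have "(+) c = (\<lambda>x. x + c)" by (auto simp: add.commute)
  then show ?thesis
    using lborel_distr_plus[of c] by simp
qed

lemma
  fixes f :: "'a::euclidean_space \<Rightarrow> 'b::{banach, second_countable_topology}"
  assumes [measurable]: "f \<in> borel_measurable borel"
  shows integral_lborel_shift: "(LBINT x. f (x + c)) = (LBINT x. f x)"
    and integrable_lborel_shift: "integrable lborel (\<lambda>x. f (x + c)) \<longleftrightarrow> integrable lborel f"
proof -
  have *: "lborel = distr lborel borel (\<lambda>x. x + c)"
    by (rule lborel_eq_distr_shift)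
  show "(LBINT x. f (x + c)) = (LBINT x. f x)"
    by (subst (2) *) (simp add: integral_distr)
  show "integrable lborel (\<lambda>x. f (x + c)) \<longleftrightarrow> integrable lborel f"
    by (subst (2) *) (simp add: integrable_distr_eq)
qed

lemma nn_integral_lborel_shift:
  fixes f :: "'a::euclidean_space \<Rightarrow> ennreal"
  assumes [measurable]: "f \<in> borel_measurable borel"
  shows "(\<integral>\<^sup>+x. f (x + c) \<partial>lborel) = (\<integral>\<^sup>+x. f x \<partial>lborel)"
proof -
  have *: "lborel = distr lborel borel (\<lambda>x. x + c)"
    by (rule lborel_eq_distr_shift)
  show ?thesis
    by (subst (2) *) (simp add: nn_integral_distr)
qed

lemma AE_lborel_shift:
  fixes c :: "'a::euclidean_space"
  assumes "AE x in lborel. P x"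
  shows "AE x in lborel. P (x + c)"
proof -
  have *: "lborel = distr lborel borel (\<lambda>x. x + c)"
    by (rule lborel_eq_distr_shift)
  from assms obtain N where N: "N \<in> null_sets lborel" "\<And>x. x \<notin> N \<Longrightarrow> P x"
    by (auto elim!: AE_E3)
  have "AE x in distr lborel borel (\<lambda>x. x + c). x \<notin> N"
    unfolding *[symmetric] by (rule AE_not_in[OF N(1)])
  then have "AE x in lborel. x + c \<notin> N"
    using N(1) by (subst (asm) AE_distr_iff) auto
  then show ?thesis
    by (rule eventually_mono) (use N(2) in auto)
qed

section \<open>Continuity of translations in L^1\<close>

definition L1_shift_continuous :: "('a::euclidean_space \<Rightarrow> real) \<Rightarrow> bool" where
  "L1_shift_continuous f \<longleftrightarrow>
     (\<forall>e>0. \<exists>d>0. \<forall>w. norm w < d \<longrightarrow> (LBINT x. \<bar>f (x + w) - f x\<bar>) < e)"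

text \<open>The usual e/3 argument: translation preserves the L^1 distance, so an approximation of
  \<open>f\<close> by \<open>g\<close> is equally good after a shift.\<close>

lemma L1_shift_continuous_limit:
  fixes f :: "'a::euclidean_space \<Rightarrow> real"
  assumes f: "integrable lborel f"
    and s: "\<And>e. e > 0 \<Longrightarrow> \<exists>g. integrable lborel g \<and> L1_shift_continuous g \<and> (LBINT x. \<bar>f x - g x\<bar>) < e"
  shows "L1_shift_continuous f"
  unfolding L1_shift_continuous_def
proof (intro allI impI)
  fix e :: real assume e: "e > 0"
  obtain g where g: "integrable lborel g" "L1_shift_continuous g" "(LBINT x. \<bar>f x - g x\<bar>) < e/3"
    using s[of "e/3"] e by auto
  obtain d where d: "d > 0" "\<And>w. norm w < d \<Longrightarrow> (LBINT x. \<bar>g (x + w) - g x\<bar>) < e/3"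
    using g(2) e unfolding L1_shift_continuous_def by (meson divide_pos_pos zero_less_numeral)
  have [measurable]: "f \<in> borel_measurable borel" "g \<in> borel_measurable borel"
    using f g(1) by auto
  have "(LBINT x. \<bar>f (x + w) - f x\<bar>) < e" if w: "norm w < d" for w
  proof -
    have i1: "integrable lborel (\<lambda>x. \<bar>f (x + w) - g (x + w)\<bar>)"
      using f g(1) by (subst integrable_lborel_shift[where f="\<lambda>x. \<bar>f x - g x\<bar>"]) auto
    have i2: "integrable lborel (\<lambda>x. \<bar>g (x + w) - g x\<bar>)"
      using g(1) by (auto simp: integrable_lborel_shift)
    have i3: "integrable lborel (\<lambda>x. \<bar>f x - g x\<bar>)"
      using f g(1) by auto
    have i4: "integrable lborel (\<lambda>x. \<bar>f (x + w) - f x\<bar>)"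
      using f by (auto simp: integrable_lborel_shift)
    have "(LBINT x. \<bar>f (x + w) - f x\<bar>)
        \<le> (LBINT x. \<bar>f (x + w) - g (x + w)\<bar> + \<bar>g (x + w) - g x\<bar> + \<bar>f x - g x\<bar>)"
      using i1 i2 i3 i4 by (intro integral_mono) auto
    also have "\<dots> = (LBINT x. \<bar>f (x + w) - g (x + w)\<bar>) + (LBINT x. \<bar>g (x + w) - g x\<bar>)
         + (LBINT x. \<bar>f x - g x\<bar>)"
      using i1 i2 i3 by simp
    also have "(LBINT x. \<bar>f (x + w) - g (x + w)\<bar>) = (LBINT x. \<bar>f x - g x\<bar>)"
      by (subst integral_lborel_shift[where f="\<lambda>x. \<bar>f x - g x\<bar>"]) auto
    finally show ?thesis
      using g(3) d(2)[OF w] by linarith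
  qed
  then show "\<exists>d>0. \<forall>w. norm w < d \<longrightarrow> (LBINT x. \<bar>f (x + w) - f x\<bar>) < e"
    using d(1) by blast
qed

text \<open>Squeezing \<open>A\<close> between a closed \<open>T\<close> and an open
  \<open>U\<close> with \<open>U - T\<close> of small measure: a shift shorter than the distance
  from \<open>T\<close> to the complement of \<open>U\<close> changes the indicator only where
  \<open>x\<close> or \<open>x + w\<close> lies in \<open>U - T\<close>.\<close>

lemma L1_shift_continuous_indicator_bounded:
  fixes A :: "'a::euclidean_space set"
  assumes A: "A \<in> sets borel" "bounded A"
  shows "L1_shift_continuous (indicator A)"
  unfolding L1_shift_continuous_def
proof (intro allI impI)
  fix e :: real assume e: "e > 0"
  obtain U where U: "open U" "A \<subseteq> U" "emeasure lebesgue (U - A) < ennreal (e/4)"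
    by (rule sets_lebesgue_outer_open[of A "e/4"]) (use A e in auto)
  obtain T where T: "closed T" "T \<subseteq> A" "emeasure lebesgue (A - T) < ennreal (e/4)"
    by (rule sets_lebesgue_inner_closed[of A "e/4"]) (use A e in auto)
  \<comment> \<open>Boundedness of \<open>A\<close> enters here: a compact set has positive distance
    from a disjoint closed set.\<close>
  have "compact T"
    using T A(2) bounded_subset compact_eq_bounded_closed by blast
  then obtain d where d: "d > 0" "\<And>x y. x \<in> T \<Longrightarrow> y \<in> - U \<Longrightarrow> d \<le> dist x y"
    using separate_compact_closed[of T "- U"] T(2) U(1,2) by (auto simp: closed_Compl) blast
  have [measurable]: "U \<in> sets borel" "T \<in> sets borel" "A \<in> sets borel"
    using U T A by auto
  have UT: "emeasure lborel (U - T) < ennreal (e/2)"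
  proof -
    have "U - T = (U - A) \<union> (A - T)" using T U by auto
    then have "emeasure lborel (U - T) \<le> emeasure lborel (U - A) + emeasure lborel (A - T)"
      by (simp add: emeasure_subadditive)
    also have "\<dots> < ennreal (e/4) + ennreal (e/4)"
      using U(3) T(3) by (intro add_strict_mono) auto
    also have "\<dots> = ennreal (e/2)"
      using e by (simp flip: ennreal_plus)
    finally show ?thesis .
  qed
  then have int: "integrable lborel (indicator (U - T) :: 'a \<Rightarrow> real)"
    by (auto intro!: integrable_real_indicator simp: order.strict_trans)
  have mUT: "measure lborel (U - T) < e/2"
    using UT e unfolding measure_def
    by (metis enn2real_less_iff ennreal_less_top half_gt_zero order.strict_trans)
  have "(LBINT x. \<bar>indicator A (x + w) - indicator A x\<bar>) < e" if w: "norm w < d" for w :: 'a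
  proof -
    have i1: "integrable lborel (\<lambda>x. indicator (U - T) (x + w) :: real)"
      using int by (subst integrable_lborel_shift[where f="indicator (U - T)"]) auto
    have le: "\<bar>indicator A (x + w) - indicator A x\<bar> \<le> (indicator (U - T) (x + w) + indicator (U - T) x :: real)" for x
    proof -
      have "x + w \<in> T \<Longrightarrow> x \<in> U" "x \<in> T \<Longrightarrow> x + w \<in> U"
        using d(2)[of "x + w" x] d(2)[of x "x + w"] w by (auto simp: dist_norm)
      then show ?thesis
        using T(2) U(2) by (auto simp: indicator_def)
    qed
    have "(LBINT x. \<bar>indicator A (x + w) - indicator A x\<bar>)
        \<le> (\<integral>x. indicator (U - T) (x + w) + indicator (U - T) x \<partial>lborel :: real)"
      using i1 int le by (intro Bochner_Integration.integral_mono_AE' AE_I2) auto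
    also have "\<dots> = 2 * measure lborel (U - T)"
      using i1 int integral_lborel_shift[where f="indicator (U - T) :: 'a \<Rightarrow> real" and c=w] by simp
    finally show ?thesis using mUT by simp
  qed
  then show "\<exists>d>0. \<forall>w::'a. norm w < d \<longrightarrow> (LBINT x. \<bar>indicator A (x + w) - indicator A x\<bar>) < e"
    using d(1) by blast
qed

lemma L1_shift_continuous_scale:
  assumes "L1_shift_continuous f"
  shows "L1_shift_continuous (\<lambda>x. c * f x)"
proof (cases "c = 0")
  case False
  show ?thesis
    unfolding L1_shift_continuous_def
  proof (intro allI impI)
    fix e :: real assume "e > 0"
    then obtain d where d: "d > 0" "\<And>w. norm w < d \<Longrightarrow> (LBINT x. \<bar>f (x + w) - f x\<bar>) < e / \<bar>c\<bar>"
      using assms False unfolding L1_shift_continuous_def by (meson divide_pos_pos zero_less_abs_iff)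
    have "(LBINT x. \<bar>c * f (x + w) - c * f x\<bar>) = \<bar>c\<bar> * (LBINT x. \<bar>f (x + w) - f x\<bar>)" for w
      by (simp add: abs_mult flip: right_diff_distrib)
    then show "\<exists>d>0. \<forall>w. norm w < d \<longrightarrow> (LBINT x. \<bar>c * f (x + w) - c * f x\<bar>) < e"
      using d False by (auto simp: field_simps)
  qed
qed (auto simp: L1_shift_continuous_def intro: exI[of _ 1])

text \<open>Density: indicators, then sums, then dominated limits, following the induction principle
  for integrable functions.\<close>

lemma integrable_imp_L1_shift_continuous:
  fixes f :: "'a::euclidean_space \<Rightarrow> real"
  assumes "integrable lborel f"
  shows "L1_shift_continuous f"
  using assms
proof (induction rule: integrable_induct)
  case (base A c)
  have [measurable]: "A \<in> sets borel" using base by auto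
  have int: "integrable lborel (indicator A :: 'a \<Rightarrow> real)"
    using base by auto
  have "L1_shift_continuous (indicator A :: 'a \<Rightarrow> real)"
  proof (rule L1_shift_continuous_limit[OF int])
    fix e :: real assume "e > 0"
    \<comment> \<open>A set of finite measure may be unbounded, so its indicator is approximated by
      indicators of its intersections with balls.\<close>
    have "(\<lambda>n. \<integral>x. \<bar>indicator A x - indicator (A \<inter> cball 0 (real n)) x\<bar> \<partial>lborel :: real) \<longlonglongrightarrow> (\<integral>x. 0 \<partial>(lborel :: 'a measure))"
    proof (rule integral_dominated_convergence[where w="indicator A"])
      show "AE x in lborel. (\<lambda>n. \<bar>indicator A x - indicator (A \<inter> cball 0 (real n)) x :: real\<bar>) \<longlonglongrightarrow> 0"
      proof (intro AE_I2 tendsto_eventually)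
        fix x :: 'a
        obtain N :: nat where "norm x \<le> real N" using real_arch_simple by blast
        then have "\<And>n. n \<ge> N \<Longrightarrow> norm x \<le> real n" by (meson of_nat_mono order_trans)
        then show "\<forall>\<^sub>F n in sequentially. \<bar>indicator A x - indicator (A \<inter> cball 0 (real n)) x :: real\<bar> = 0"
          unfolding eventually_sequentially by (intro exI[of _ N]) (auto simp: indicator_def)
      qed
    qed (use int in \<open>auto simp: indicator_def\<close>)
    then have "(\<lambda>n. \<integral>x. \<bar>indicator A x - indicator (A \<inter> cball 0 (real n)) x :: real\<bar> \<partial>(lborel :: 'a measure)) \<longlonglongrightarrow> 0"
      by simp
    then have "\<forall>\<^sub>F n in sequentially. (\<integral>x. \<bar>indicator A x - indicator (A \<inter> cball 0 (real n)) x :: real\<bar> \<partial>(lborel :: 'a measure)) < e"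
      by (rule order_tendstoD(2)) fact
    then obtain n where n: "(\<integral>x. \<bar>indicator A x - indicator (A \<inter> cball 0 (real n)) x :: real\<bar> \<partial>(lborel :: 'a measure)) < e"
      by (metis (no_types, lifting) eventually_sequentially order_refl)
    have "integrable lborel (indicator (A \<inter> cball 0 (real n)) :: 'a \<Rightarrow> real)"
      using base by (intro Bochner_Integration.integrable_bound[OF int]) (measurable, auto simp: indicator_def)
    moreover have "L1_shift_continuous (indicator (A \<inter> cball 0 (real n)) :: 'a \<Rightarrow> real)"
      by (rule L1_shift_continuous_indicator_bounded) (auto simp: bounded_Int)
    ultimately show "\<exists>g. integrable lborel g \<and> L1_shift_continuous g \<and> (\<integral>x. \<bar>indicator A x - g x\<bar> \<partial>(lborel :: 'a measure)) < e"
      using n by blast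
  qed
  from L1_shift_continuous_scale[OF this, of c] show ?case
    by (simp add: mult.commute)
next
  case (add f g)
  have [measurable]: "f \<in> borel_measurable borel" "g \<in> borel_measurable borel"
    using add by auto
  show ?case
    unfolding L1_shift_continuous_def
  proof (intro allI impI)
    fix e :: real assume e: "e > 0"
    obtain d1 where d1: "d1 > 0" "\<And>w. norm w < d1 \<Longrightarrow> (LBINT x. \<bar>f (x + w) - f x\<bar>) < e/2"
      using add.IH(1) half_gt_zero[OF e] unfolding L1_shift_continuous_def by blast
    obtain d2 where d2: "d2 > 0" "\<And>w. norm w < d2 \<Longrightarrow> (LBINT x. \<bar>g (x + w) - g x\<bar>) < e/2"
      using add.IH(2) half_gt_zero[OF e] unfolding L1_shift_continuous_def by blast
    have "(LBINT x. \<bar>f (x + w) + g (x + w) - (f x + g x)\<bar>) < e" if w: "norm w < min d1 d2" for w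
    proof -
      have i: "integrable lborel (\<lambda>x. \<bar>f (x + w) - f x\<bar>)" "integrable lborel (\<lambda>x. \<bar>g (x + w) - g x\<bar>)"
        "integrable lborel (\<lambda>x. \<bar>f (x + w) + g (x + w) - (f x + g x)\<bar>)"
        using add by (auto simp: integrable_lborel_shift)
      have "(LBINT x. \<bar>f (x + w) + g (x + w) - (f x + g x)\<bar>)
         \<le> (LBINT x. \<bar>f (x + w) - f x\<bar> + \<bar>g (x + w) - g x\<bar>)"
        using i by (intro integral_mono) auto
      also have "\<dots> < e"
        using i d1(2)[of w] d2(2)[of w] w by simp
      finally show ?thesis .
    qed
    then show "\<exists>d>0. \<forall>w. norm w < d \<longrightarrow> (LBINT x. \<bar>f (x + w) + g (x + w) - (f x + g x)\<bar>) < e"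
      using d1(1) d2(1) by (intro exI[of _ "min d1 d2"]) auto
  qed
next
  case (lim f s)
  show ?case
  proof (rule L1_shift_continuous_limit[OF lim.hyps(4)])
    fix e :: real assume e: "e > 0"
    have [measurable]: "f \<in> borel_measurable borel" "\<And>i. s i \<in> borel_measurable borel"
      using lim by auto
    \<comment> \<open>The approximants of the induction principle are bounded by twice
      \<open>\<bar>f x\<bar>\<close>, hence the majorant with factor 3.\<close>
    have "(\<lambda>n. \<integral>x. \<bar>f x - s n x\<bar> \<partial>lborel) \<longlonglongrightarrow> (\<integral>x. 0 \<partial>(lborel :: 'a measure))"
    proof (rule integral_dominated_convergence[where w="\<lambda>x. 3 * \<bar>f x\<bar>"])
      show "AE x in lborel. (\<lambda>n. \<bar>f x - s n x\<bar>) \<longlonglongrightarrow> 0"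
        using lim.hyps(2) by (intro AE_I2) (auto intro!: tendsto_eq_intros)
      show "AE x in lborel. norm \<bar>f x - s i x\<bar> \<le> 3 * \<bar>f x\<bar>" for i
      proof (intro AE_I2)
        fix x :: 'a
        show "norm \<bar>f x - s i x\<bar> \<le> 3 * \<bar>f x\<bar>"
          using lim.hyps(3)[of x i] by (auto simp: abs_le_iff)
      qed
    qed (use lim in auto)
    then have "(\<lambda>n. \<integral>x. \<bar>f x - s n x\<bar> \<partial>lborel) \<longlonglongrightarrow> 0"
      by simp
    then have "\<forall>\<^sub>F n in sequentially. (LBINT x. \<bar>f x - s n x\<bar>) < e"
      by (rule order_tendstoD(2)) fact
    then obtain n where "(LBINT x. \<bar>f x - s n x\<bar>) < e"
      by (metis (no_types, lifting) eventually_sequentially order_refl)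
    then show "\<exists>g. integrable lborel g \<and> L1_shift_continuous g \<and> (LBINT x. \<bar>f x - g x\<bar>) < e"
      using lim by blast
  qed
qed

section \<open>Test functions and the fundamental lemma\<close>

lemma Ck_cmult: "Ck k f \<Longrightarrow> Ck k (\<lambda>x. a * f x)"
proof (induction k arbitrary: f)
  case 0
  then show ?case by (auto intro!: continuous_intros)
next
  case (Suc k)
  have "frechet_derivative (\<lambda>x. a * f x) (at x) = (\<lambda>b. a * frechet_derivative f (at x) b)" for x
    using Suc.prems
    by (intro frechet_derivative_at[symmetric] has_derivative_mult_right) (auto simp: frechet_derivative_works)
  with Suc show ?case by auto
qed

lemma has_derivative_affine:
  fixes f :: "'a::euclidean_space \<Rightarrow> real"
  assumes "f differentiable (at (a *\<^sub>R x + c))"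
  shows "((\<lambda>x. f (a *\<^sub>R x + c)) has_derivative
           (\<lambda>b. a * frechet_derivative f (at (a *\<^sub>R x + c)) b)) (at x)"
proof -
  let ?D = "frechet_derivative f (at (a *\<^sub>R x + c))"
  have D: "(f has_derivative ?D) (at (a *\<^sub>R x + c))"
    using assms by (simp add: frechet_derivative_works)
  have "((\<lambda>x. f (a *\<^sub>R x + c)) has_derivative (\<lambda>b. ?D (a *\<^sub>R b))) (at x)"
    by (rule has_derivative_compose[where f="\<lambda>x. a *\<^sub>R x + c" and g=f]) (use D in \<open>auto intro!: derivative_eq_intros\<close>)
  then show ?thesis
    using has_derivative_linear[OF D] by (simp add: linear_scale)
qed

text \<open>By induction on the order: each partial derivative of the composite is \<open>a\<close>
  times the same affine substitution in a partial derivative of \<open>f\<close>, and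
  \<open>Ck_cmult\<close> takes care of the factor.\<close>

lemma Ck_affine:
  fixes f :: "'a::euclidean_space \<Rightarrow> real"
  shows "Ck k f \<Longrightarrow> Ck k (\<lambda>x. f (a *\<^sub>R x + c))"
proof (induction k arbitrary: f)
  case 0
  then show ?case
    by (auto intro!: continuous_on_compose2[of UNIV f UNIV "\<lambda>x. a *\<^sub>R x + c"] continuous_intros)
next
  case (Suc k)
  have D: "((\<lambda>x. f (a *\<^sub>R x + c)) has_derivative
           (\<lambda>b. a * frechet_derivative f (at (a *\<^sub>R x + c)) b)) (at x)" for x
    using Suc.prems by (intro has_derivative_affine) auto
  have "frechet_derivative (\<lambda>x. f (a *\<^sub>R x + c)) (at x) = (\<lambda>b. a * frechet_derivative f (at (a *\<^sub>R x + c)) b)" for x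
    by (rule frechet_derivative_at[OF D, symmetric])
  moreover have "Ck k (\<lambda>x. a * frechet_derivative f (at (a *\<^sub>R x + c)) b)" if "b \<in> Basis" for b
    using Suc.prems that by (intro Ck_cmult Suc.IH) auto
  ultimately show ?case
    using D by (auto simp: differentiable_def)
qed

lemma grad_affine:
  fixes f :: "real ^ 'n \<Rightarrow> real"
  assumes "f differentiable (at (a *\<^sub>R x + c))"
  shows "grad (\<lambda>x. f (a *\<^sub>R x + c)) x = a *\<^sub>R grad f (a *\<^sub>R x + c)"
  unfolding grad_def
  by (auto simp: vec_eq_iff frechet_derivative_at[OF has_derivative_affine[OF assms], symmetric])

section \<open>Cutoff functions and bounds for test functions\<close>

definition std_bump :: "(real ^ 'n \<Rightarrow> real) \<Rightarrow> bool" where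
  "std_bump \<zeta> \<longleftrightarrow> (\<forall>k. Ck k \<zeta>) \<and> (\<forall>x. 0 \<le> \<zeta> x \<and> \<zeta> x \<le> 1) \<and> (\<forall>x\<in>ball 0 1. \<zeta> x = 1) \<and>
     (\<forall>x. norm x \<ge> 2 \<longrightarrow> \<zeta> x = 0)"

text \<open>Written as an affine substitution rather than through \<open>x - y\<close>, so that
  \<open>Ck_affine\<close> applies to the body as it stands.\<close>

definition bump_at :: "(real ^ 'n \<Rightarrow> real) \<Rightarrow> real ^ 'n \<Rightarrow> real \<Rightarrow> real ^ 'n \<Rightarrow> real" where
  "bump_at \<zeta> y r x = \<zeta> ((1 / r) *\<^sub>R x + (- (1 / r) *\<^sub>R y))"

lemma bump_at_eq: "bump_at \<zeta> y r x = \<zeta> ((1 / r) *\<^sub>R (x - y))"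
  by (simp add: bump_at_def algebra_simps)

text \<open>The only source of smooth cutoffs: the function \<eta> given in the final statement is
  rescaled to a unit profile, from which cutoffs with all other centres and radii are
  derived.\<close>

lemma test_function_std_bump:
  fixes \<eta> :: "real ^ 'n \<Rightarrow> real"
  assumes "r > 0" "\<eta> \<in> test_functions (ball x0 (2 * r))" "\<forall>x. 0 \<le> \<eta> x \<and> \<eta> x \<le> 1"
    "\<forall>x\<in>ball x0 r. \<eta> x = 1"
  shows "std_bump (\<lambda>x. \<eta> (r *\<^sub>R x + x0))"
proof -
  have Ck: "\<And>k. Ck k \<eta>" and sub: "{x. \<eta> x \<noteq> 0} \<subseteq> ball x0 (2 * r)"
    using assms(2) closure_subset[of "{x. \<eta> x \<noteq> 0}"]
    by (auto simp only: test_functions_def compactly_contained_def mem_Collect_eq)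
  have "\<eta> (r *\<^sub>R x + x0) = 0" if "norm x \<ge> 2" for x
  proof -
    have "r *\<^sub>R x + x0 \<notin> ball x0 (2 * r)"
      using that assms(1) by (simp add: dist_norm mult.commute)
    then show ?thesis using sub by blast
  qed
  moreover have "\<eta> (r *\<^sub>R x + x0) = 1" if "norm x < 1" for x
    using that assms(1,4) by (auto simp: dist_norm)
  ultimately show ?thesis
    using assms Ck by (auto simp: std_bump_def intro!: Ck_affine)
qed

lemma
  assumes "std_bump \<zeta>"
  shows bump_at_nonneg: "0 \<le> bump_at \<zeta> y r x" and bump_at_le_1: "bump_at \<zeta> y r x \<le> 1"
    and bump_at_eq_0: "r > 0 \<Longrightarrow> x \<notin> cball y (2 * r) \<Longrightarrow> bump_at \<zeta> y r x = 0"
    and bump_at_eq_1: "r > 0 \<Longrightarrow> x \<in> ball y r \<Longrightarrow> bump_at \<zeta> y r x = 1"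
proof -
  show "0 \<le> bump_at \<zeta> y r x" "bump_at \<zeta> y r x \<le> 1"
    using assms by (auto simp: bump_at_def std_bump_def)
  have n: "norm ((1 / r) *\<^sub>R (x - y)) = dist y x / r" if "r > 0"
    using that by (simp add: dist_norm norm_minus_commute del: scaleR_right_diff_distrib)
  show "bump_at \<zeta> y r x = 0" if "r > 0" "x \<notin> cball y (2 * r)"
    using assms that n unfolding std_bump_def bump_at_eq by (auto simp: pos_le_divide_eq simp del: scaleR_right_diff_distrib)
  show "bump_at \<zeta> y r x = 1" if "r > 0" "x \<in> ball y r"
    using assms that n unfolding std_bump_def bump_at_eq by (auto simp: pos_divide_less_eq simp del: scaleR_right_diff_distrib)
qed

lemma bump_at_test_function:
  assumes "std_bump \<zeta>" "r > 0" "cball y (2 * r) \<subseteq> U"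
  shows "bump_at \<zeta> y r \<in> test_functions U"
proof -
  have "{x. bump_at \<zeta> y r x \<noteq> 0} \<subseteq> cball y (2 * r)"
    using bump_at_eq_0[OF assms(1,2)] by blast
  then have "closure {x. bump_at \<zeta> y r x \<noteq> 0} \<subseteq> cball y (2 * r)"
    by (simp add: closure_minimal)
  moreover have "compact (closure {x. bump_at \<zeta> y r x \<noteq> 0})"
    using calculation by (meson bounded_cball bounded_subset closed_closure compact_eq_bounded_closed)
  moreover have "Ck k (bump_at \<zeta> y r)" for k
    using assms(1) unfolding bump_at_def std_bump_def by (intro Ck_affine) auto
  ultimately show ?thesis
    using assms(3) by (auto simp: test_functions_def compactly_contained_def)
qed

lemma test_function_differentiable: "\<phi> \<in> test_functions U \<Longrightarrow> \<phi> differentiable (at x)"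
  by (auto simp: test_functions_def dest!: spec[of _ "Suc 0"])

lemma test_function_continuous: "\<phi> \<in> test_functions U \<Longrightarrow> continuous_on UNIV \<phi>"
  by (auto simp: test_functions_def dest!: spec[of _ 0])

lemma test_function_continuous_grad:
  "\<phi> \<in> test_functions U \<Longrightarrow> continuous_on UNIV (\<lambda>x. grad \<phi> x $ j)"
  by (auto simp: test_functions_def grad_def axis_in_Basis_iff dest!: spec[of _ "Suc 0"])

lemma
  assumes "\<phi> \<in> test_functions U"
  shows test_function_borel: "\<phi> \<in> borel_measurable borel"
    and test_function_grad_borel: "(\<lambda>x. grad \<phi> x $ j) \<in> borel_measurable borel"
  using test_function_continuous[OF assms] test_function_continuous_grad[OF assms]
  by (auto intro: borel_measurable_continuous_onI)

lemma compact_support_bounded: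
  fixes g :: "'a::euclidean_space \<Rightarrow> real"
  assumes "continuous_on UNIV g" "compact K" "\<And>x. x \<notin> K \<Longrightarrow> g x = 0"
  shows "\<exists>C\<ge>0. \<forall>x. \<bar>g x\<bar> \<le> C"
proof -
  have "bounded (g ` K)"
    using assms(1,2) by (meson compact_continuous_image compact_imp_bounded continuous_on_subset subset_UNIV)
  then obtain C where C: "\<And>x. x \<in> K \<Longrightarrow> \<bar>g x\<bar> \<le> C"
    by (auto simp: bounded_iff)
  then have "\<bar>g x\<bar> \<le> max 0 C" for x
    using assms(3)[of x] C[of x] by (cases "x \<in> K") (auto simp: le_max_iff_disj)
  then show ?thesis by (intro exI[of _ "max 0 C"]) auto
qed

lemma grad_eq_0_outside:
  fixes f :: "real ^ 'n \<Rightarrow> real"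
  assumes "closed K" "\<And>x. x \<notin> K \<Longrightarrow> f x = 0" "x \<notin> K"
  shows "grad f x = 0"
proof -
  have "(f has_derivative (\<lambda>_. 0)) (at x)"
    by (rule has_derivative_transform_within_open[OF has_derivative_const[of 0], of "- K"])
      (use assms in \<open>auto simp: open_Compl\<close>)
  then show ?thesis
    by (simp add: grad_def frechet_derivative_at[symmetric] vec_eq_iff)
qed

lemma test_function_bounded:
  assumes "\<phi> \<in> test_functions U"
  obtains C where "C \<ge> 0" "\<And>x. \<bar>\<phi> x\<bar> \<le> C" "\<And>x j. \<bar>grad \<phi> x $ j\<bar> \<le> C"
proof -
  obtain K where K: "compact K" and z: "\<And>x. x \<notin> K \<Longrightarrow> \<phi> x = 0"
  proof (rule that[of "closure {x. \<phi> x \<noteq> 0}"])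
    show "compact (closure {x. \<phi> x \<noteq> 0})"
      using assms by (simp only: test_functions_def compactly_contained_def mem_Collect_eq)
    show "\<phi> x = 0" if "x \<notin> closure {x. \<phi> x \<noteq> 0}" for x
      using that closure_subset[of "{x. \<phi> x \<noteq> 0}"] by blast
  qed
  have gz: "grad \<phi> x $ j = 0" if "x \<notin> K" for x j
    using grad_eq_0_outside[OF compact_imp_closed[OF K] z that] by simp
  obtain C0 where C0: "C0 \<ge> 0" "\<And>x. \<bar>\<phi> x\<bar> \<le> C0"
    using compact_support_bounded[OF test_function_continuous[OF assms] K z] by auto
  have "\<forall>j. \<exists>C\<ge>0. \<forall>x. \<bar>grad \<phi> x $ j\<bar> \<le> C"
    using compact_support_bounded[OF test_function_continuous_grad[OF assms] K gz] by auto
  then obtain c where c: "\<And>j. c j \<ge> 0" "\<And>j x. \<bar>grad \<phi> x $ j\<bar> \<le> c j"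
    by metis
  have "c j \<le> sum c UNIV" for j
    using c(1) by (intro member_le_sum) auto
  then have "\<bar>grad \<phi> x $ j\<bar> \<le> C0 + sum c UNIV" for x j
    using c(2)[of x j] C0(1) by (smt (verit))
  moreover have "\<bar>\<phi> x\<bar> \<le> C0 + sum c UNIV" for x
    using C0(2)[of x] c(1) by (smt (verit) sum_nonneg)
  moreover have "C0 + sum c UNIV \<ge> 0"
    using C0 c by (intro add_nonneg_nonneg sum_nonneg) auto
  ultimately show ?thesis using that by blast
qed

lemma integrable_indicator_compact: "compact K \<Longrightarrow> integrable lborel (indicator K :: 'a::euclidean_space \<Rightarrow> real)"
  by (intro integrable_real_indicator)
    (auto intro!: emeasure_bounded_finite[unfolded infinity_ennreal_def] compact_imp_bounded borel_compact)

lemma integrable_compact_support: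
  fixes g :: "'a::euclidean_space \<Rightarrow> real"
  assumes "g \<in> borel_measurable borel" "compact K" "\<And>x. \<bar>g x\<bar> \<le> B" "\<And>x. x \<notin> K \<Longrightarrow> g x = 0"
  shows "integrable lborel g"
proof (rule Bochner_Integration.integrable_bound)
  show "integrable lborel (\<lambda>x. B * indicator K x)"
    using integrable_indicator_compact[OF assms(2)] by simp
  show "AE x in lborel. norm (g x) \<le> norm (B * indicator K x)"
  proof (rule AE_I2)
    fix x
    have "\<bar>g x\<bar> \<le> \<bar>B\<bar>" using assms(3)[of x] by linarith
    then show "norm (g x) \<le> norm (B * indicator K x)"
      using assms(4)[of x] by (cases "x \<in> K") auto
  qed
qed (use assms(1) in simp)

section \<open>The fundamental lemma of the calculus of variations\<close>

lemma AE_lborel_locally: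
  fixes U :: "'a::euclidean_space set"
  assumes "\<And>z. z \<in> U \<Longrightarrow> \<exists>d>0. AE x in lborel. x \<in> ball z d \<longrightarrow> P x"
  shows "AE x in lborel. x \<in> U \<longrightarrow> P x"
proof -
  obtain d where d: "\<And>z. z \<in> U \<Longrightarrow> d z > 0 \<and> (AE x in lborel. x \<in> ball z (d z) \<longrightarrow> P x)"
    using assms by metis
  obtain F' where F': "F' \<subseteq> (\<lambda>z. ball z (d z)) ` U" "countable F'" "\<Union>F' = \<Union>((\<lambda>z. ball z (d z)) ` U)"
    by (rule Lindelof[of "(\<lambda>z. ball z (d z)) ` U"]) auto
  have "AE x in lborel. \<forall>B\<in>F'. x \<in> B \<longrightarrow> P x"
    using F'(1,2) d by (subst AE_ball_countable) auto
  then show ?thesis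
  proof (rule eventually_mono)
    fix x assume x: "\<forall>B\<in>F'. x \<in> B \<longrightarrow> P x"
    show "x \<in> U \<longrightarrow> P x"
    proof
      assume "x \<in> U"
      then have "x \<in> \<Union>((\<lambda>z. ball z (d z)) ` U)" using d[of x] by force
      then show "P x" using x F'(3) by blast
    qed
  qed
qed

text \<open>Testing against a cutoff centred at \<open>x\<close> says that a weighted local average
  of \<open>g\<close> around \<open>x\<close> vanishes, while continuity of translations makes these
  averages close to \<open>g\<close> in L^1; hence the L^1 norm of \<open>g\<close> near
  \<open>z\<close> is below every \<open>e\<close>.\<close>

lemma fundamental_lemma_calculus_of_variations:
  fixes g \<zeta> :: "real ^ 'n \<Rightarrow> real"
  assumes \<zeta>: "std_bump \<zeta>" and g: "integrable lborel g" and U: "open U"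
    and ort: "\<And>\<phi>. \<phi> \<in> test_functions U \<Longrightarrow> (LBINT x. g x * \<phi> x) = 0"
  shows "AE x in lborel. x \<in> U \<longrightarrow> g x = 0"
proof (rule AE_lborel_locally)
  fix z assume "z \<in> U"
  then obtain d0 where d0: "d0 > 0" "ball z d0 \<subseteq> U"
    using U by (auto simp: open_contains_ball)
  \<comment> \<open>With a third of \<open>d0\<close>, cutoffs supported within distance
    \<open>d\<close> of a point of \<open>ball z d\<close> stay inside \<open>U\<close>.\<close>
  define d where "d = d0 / 3"
  have d: "d > 0" using d0 by (simp add: d_def)
  have [measurable]: "ball z d \<in> sets borel" by simp
  have [measurable]: "g \<in> borel_measurable borel" using g by auto
  have [measurable]: "\<zeta> \<in> borel_measurable borel"
    using \<zeta> by (auto simp: std_bump_def intro!: borel_measurable_continuous_onI dest!: spec[of _ 0])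
  have \<zeta>1: "\<And>x. 0 \<le> \<zeta> x" "\<And>x. \<zeta> x \<le> 1" "\<And>x. norm x \<ge> 2 \<Longrightarrow> \<zeta> x = 0" "\<And>x. norm x < 1 \<Longrightarrow> \<zeta> x = 1"
    using \<zeta> by (auto simp: std_bump_def)
  have est: "(\<integral>\<^sup>+x. indicator (ball z d) x * ennreal \<bar>g x\<bar> \<partial>lborel) \<le> ennreal e" if e: "e > 0" for e
  proof -
    obtain \<delta> where \<delta>: "\<delta> > 0" "\<And>w. norm w < \<delta> \<Longrightarrow> (LBINT x. \<bar>g (x + w) - g x\<bar>) < e"
      using integrable_imp_L1_shift_continuous[OF g] e unfolding L1_shift_continuous_def by meson
    define \<epsilon> where "\<epsilon> = min d \<delta> / 2"
    have \<epsilon>: "\<epsilon> > 0" "2 * \<epsilon> \<le> d" "2 * \<epsilon> \<le> \<delta>" using d \<delta> by (auto simp: \<epsilon>_def)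
    define k where "k w = \<zeta> ((1 / \<epsilon>) *\<^sub>R w)" for w
    have [measurable]: "k \<in> borel_measurable borel" unfolding k_def by measurable
    have k: "0 \<le> k w" "k w \<le> 1" "norm w \<ge> 2 * \<epsilon> \<Longrightarrow> k w = 0" "norm w < \<epsilon> \<Longrightarrow> k w = 1" for w
      using \<epsilon>(1) \<zeta>1 by (auto simp: k_def field_simps)
    have ki: "integrable lborel k"
      by (rule integrable_compact_support[OF _ compact_cball[of 0 "2 * \<epsilon>"], of _ 1]) (use k in \<open>auto simp: not_le\<close>)
    define Z where "Z = (LBINT x. k x)"
    have Zn: "(\<integral>\<^sup>+x. ennreal (k x) \<partial>lborel) = ennreal Z"
      unfolding Z_def using k by (intro nn_integral_eq_integral ki) auto
    have Zpos: "Z > 0"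
    proof -
      have "0 < measure lborel (ball 0 \<epsilon> :: (real ^ 'n) set)"
        using \<epsilon>(1) by (simp add: content_ball_pos)
      also have "\<dots> = (\<integral>x. indicator (ball 0 \<epsilon>) x \<partial>(lborel :: (real ^ 'n) measure))"
        by simp
      also have "\<dots> \<le> Z"
        unfolding Z_def
      proof (rule Bochner_Integration.integral_mono)
        show "integrable lborel (indicator (ball 0 \<epsilon>) :: real ^ 'n \<Rightarrow> real)"
          by (intro integrable_real_indicator) (auto intro!: emeasure_bounded_finite[unfolded infinity_ennreal_def])
      qed (use k ki in \<open>auto simp: indicator_def\<close>)
      finally show ?thesis .
    qed
    have pt: "\<bar>g x\<bar> * Z \<le> (LBINT w. \<bar>g (x + w) - g x\<bar> * k w) \<and> integrable lborel (\<lambda>w. \<bar>g (x + w) - g x\<bar> * k w)"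
      if x: "x \<in> ball z d" for x
    proof -
      have "cball x (2 * \<epsilon>) \<subseteq> U"
      proof
        fix y assume "y \<in> cball x (2 * \<epsilon>)"
        then have "dist z y \<le> dist z x + dist x y" "dist x y \<le> d"
          using \<epsilon> by (auto intro: dist_triangle)
        then show "y \<in> U"
          using x d0 by (auto simp: d_def)
      qed
      \<comment> \<open>Since the average of \<open>g\<close> weighted by \<open>k\<close> around
        \<open>x\<close> is zero, \<open>g x * Z\<close> equals minus the weighted integral of
        \<open>g (x + w) - g x\<close>.\<close>
      then have "(LBINT y. g y * bump_at \<zeta> x \<epsilon> y) = 0"
        by (intro ort bump_at_test_function \<zeta> \<epsilon>)
      then have "(LBINT y. g y * k (y - x)) = 0"
        by (simp add: bump_at_eq k_def)
      moreover have "(LBINT y. g y * k (y - x)) = (LBINT w. g (w + x) * k w)"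
        by (subst integral_lborel_shift[where c=x, symmetric]) auto
      ultimately have 0: "(LBINT w. g (x + w) * k w) = 0"
        by (simp add: add.commute)
      have gx: "integrable lborel (\<lambda>w. g (w + x))"
        using g by (subst integrable_lborel_shift) auto
      have i1: "integrable lborel (\<lambda>w. g (x + w) * k w)"
      proof (rule Bochner_Integration.integrable_bound[OF gx])
        have "\<bar>g (x + w)\<bar> * \<bar>k w\<bar> \<le> \<bar>g (x + w)\<bar>" for w
          using k[of w] by (intro mult_left_le) auto
        then show "AE w in lborel. norm (g (x + w) * k w) \<le> norm (g (w + x))"
          unfolding real_norm_def abs_mult add.commute[of _ x] by (intro AE_I2)
      qed measurable
      have i2: "integrable lborel (\<lambda>w. g x * k w)" using ki by simp
      have i3: "integrable lborel (\<lambda>w. (g (x + w) - g x) * k w)"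
        using i1 i2 by (simp add: left_diff_distrib)
      have "g x * Z = - (LBINT w. (g (x + w) - g x) * k w)"
        using i1 i2 0 by (simp add: left_diff_distrib Z_def)
      then have "\<bar>g x * Z\<bar> \<le> (LBINT w. \<bar>(g (x + w) - g x) * k w\<bar>)"
        using integral_abs_bound[of lborel "\<lambda>w. (g (x + w) - g x) * k w"] by (simp only: abs_minus_cancel)
      then show ?thesis
        using Zpos k i3[THEN integrable_abs] by (simp add: abs_mult)
    qed
    have "(\<integral>\<^sup>+x. indicator (ball z d) x * ennreal \<bar>g x\<bar> \<partial>lborel) * ennreal Z
      = (\<integral>\<^sup>+x. indicator (ball z d) x * ennreal \<bar>g x\<bar> * ennreal Z \<partial>lborel)"
      by (rule nn_integral_multc[symmetric]) simp
    also have "\<dots> \<le> (\<integral>\<^sup>+x. (\<integral>\<^sup>+w. ennreal (\<bar>g (x + w) - g x\<bar> * k w) \<partial>lborel) \<partial>lborel)"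
    proof (rule nn_integral_mono)
      fix x :: "real ^ 'n"
      show "indicator (ball z d) x * ennreal \<bar>g x\<bar> * ennreal Z \<le> (\<integral>\<^sup>+w. ennreal (\<bar>g (x + w) - g x\<bar> * k w) \<partial>lborel)"
      proof (cases "x \<in> ball z d")
        case True
        with pt[OF True] k Zpos show ?thesis
          by (subst nn_integral_eq_integral) (auto simp flip: ennreal_mult intro!: ennreal_leI)
      qed simp
    qed
    \<comment> \<open>Tonelli turns the pointwise oscillations into L^1 norms of
      \<open>g (x + w) - g x\<close> for fixed \<open>w\<close>, each below \<open>e\<close> because
      the kernel only sees shifts shorter than \<open>\<delta>\<close>.\<close>
    also have "\<dots> = (\<integral>\<^sup>+w. (\<integral>\<^sup>+x. ennreal (\<bar>g (x + w) - g x\<bar> * k w) \<partial>lborel) \<partial>lborel)"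
      by (rule lborel_pair.Fubini'[symmetric]) measurable
    also have "\<dots> \<le> (\<integral>\<^sup>+w. ennreal e * ennreal (k w) \<partial>lborel)"
    proof (rule nn_integral_mono)
      fix w :: "real ^ 'n"
      show "(\<integral>\<^sup>+x. ennreal (\<bar>g (x + w) - g x\<bar> * k w) \<partial>lborel) \<le> ennreal e * ennreal (k w)"
      proof (cases "norm w < 2 * \<epsilon>")
        case True
        have "integrable lborel (\<lambda>x. \<bar>g (x + w) - g x\<bar> * k w)"
          using g by (auto simp: integrable_lborel_shift)
        then have "(\<integral>\<^sup>+x. ennreal (\<bar>g (x + w) - g x\<bar> * k w) \<partial>lborel) = ennreal ((LBINT x. \<bar>g (x + w) - g x\<bar>) * k w)"
          using k by (subst nn_integral_eq_integral) auto
        also have "\<dots> \<le> ennreal (e * k w)"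
          using \<delta>(2)[of w] True \<epsilon> k by (intro ennreal_leI mult_right_mono) auto
        finally show ?thesis using e k by (simp add: ennreal_mult)
      qed (use k in auto)
    qed
    also have "\<dots> = ennreal e * ennreal Z"
      using Zn by (subst nn_integral_cmult) auto
    finally show ?thesis
      using Zpos by (simp add: ennreal_mult_le_mult_iff mult.commute)
  qed
  have "(\<integral>\<^sup>+x. indicator (ball z d) x * ennreal \<bar>g x\<bar> \<partial>lborel) = 0"
  proof (rule antisym)
    show "(\<integral>\<^sup>+x. indicator (ball z d) x * ennreal \<bar>g x\<bar> \<partial>lborel) \<le> 0"
      by (rule ennreal_le_epsilon) (use est in auto)
  qed simp
  then have "AE x in lborel. indicator (ball z d) x * ennreal \<bar>g x\<bar> = 0"
    by (subst (asm) nn_integral_0_iff_AE) simp_all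
  then show "\<exists>d>0. AE x in lborel. x \<in> ball z d \<longrightarrow> g x = 0"
    using d by (intro exI[of _ d]) (auto simp: indicator_def split: if_splits elim!: eventually_mono)
qed

section \<open>Weak derivatives along lines\<close>

lemma dist_add_le: "dist z (x + y) \<le> dist z x + norm (y :: 'a::real_normed_vector)"
  using dist_triangle[of z "x + y" x] by (simp add: dist_norm)

text \<open>Integrals range over the whole space because the test functions vanish outside
  \<open>U\<close>. One direction at a time is recorded, as the later arguments run along coordinate
  lines.\<close>

definition weak_pd :: "(real ^ 'n) set \<Rightarrow> (real ^ 'n \<Rightarrow> real) \<Rightarrow> (real ^ 'n \<Rightarrow> real) \<Rightarrow> 'n \<Rightarrow> bool" where
  "weak_pd U u p j \<longleftrightarrow>
     (\<forall>\<phi>\<in>test_functions U. (LBINT x. u x * grad \<phi> x $ j) = - (LBINT x. p x * \<phi> x))"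

text \<open>The increment over a segment that the fundamental theorem of calculus predicts for a
  function with derivative \<open>p\<close> in direction \<open>j\<close>.\<close>

definition line_int :: "(real ^ 'n \<Rightarrow> real) \<Rightarrow> 'n \<Rightarrow> real \<Rightarrow> real ^ 'n \<Rightarrow> real" where
  "line_int p j s x = (LBINT r. indicator {0..s} r * p (x + r *\<^sub>R axis j 1))"

lemma has_real_derivative_line:
  fixes f :: "real ^ 'n \<Rightarrow> real"
  assumes "f differentiable (at (x + r *\<^sub>R axis j 1))"
  shows "((\<lambda>r. f (x + r *\<^sub>R axis j 1)) has_real_derivative grad f (x + r *\<^sub>R axis j 1) $ j) (at r)"
proof -
  let ?D = "frechet_derivative f (at (x + r *\<^sub>R axis j 1))"
  have D: "(f has_derivative ?D) (at (x + r *\<^sub>R axis j 1))"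
    using assms by (simp add: frechet_derivative_works)
  have "((\<lambda>r. f (x + r *\<^sub>R axis j 1)) has_derivative (\<lambda>h. ?D (h *\<^sub>R axis j 1))) (at r)"
    by (rule has_derivative_compose[where f="\<lambda>r. x + r *\<^sub>R axis j 1" and g=f])
      (use D in \<open>auto intro!: derivative_eq_intros\<close>)
  then show ?thesis
    using has_derivative_linear[OF D]
    by (simp add: has_field_derivative_def linear_scale grad_def mult_commute_abs)
qed

text \<open>Tonelli and translation invariance: the norm on the product is the L^1 norm of
  \<open>p\<close> times the length of the interval.\<close>

lemma line_prod_integrable:
  fixes p :: "real ^ 'n \<Rightarrow> real"
  assumes p: "integrable lborel p"
  shows "integrable (lborel \<Otimes>\<^sub>M lborel) (\<lambda>(x, r). indicator {0..s} r * p (x + r *\<^sub>R axis j 1))"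
proof (rule integrableI_bounded)
  have [measurable]: "p \<in> borel_measurable borel" using p by auto
  show "(\<lambda>(x, r). indicator {0..s} r * p (x + r *\<^sub>R axis j 1)) \<in> borel_measurable (lborel \<Otimes>\<^sub>M lborel)"
    by measurable
  have "(\<integral>\<^sup>+ z. ennreal (norm (case z of (x, r) \<Rightarrow> indicator {0..s} r * p (x + r *\<^sub>R axis j 1))) \<partial>(lborel \<Otimes>\<^sub>M lborel))
    = (\<integral>\<^sup>+r. (\<integral>\<^sup>+x. ennreal (indicator {0..s} r * \<bar>p (x + r *\<^sub>R axis j 1)\<bar>) \<partial>lborel) \<partial>lborel)"
    by (subst lborel_pair.nn_integral_snd[symmetric]) (measurable, simp add: abs_mult)
  also have "\<dots> = (\<integral>\<^sup>+r. indicator {0..s} r * (\<integral>\<^sup>+x. ennreal \<bar>p x\<bar> \<partial>lborel) \<partial>lborel)"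
  proof (rule nn_integral_cong)
    fix r :: real
    have "(\<integral>\<^sup>+x. ennreal (indicator {0..s} r * \<bar>p (x + r *\<^sub>R axis j 1)\<bar>) \<partial>lborel)
      = (\<integral>\<^sup>+x. indicator {0..s} r * ennreal \<bar>p (x + r *\<^sub>R axis j 1)\<bar> \<partial>lborel)"
      by (auto intro!: nn_integral_cong simp: indicator_def)
    also have "\<dots> = indicator {0..s} r * (\<integral>\<^sup>+x. ennreal \<bar>p (x + r *\<^sub>R axis j 1)\<bar> \<partial>lborel)"
      by (rule nn_integral_cmult) simp
    also have "(\<integral>\<^sup>+x. ennreal \<bar>p (x + r *\<^sub>R axis j 1)\<bar> \<partial>lborel) = (\<integral>\<^sup>+x. ennreal \<bar>p x\<bar> \<partial>lborel)"
      by (rule nn_integral_lborel_shift) simp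
    finally show "(\<integral>\<^sup>+x. ennreal (indicator {0..s} r * \<bar>p (x + r *\<^sub>R axis j 1)\<bar>) \<partial>lborel)
       = indicator {0..s} r * (\<integral>\<^sup>+x. ennreal \<bar>p x\<bar> \<partial>lborel)" .
  qed
  also have "\<dots> = (\<integral>\<^sup>+x. ennreal \<bar>p x\<bar> \<partial>lborel) * emeasure lborel {0..s}"
    by (subst nn_integral_multc) (auto simp: mult.commute)
  also have "\<dots> < \<infinity>"
    using p by (auto simp: integrable_iff_bounded ennreal_mult_less_top emeasure_lborel_Icc_eq)
  finally show "(\<integral>\<^sup>+ z. ennreal (norm (case z of (x, r) \<Rightarrow> indicator {0..s} r * p (x + r *\<^sub>R axis j 1))) \<partial>(lborel \<Otimes>\<^sub>M lborel)) < \<infinity>" .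
qed

lemma
  fixes p :: "real ^ 'n \<Rightarrow> real"
  assumes p: "integrable lborel p"
  shows line_int_integrable: "integrable lborel (line_int p j s)"
    and line_integrable_AE: "AE x in lborel. integrable lborel (\<lambda>r. indicator {0..s} r * p (x + r *\<^sub>R axis j 1))"
  using lborel_pair.integrable_fst'[OF line_prod_integrable[OF p, where s=s and j=j]]
    lborel_pair.AE_integrable_fst'[OF line_prod_integrable[OF p, where s=s and j=j]]
  by (simp_all add: line_int_def[abs_def])

lemma test_function_shift:
  fixes \<phi> :: "real ^ 'n \<Rightarrow> real"
  assumes \<phi>: "\<phi> \<in> test_functions W" and sub: "\<And>x. x \<in> W \<Longrightarrow> x + c \<in> \<Omega>"
  shows "(\<lambda>x. \<phi> (x - c)) \<in> test_functions \<Omega>"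
proof -
  have eq: "(\<lambda>x. \<phi> (x - c)) = (\<lambda>x. \<phi> (1 *\<^sub>R x + (- c)))" by simp
  have "{x. \<phi> (x - c) \<noteq> 0} = (+) c ` {x. \<phi> x \<noteq> 0}"
    by (force simp: image_iff intro: exI[of _ "_ - c"])
  then have *: "closure {x. \<phi> (x - c) \<noteq> 0} = (+) c ` closure {x. \<phi> x \<noteq> 0}"
    by (simp only: closure_translation)
  have "compact (closure {x. \<phi> x \<noteq> 0})" "closure {x. \<phi> x \<noteq> 0} \<subseteq> W" "\<And>k. Ck k \<phi>"
    using \<phi> by (simp_all only: test_functions_def compactly_contained_def mem_Collect_eq)
  then have "compact ((+) c ` closure {x. \<phi> x \<noteq> 0})" "(+) c ` closure {x. \<phi> x \<noteq> 0} \<subseteq> \<Omega>"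
    using sub by (intro compact_translation, simp, auto simp: add.commute[of c])
  moreover have "Ck k (\<lambda>x. \<phi> (x - c))" for k
    unfolding eq by (intro Ck_affine \<open>Ck k \<phi>\<close>)
  ultimately show ?thesis
    by (simp only: test_functions_def compactly_contained_def mem_Collect_eq *) blast
qed

lemma grad_shift: "f differentiable (at (x - c)) \<Longrightarrow> grad (\<lambda>x. f (x - c)) x = grad f (x - c)"
  using grad_affine[of f 1 x "- c"] by simp

text \<open>Weak differentiability becomes the fundamental theorem of calculus on segments: the weak
  identity is used for all translates of a test function along the segment and integrated over the
  shift; the fundamental lemma then removes the test function.\<close>

lemma weak_pd_line:
  fixes u p \<zeta> :: "real ^ 'n \<Rightarrow> real"
  assumes \<zeta>: "std_bump \<zeta>" and u: "integrable lborel u" and p: "integrable lborel p"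
    and wd: "weak_pd \<Omega> u p j" and W: "open W" and s: "s \<ge> 0"
    and sub: "\<And>x r. x \<in> W \<Longrightarrow> 0 \<le> r \<Longrightarrow> r \<le> s \<Longrightarrow> x + r *\<^sub>R axis j 1 \<in> \<Omega>"
  shows "AE x in lborel. x \<in> W \<longrightarrow> u (x + s *\<^sub>R axis j 1) - u x = line_int p j s x"
proof -
  let ?e = "axis j 1 :: real ^ 'n"
  have [measurable]: "u \<in> borel_measurable borel" "p \<in> borel_measurable borel" using u p by auto
  have iu: "integrable lborel (\<lambda>x. u (x + s *\<^sub>R ?e))"
    using u by (subst integrable_lborel_shift) auto
  have "AE x in lborel. x \<in> W \<longrightarrow> u (x + s *\<^sub>R ?e) - u x - line_int p j s x = 0"
  proof (rule fundamental_lemma_calculus_of_variations[OF \<zeta> _ W])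
    show "integrable lborel (\<lambda>x. u (x + s *\<^sub>R ?e) - u x - line_int p j s x)"
      using u iu line_int_integrable[OF p] by simp
    fix \<phi> assume \<phi>: "\<phi> \<in> test_functions W"
    obtain C where C: "C \<ge> 0" "\<And>x. \<bar>\<phi> x\<bar> \<le> C" "\<And>x j. \<bar>grad \<phi> x $ j\<bar> \<le> C"
      using test_function_bounded[OF \<phi>] by blast
    have [measurable]: "\<phi> \<in> borel_measurable borel" "(\<lambda>x. grad \<phi> x $ j) \<in> borel_measurable borel"
      by (rule test_function_borel[OF \<phi>] test_function_grad_borel[OF \<phi>])+
    have gm[measurable]: "(\<lambda>(x, r). grad \<phi> (x - r *\<^sub>R ?e) $ j) \<in> borel_measurable (lborel \<Otimes>\<^sub>M lborel)"
      using measurable_compose[of "\<lambda>(x, r::real). x - r *\<^sub>R ?e" "lborel \<Otimes>\<^sub>M lborel" borel "\<lambda>x. grad \<phi> x $ j" borel]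
      by (simp add: case_prod_unfold)
    have wdr: "(LBINT x. u x * grad \<phi> (x - r *\<^sub>R ?e) $ j) = - (LBINT x. p x * \<phi> (x - r *\<^sub>R ?e))"
      if "0 \<le> r" "r \<le> s" for r
    proof -
      have "(\<lambda>x. \<phi> (x - r *\<^sub>R ?e)) \<in> test_functions \<Omega>"
        by (rule test_function_shift[OF \<phi>]) (use sub that in auto)
      then show ?thesis
        using wd unfolding weak_pd_def
        by (auto simp: grad_shift[OF test_function_differentiable[OF \<phi>]])
    qed
    have iu2: "integrable (lborel \<Otimes>\<^sub>M lborel) (\<lambda>(x, r). u x * (indicator {0..s} r :: real))"
    proof (rule integrableI_bounded)
      have "(\<integral>\<^sup>+ z. ennreal (norm (case z of (x, r) \<Rightarrow> u x * (indicator {0..s} r :: real))) \<partial>(lborel \<Otimes>\<^sub>M lborel))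
        = (\<integral>\<^sup>+x. (\<integral>\<^sup>+r. ennreal \<bar>u x\<bar> * indicator {0..s} r \<partial>lborel) \<partial>lborel)"
        by (subst lborel.nn_integral_fst[symmetric])
          (auto intro!: nn_integral_cong simp: abs_mult indicator_def)
      also have "\<dots> = (\<integral>\<^sup>+x. ennreal \<bar>u x\<bar> \<partial>lborel) * emeasure lborel {0..s}"
        by (simp add: nn_integral_cmult nn_integral_multc)
      also have "\<dots> < \<infinity>"
        using u by (auto simp: integrable_iff_bounded ennreal_mult_less_top emeasure_lborel_Icc_eq)
      finally show "(\<integral>\<^sup>+ z. ennreal (norm (case z of (x, r) \<Rightarrow> u x * (indicator {0..s} r :: real))) \<partial>(lborel \<Otimes>\<^sub>M lborel)) < \<infinity>" .
    qed measurable
    have i1: "integrable (lborel \<Otimes>\<^sub>M lborel) (\<lambda>(x, r). indicator {0..s} r * (u x * grad \<phi> (x - r *\<^sub>R ?e) $ j))"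
    proof (rule Bochner_Integration.integrable_bound[OF integrable_mult_left[OF iu2, of C]])
      show "(\<lambda>(x, r). indicator {0..s} r * (u x * grad \<phi> (x - r *\<^sub>R ?e) $ j)) \<in> borel_measurable (lborel \<Otimes>\<^sub>M lborel)"
        using gm by (auto simp: case_prod_unfold)
      show "AE z in lborel \<Otimes>\<^sub>M lborel. norm (case z of (x, r) \<Rightarrow> indicator {0..s} r * (u x * grad \<phi> (x - r *\<^sub>R ?e) $ j))
         \<le> norm ((case z of (x, r) \<Rightarrow> u x * (indicator {0..s} r :: real)) * C)"
        using C by (intro AE_I2) (auto simp: abs_mult indicator_def mult_left_mono)
    qed
    \<comment> \<open>The shift is integrated out by the classical fundamental theorem for
      \<open>\<phi>\<close>, which leaves only boundary values.\<close>
    have inner: "(LBINT r. indicator {0..s} r * (u x * grad \<phi> (x - r *\<^sub>R ?e) $ j)) = u x * (\<phi> x - \<phi> (x - s *\<^sub>R ?e))" for x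
    proof -
      have "(LBINT r. grad \<phi> (x - r *\<^sub>R ?e) $ j * indicator {0..s} r) = - \<phi> (x - s *\<^sub>R ?e) - (- \<phi> (x - 0 *\<^sub>R ?e))"
      proof (rule integral_FTC_Icc_real[OF s])
        fix r
        have "((\<lambda>r. \<phi> (x + r *\<^sub>R ?e)) has_real_derivative grad \<phi> (x + (- r) *\<^sub>R ?e) $ j) (at (- r))"
          by (rule has_real_derivative_line[OF test_function_differentiable[OF \<phi>]])
        then have "((\<lambda>r. \<phi> (x + (- r) *\<^sub>R ?e)) has_real_derivative grad \<phi> (x + (- r) *\<^sub>R ?e) $ j * - 1) (at r)"
          by (rule DERIV_chain2) (auto intro!: derivative_eq_intros)
        then show "((\<lambda>r. - \<phi> (x - r *\<^sub>R ?e)) has_real_derivative grad \<phi> (x - r *\<^sub>R ?e) $ j) (at r)"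
          by (auto intro!: derivative_eq_intros)
        have "continuous_on UNIV (\<lambda>r. grad \<phi> (x - r *\<^sub>R ?e) $ j)"
          by (rule continuous_on_compose2[OF test_function_continuous_grad[OF \<phi>, of j]]) (auto intro!: continuous_intros)
        then show "isCont (\<lambda>r. grad \<phi> (x - r *\<^sub>R ?e) $ j) r"
          by (simp add: continuous_on_eq_continuous_at)
      qed
      moreover have "(LBINT r. indicator {0..s} r * (u x * grad \<phi> (x - r *\<^sub>R ?e) $ j))
        = u x * (LBINT r. grad \<phi> (x - r *\<^sub>R ?e) $ j * indicator {0..s} r)"
        by (subst integral_mult_right_zero[symmetric]) (simp add: ac_simps)
      ultimately show ?thesis by simp
    qed
    have b1: "integrable lborel (\<lambda>x. u x * \<phi> (x - c))" for c
      by (rule Bochner_Integration.integrable_bound[OF integrable_mult_left[OF u, of C]])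
        (use C in \<open>auto simp: abs_mult mult_left_mono intro!: AE_I2\<close>)
    have b2: "integrable lborel (\<lambda>x. u (x + c) * \<phi> x)" for c
      using b1[of c] integrable_lborel_shift[of "\<lambda>x. u x * \<phi> (x - c)" c] by simp
    have A: "(LBINT r. indicator {0..s} r * (LBINT x. u x * grad \<phi> (x - r *\<^sub>R ?e) $ j))
       = (LBINT x. u x * \<phi> x) - (LBINT x. u (x + s *\<^sub>R ?e) * \<phi> x)"
    proof -
      have "(LBINT r. indicator {0..s} r * (LBINT x. u x * grad \<phi> (x - r *\<^sub>R ?e) $ j))
         = (LBINT r. (LBINT x. indicator {0..s} r * (u x * grad \<phi> (x - r *\<^sub>R ?e) $ j)))"
        by simp
      also have "\<dots> = (LBINT x. (LBINT r. indicator {0..s} r * (u x * grad \<phi> (x - r *\<^sub>R ?e) $ j)))"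
        using i1 by (rule lborel_pair.Fubini_integral)
      also have "\<dots> = (LBINT x. u x * \<phi> x - u x * \<phi> (x - s *\<^sub>R ?e))"
        by (simp add: inner right_diff_distrib)
      also have "\<dots> = (LBINT x. u x * \<phi> x) - (LBINT x. u x * \<phi> (x - s *\<^sub>R ?e))"
        using b1[of 0] b1[of "s *\<^sub>R ?e"] by simp
      also have "(LBINT x. u x * \<phi> (x - s *\<^sub>R ?e)) = (LBINT x. u (x + s *\<^sub>R ?e) * \<phi> x)"
        using integral_lborel_shift[of "\<lambda>x. u x * \<phi> (x - s *\<^sub>R ?e)" "s *\<^sub>R ?e"] by simp
      finally show ?thesis .
    qed
    have i2: "integrable (lborel \<Otimes>\<^sub>M lborel) (\<lambda>(x, r). indicator {0..s} r * p (x + r *\<^sub>R ?e) * \<phi> x)"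
      by (rule Bochner_Integration.integrable_bound[OF integrable_mult_left[OF line_prod_integrable[OF p, where s=s and j=j], of C]])
        (use C in \<open>auto simp: abs_mult mult_left_mono case_prod_unfold intro!: AE_I2\<close>)
    \<comment> \<open>The other side of the same integration: moving the shift from
      \<open>\<phi>\<close> onto \<open>p\<close> produces the line integral.\<close>
    have B: "(LBINT r. indicator {0..s} r * (LBINT x. p x * \<phi> (x - r *\<^sub>R ?e))) = (LBINT x. line_int p j s x * \<phi> x)"
    proof -
      have "(LBINT r. indicator {0..s} r * (LBINT x. p x * \<phi> (x - r *\<^sub>R ?e)))
         = (LBINT r. (LBINT x. indicator {0..s} r * p (x + r *\<^sub>R ?e) * \<phi> x))"
      proof (rule Bochner_Integration.integral_cong)
        fix r :: real
        have "(LBINT x. p x * \<phi> (x - r *\<^sub>R ?e)) = (LBINT x. p (x + r *\<^sub>R ?e) * \<phi> x)"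
          using integral_lborel_shift[of "\<lambda>x. p x * \<phi> (x - r *\<^sub>R ?e)" "r *\<^sub>R ?e"] by simp
        then show "indicator {0..s} r * (LBINT x. p x * \<phi> (x - r *\<^sub>R ?e)) = (LBINT x. indicator {0..s} r * p (x + r *\<^sub>R ?e) * \<phi> x)"
          by (simp add: mult.assoc)
      qed simp
      also have "\<dots> = (LBINT x. (LBINT r. indicator {0..s} r * p (x + r *\<^sub>R ?e) * \<phi> x))"
        using i2 by (rule lborel_pair.Fubini_integral)
      finally show ?thesis by (simp add: line_int_def)
    qed
    have "(LBINT r. indicator {0..s} r * (LBINT x. u x * grad \<phi> (x - r *\<^sub>R ?e) $ j))
      = (LBINT r. - (indicator {0..s} r * (LBINT x. p x * \<phi> (x - r *\<^sub>R ?e))))"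
      by (rule Bochner_Integration.integral_cong) (auto simp: indicator_def wdr)
    then have AB: "(LBINT x. u x * \<phi> x) - (LBINT x. u (x + s *\<^sub>R ?e) * \<phi> x) = - (LBINT x. line_int p j s x * \<phi> x)"
      using A B by simp
    have b3: "integrable lborel (\<lambda>x. line_int p j s x * \<phi> x)"
      by (rule Bochner_Integration.integrable_bound[OF integrable_mult_left[OF line_int_integrable[OF p, of j s], of C]])
        (use C borel_measurable_integrable[OF line_int_integrable[OF p, of j s]] in \<open>auto simp: abs_mult mult_left_mono intro!: AE_I2\<close>)
    show "(LBINT x. (u (x + s *\<^sub>R ?e) - u x - line_int p j s x) * \<phi> x) = 0"
      using AB b1[of 0] b2[of "s *\<^sub>R ?e"] b3 by (simp add: left_diff_distrib)
  qed
  then show ?thesis by (rule eventually_mono) auto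
qed

text \<open>A segment average is an average of translates, so its L^1 distance from \<open>q\<close>
  is controlled by the distances between \<open>q\<close> and its translates by at most the length
  of the segment.\<close>

lemma line_int_average:
  fixes q :: "real ^ 'n \<Rightarrow> real"
  assumes q: "integrable lborel q"
  shows "(\<lambda>n. \<integral>x. \<bar>real (Suc n) * line_int q j (1 / real (Suc n)) x - q x\<bar> \<partial>lborel) \<longlonglongrightarrow> 0"
proof (rule LIMSEQ_I)
  fix e :: real assume e: "e > 0"
  let ?e = "axis j 1 :: real ^ 'n"
  have [measurable]: "q \<in> borel_measurable borel" using q by auto
  obtain d where d: "d > 0" "\<And>w. norm w < d \<Longrightarrow> (LBINT x. \<bar>q (x + w) - q x\<bar>) < e / 2"
    using integrable_imp_L1_shift_continuous[OF q] half_gt_zero[OF e] unfolding L1_shift_continuous_def by meson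
  obtain n0 where n0: "1 / real (Suc n0) < d" using d(1) nat_approx_posE by blast
  have "(LBINT x. \<bar>real (Suc n) * line_int q j (1 / real (Suc n)) x - q x\<bar>) \<le> e / 2" if n: "n \<ge> n0" for n
  proof -
    define N where "N = real (Suc n)"
    define s where "s = 1 / N"
    have N: "N > 0" "s > 0" "N * s = 1" by (auto simp: N_def s_def)
    have sd: "s < d"
      using n0 n by (simp add: s_def N_def) (smt (verit, best) frac_le of_nat_0_le_iff of_nat_mono)
    have li: "integrable lborel (line_int q j s)" by (rule line_int_integrable[OF q])
    have "AE x in lborel. ennreal \<bar>N * line_int q j s x - q x\<bar> \<le> (\<integral>\<^sup>+r. ennreal (N * (indicator {0..s} r * \<bar>q (x + r *\<^sub>R ?e) - q x\<bar>)) \<partial>lborel)"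
      using line_integrable_AE[OF q, of s j]
    proof (rule eventually_mono)
      fix x assume i: "integrable lborel (\<lambda>r. indicator {0..s} r * q (x + r *\<^sub>R ?e))"
      have i2: "integrable lborel (\<lambda>r. indicator {0..s} r * q x)"
        using N by (intro integrable_mult_left integrable_real_indicator) (auto simp: emeasure_lborel_Icc_eq)
      have i3: "integrable lborel (\<lambda>r. indicator {0..s} r * (q (x + r *\<^sub>R ?e) - q x))"
        using i i2 by (simp add: right_diff_distrib)
      have qx: "N * (LBINT r. indicator {0..s} r * q x) = q x"
        using N by simp
      have "N * line_int q j s x - q x = N * ((LBINT r. indicator {0..s} r * q (x + r *\<^sub>R ?e)) - (LBINT r. indicator {0..s} r * q x))"
        by (simp only: line_int_def right_diff_distrib qx)
      also have "\<dots> = N * (LBINT r. indicator {0..s} r * (q (x + r *\<^sub>R ?e) - q x))"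
        using i i2 by (simp add: right_diff_distrib)
      finally have "\<bar>N * line_int q j s x - q x\<bar> \<le> N * (LBINT r. \<bar>indicator {0..s} r * (q (x + r *\<^sub>R ?e) - q x)\<bar>)"
        using N integral_abs_bound[of lborel "\<lambda>r. indicator {0..s} r * (q (x + r *\<^sub>R ?e) - q x)"]
        by (simp add: abs_mult)
      also have "\<dots> = (LBINT r. N * (indicator {0..s} r * \<bar>q (x + r *\<^sub>R ?e) - q x\<bar>))"
        by (simp add: abs_mult)
      finally have "ennreal \<bar>N * line_int q j s x - q x\<bar> \<le> ennreal (LBINT r. N * (indicator {0..s} r * \<bar>q (x + r *\<^sub>R ?e) - q x\<bar>))"
        by (rule ennreal_leI)
      also have "\<dots> = (\<integral>\<^sup>+r. ennreal (N * (indicator {0..s} r * \<bar>q (x + r *\<^sub>R ?e) - q x\<bar>)) \<partial>lborel)"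
        using N i3[THEN integrable_abs] by (subst nn_integral_eq_integral) (auto simp: abs_mult)
      finally show "ennreal \<bar>N * line_int q j s x - q x\<bar> \<le> (\<integral>\<^sup>+r. ennreal (N * (indicator {0..s} r * \<bar>q (x + r *\<^sub>R ?e) - q x\<bar>)) \<partial>lborel)" .
    qed
    then have "(\<integral>\<^sup>+x. ennreal \<bar>N * line_int q j s x - q x\<bar> \<partial>lborel)
       \<le> (\<integral>\<^sup>+x. (\<integral>\<^sup>+r. ennreal (N * (indicator {0..s} r * \<bar>q (x + r *\<^sub>R ?e) - q x\<bar>)) \<partial>lborel) \<partial>lborel)"
      by (rule nn_integral_mono_AE)
    also have "\<dots> = (\<integral>\<^sup>+r. (\<integral>\<^sup>+x. ennreal (N * (indicator {0..s} r * \<bar>q (x + r *\<^sub>R ?e) - q x\<bar>)) \<partial>lborel) \<partial>lborel)"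
      by (rule lborel_pair.Fubini'[symmetric]) measurable
    also have "\<dots> \<le> (\<integral>\<^sup>+r. ennreal (N * (e / 2)) * indicator {0..s} r \<partial>lborel)"
    proof (rule nn_integral_mono)
      fix r :: real
      show "(\<integral>\<^sup>+x. ennreal (N * (indicator {0..s} r * \<bar>q (x + r *\<^sub>R ?e) - q x\<bar>)) \<partial>lborel) \<le> ennreal (N * (e / 2)) * indicator {0..s} r"
      proof (cases "r \<in> {0..s}")
        case True
        have "(\<integral>\<^sup>+x. ennreal (N * \<bar>q (x + r *\<^sub>R ?e) - q x\<bar>) \<partial>lborel) = ennreal (N * (LBINT x. \<bar>q (x + r *\<^sub>R ?e) - q x\<bar>))"
          using q N by (subst nn_integral_eq_integral) (auto simp: integrable_lborel_shift)
        also have "\<dots> \<le> ennreal (N * (e / 2))"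
          using d(2)[of "r *\<^sub>R ?e"] True sd N by (intro ennreal_leI mult_left_mono) (auto simp: less_imp_le)
        finally show ?thesis using True by simp
      qed simp
    qed
    also have "\<dots> = ennreal (N * (e / 2)) * ennreal s"
      using N by (simp add: nn_integral_cmult)
    also have "\<dots> = ennreal (e / 2)"
      using N e by (simp flip: ennreal_mult add: mult.commute mult.left_commute)
    finally have "(\<integral>\<^sup>+x. ennreal \<bar>N * line_int q j s x - q x\<bar> \<partial>lborel) \<le> ennreal (e / 2)" .
    moreover have "(\<integral>\<^sup>+x. ennreal \<bar>N * line_int q j s x - q x\<bar> \<partial>lborel) = ennreal (LBINT x. \<bar>N * line_int q j s x - q x\<bar>)"
      using li q by (intro nn_integral_eq_integral) auto
    ultimately show ?thesis using e by (simp add: N_def s_def)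
  qed
  then show "\<exists>no. \<forall>n\<ge>no. norm ((LBINT x. \<bar>real (Suc n) * line_int q j (1 / real (Suc n)) x - q x\<bar>) - 0) < e"
    using e by (intro exI[of _ n0]) fastforce
qed

section \<open>The chain rule for weak derivatives\<close>

lemma
  fixes G G' :: "real \<Rightarrow> real"
  assumes G: "\<And>t. (G has_real_derivative G' t) (at t)"
  shows C1_continuous: "continuous_on UNIV G" and C1_borel: "G \<in> borel_measurable borel"
  using G DERIV_isCont by (blast intro: continuous_at_imp_continuous_on borel_measurable_continuous_onI)+

lemma C1_bounds:
  fixes G G' :: "real \<Rightarrow> real"
  assumes G: "\<And>t. (G has_real_derivative G' t) (at t)" and G'c: "continuous_on UNIV G'"
  obtains C where "\<And>t. \<bar>t\<bar> \<le> M \<Longrightarrow> \<bar>G t\<bar> \<le> C" "\<And>t. \<bar>t\<bar> \<le> M \<Longrightarrow> \<bar>G' t\<bar> \<le> C"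
proof -
  have "compact (G ` {-M..M})" "compact (G' ` {-M..M})"
    using C1_continuous[OF G] G'c by (auto intro!: compact_continuous_image intro: continuous_on_subset)
  then have "bounded (G ` {-M..M} \<union> G' ` {-M..M})"
    by (simp add: compact_imp_bounded)
  then show ?thesis using that by (force simp: bounded_iff abs_le_iff)
qed

text \<open>Completing the divided difference on the diagonal by the derivative makes the
  factorisation of \<open>G d - G c\<close> exact for all arguments; in the chain rule it stands for
  the derivative before the limit is taken.\<close>

lemma difference_quotient_bound_tendsto:
  fixes G G' :: "real \<Rightarrow> real"
  assumes G: "\<And>t. (G has_real_derivative G' t) (at t)"
  defines "H \<equiv> \<lambda>a b. if b = a then G' a else (G b - G a) / (b - a)"
  shows "b \<longlonglongrightarrow> a \<Longrightarrow> (\<lambda>n. H a (b n)) \<longlonglongrightarrow> G' a"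
    and "(\<And>t. \<bar>t\<bar> \<le> M \<Longrightarrow> \<bar>G' t\<bar> \<le> C) \<Longrightarrow> \<bar>c\<bar> \<le> M \<Longrightarrow> \<bar>d\<bar> \<le> M \<Longrightarrow> \<bar>H c d\<bar> \<le> C"
    and "G d - G c = H c d * (d - c)"
proof -
  have "((\<lambda>y. (G y - G a) / (y - a)) \<longlongrightarrow> G' a) (at a)"
    using G[of a] by (simp add: has_field_derivative_iff)
  then have "((\<lambda>y. H a y) \<longlongrightarrow> G' a) (at a)"
    by (rule Lim_transform_eventually) (auto simp: H_def eventually_at intro!: exI[of _ 1])
  then have "isCont (H a) a" by (simp add: isCont_def H_def)
  then show "b \<longlonglongrightarrow> a \<Longrightarrow> (\<lambda>n. H a (b n)) \<longlonglongrightarrow> G' a"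
    using isCont_tendsto_compose[of a "H a" b sequentially] by (simp add: H_def)
  show "G d - G c = H c d * (d - c)" by (simp add: H_def)
  assume C: "\<And>t. \<bar>t\<bar> \<le> M \<Longrightarrow> \<bar>G' t\<bar> \<le> C" and cd: "\<bar>c\<bar> \<le> M" "\<bar>d\<bar> \<le> M"
  have le: "\<bar>(G b - G a) / (b - a)\<bar> \<le> C" if ab: "a < b" "\<bar>a\<bar> \<le> M" "\<bar>b\<bar> \<le> M" for a b
  proof -
    obtain z where z: "a < z" "z < b" "G b - G a = (b - a) * G' z"
      using MVT2[OF ab(1), of G G'] G by blast
    then have "(G b - G a) / (b - a) = G' z" using ab by simp
    then show ?thesis using C[of z] z ab by auto
  qed
  show "\<bar>H c d\<bar> \<le> C"
  proof (cases c d rule: linorder_cases)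
    case less then show ?thesis using le[of c d] cd by (simp add: H_def)
  next
    case equal then show ?thesis using C cd by (simp add: H_def)
  next
    case greater
    then have "(G d - G c) / (d - c) = (G c - G d) / (c - d)"
      by (simp add: field_simps)
    then show ?thesis using le[of d c] cd greater by (simp add: H_def)
  qed
qed

text \<open>A discrete integration by parts followed by a limit. The difference quotient of
  \<open>G (v x)\<close> is a bounded divided difference times a segment average of
  \<open>q\<close>; these averages tend to \<open>q\<close> in L^1, and along a subsequence they
  also force the shifted values of \<open>v\<close> back to \<open>v x\<close>.\<close>

lemma chain_rule_weak:
  fixes v q Z Z' :: "real ^ 'n \<Rightarrow> real" and G G' :: "real \<Rightarrow> real"
  assumes v[measurable]: "v \<in> borel_measurable borel" and vM: "\<And>x. \<bar>v x\<bar> \<le> M"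
    and q: "integrable lborel q"
    and line: "\<And>n. n \<ge> n0 \<Longrightarrow> AE x in lborel. x \<in> W \<longrightarrow>
          v (x + (1 / real (Suc n)) *\<^sub>R axis j 1) - v x = line_int q j (1 / real (Suc n)) x"
    and G: "\<And>t. (G has_real_derivative G' t) (at t)" and G'c: "continuous_on UNIV G'"
    and Z[measurable]: "Z \<in> borel_measurable borel" and Z'[measurable]: "Z' \<in> borel_measurable borel"
    and ZC: "\<And>x. \<bar>Z x\<bar> \<le> C" "\<And>x. \<bar>Z' x\<bar> \<le> C"
    and ZD: "\<And>x r. ((\<lambda>r. Z (x + r *\<^sub>R axis j 1)) has_real_derivative Z' (x + r *\<^sub>R axis j 1)) (at r)"
    and K: "compact K" "K \<subseteq> W" "\<And>x. x \<notin> K \<Longrightarrow> Z x = 0"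
  shows "(LBINT x. G (v x) * Z' x) = - (LBINT x. G' (v x) * q x * Z x)"
proof -
  let ?e = "axis j 1 :: real ^ 'n"
  define A where "A n x = real (Suc n) * line_int q j (1 / real (Suc n)) x" for n x
  define H where "H a b = (if b = a then G' a else (G b - G a) / (b - a))" for a b
  define w where "w n x = v (x + (1 / real (Suc n)) *\<^sub>R ?e)" for n x
  have [measurable]: "q \<in> borel_measurable borel" using q by auto
  have [measurable]: "G \<in> borel_measurable borel" "G' \<in> borel_measurable borel"
    using C1_borel[OF G] G'c by (auto intro: borel_measurable_continuous_onI)
  have [measurable]: "w n \<in> borel_measurable borel" for n unfolding w_def by measurable
  have [measurable]: "(\<lambda>x. H (v x) (w n x)) \<in> borel_measurable borel" for n
    unfolding H_def by measurable
  have Ai: "integrable lborel (A n)" for n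
    unfolding A_def using line_int_integrable[OF q] by simp
  have [measurable]: "A n \<in> borel_measurable borel" for n using Ai[of n] by auto
  have C0: "C \<ge> 0" using ZC(1)[of 0] by linarith
  obtain C1 where C1: "\<And>t. \<bar>t\<bar> \<le> M \<Longrightarrow> \<bar>G t\<bar> \<le> C1" "\<And>t. \<bar>t\<bar> \<le> M \<Longrightarrow> \<bar>G' t\<bar> \<le> C1"
    by (rule C1_bounds[OF G G'c, of M]) blast
  have C10: "C1 \<ge> 0" using C1(1)[OF vM[of 0]] by linarith
  have HC: "\<bar>H (v x) (w n x)\<bar> \<le> C1" for n x
    unfolding H_def w_def by (rule difference_quotient_bound_tendsto(2)[OF G C1(2) vM vM])
  have Heq: "G (w n x) - G (v x) = H (v x) (w n x) * (w n x - v x)" for n x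
    unfolding H_def using difference_quotient_bound_tendsto(3)[OF G] by simp
  obtain R where R: "\<And>x. x \<in> K \<Longrightarrow> norm x \<le> R"
    using compact_imp_bounded[OF K(1)] unfolding bounded_iff by auto
  \<comment> \<open>Radius \<open>R + 1\<close> contains the supports of all \<open>Q n\<close>,
    since every step has length at most 1.\<close>
  define dom where "dom = (indicator (cball 0 (R + 1)) :: real ^ 'n \<Rightarrow> real)"
  have domi: "integrable lborel dom"
    unfolding dom_def by (rule integrable_indicator_compact[OF compact_cball])
  have dom1: "dom x = 1" if "x \<in> K \<or> x - (1 / real (Suc n)) *\<^sub>R ?e \<in> K" for x n
  proof -
    have "norm x \<le> R + 1"
      using that
    proof
      assume "x - (1 / real (Suc n)) *\<^sub>R ?e \<in> K"
      then have "norm (x - (1 / real (Suc n)) *\<^sub>R ?e) \<le> R" by (rule R)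
      moreover have "norm x \<le> norm (x - (1 / real (Suc n)) *\<^sub>R ?e) + norm ((1 / real (Suc n)) *\<^sub>R ?e)"
        using norm_triangle_ineq[of "x - (1 / real (Suc n)) *\<^sub>R ?e" "(1 / real (Suc n)) *\<^sub>R ?e"] by simp
      moreover have "norm ((1 / real (Suc n)) *\<^sub>R ?e) \<le> 1" by simp
      ultimately show ?thesis by linarith
    qed (use R in force)
    then show ?thesis by (simp add: dom_def)
  qed
  \<comment> \<open>The backward difference quotient of the cutoff; a translation under the integral
    turns it into the forward quotient of \<open>G (v x)\<close> with opposite sign.\<close>
  define Q where "Q n x = real (Suc n) * (Z x - Z (x - (1 / real (Suc n)) *\<^sub>R ?e))" for n x
  have [measurable]: "Q n \<in> borel_measurable borel" for n unfolding Q_def by measurable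
  have QC: "\<bar>Q n x\<bar> \<le> C * dom x" for n x
  proof (cases "x \<in> K \<or> x - (1 / real (Suc n)) *\<^sub>R ?e \<in> K")
    case True
    obtain z where "Z (x + 0 *\<^sub>R ?e) - Z (x + (- (1 / real (Suc n))) *\<^sub>R ?e)
        = (0 - (- (1 / real (Suc n)))) * Z' (x + z *\<^sub>R ?e)"
      using MVT2[of "- (1 / real (Suc n))" 0 "\<lambda>r. Z (x + r *\<^sub>R ?e)" "\<lambda>r. Z' (x + r *\<^sub>R ?e)"] ZD
      by (metis neg_less_0_iff_less of_nat_0_less_iff zero_less_Suc zero_less_divide_1_iff)
    then have "Q n x = Z' (x + z *\<^sub>R ?e)"
      by (simp add: Q_def)
    then show ?thesis using ZC(2) dom1[OF True] by simp
  qed (use K(3) C0 in \<open>simp add: Q_def dom_def\<close>)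
  have Qlim: "(\<lambda>n. Q n x) \<longlonglongrightarrow> Z' x" for x
  proof -
    have "((\<lambda>r. Z (x + r *\<^sub>R ?e)) has_real_derivative Z' x) (at 0)" using ZD[of x 0] by simp
    then have d: "((\<lambda>h. (Z (x + h *\<^sub>R ?e) - Z x) / h) \<longlongrightarrow> Z' x) (at 0)"
      by (simp add: has_field_derivative_iff)
    have "filterlim (\<lambda>n. - (1 / real (Suc n))) (at 0) sequentially"
      unfolding filterlim_at
    proof
      show "\<forall>\<^sub>F n in sequentially. - (1 / real (Suc n)) \<in> UNIV \<and> - (1 / real (Suc n)) \<noteq> 0" by simp
      show "(\<lambda>n. - (1 / real (Suc n))) \<longlonglongrightarrow> 0"
        using tendsto_minus[OF LIMSEQ_inverse_real_of_nat] by (simp add: inverse_eq_divide)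
    qed
    from filterlim_compose[OF d this] show ?thesis
      by (simp add: Q_def field_simps)
  qed
  have L: "(\<lambda>n. \<integral>x. G (v x) * Q n x \<partial>lborel) \<longlonglongrightarrow> (LBINT x. G (v x) * Z' x)"
  proof (rule integral_dominated_convergence[where w="\<lambda>x. C1 * (C * dom x)"])
    show "AE x in lborel. norm (G (v x) * Q n x) \<le> C1 * (C * dom x)" for n
    proof (rule AE_I2)
      fix x
      show "norm (G (v x) * Q n x) \<le> C1 * (C * dom x)"
        using QC[of n x] C1(1)[OF vM[of x]] C10 by (simp add: abs_mult mult_mono)
    qed
    show "AE x in lborel. (\<lambda>n. G (v x) * Q n x) \<longlonglongrightarrow> G (v x) * Z' x"
      by (intro AE_I2 tendsto_mult tendsto_const Qlim)
  qed (use domi in auto)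
  have bK: "integrable lborel (\<lambda>x. g x * Z x)" if gm[measurable]: "g \<in> borel_measurable borel" and gb: "\<And>x. \<bar>g x\<bar> \<le> C1" for g
  proof (rule integrable_compact_support[OF _ K(1), of _ "C1 * C"])
    show "\<bar>g x * Z x\<bar> \<le> C1 * C" for x
      using gb[of x] ZC(1)[of x] C10 by (simp add: abs_mult mult_mono)
  qed (use K(3) in auto)
  have R1: "(LBINT x. G (v x) * Q n x) = - (LBINT x. H (v x) (w n x) * A n x * Z x)" if n: "n \<ge> n0" for n
  proof -
    let ?c = "(1 / real (Suc n)) *\<^sub>R ?e"
    have i1: "integrable lborel (\<lambda>x. G (v x) * Z x)" "integrable lborel (\<lambda>x. G (w n x) * Z x)"
      using C1(1) vM by (auto intro!: bK simp: w_def)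
    have eq: "(\<lambda>x. G (w n x) * Z x) = (\<lambda>x. (\<lambda>y. G (v y) * Z (y - ?c)) (x + ?c))"
      by (simp add: w_def)
    have i2: "integrable lborel (\<lambda>x. G (v x) * Z (x - ?c))"
      using i1(2) unfolding eq by (subst (asm) integrable_lborel_shift) auto
    have sh: "(LBINT x. G (v x) * Z (x - ?c)) = (LBINT x. G (w n x) * Z x)"
      unfolding eq by (subst integral_lborel_shift) auto
    have "(LBINT x. G (v x) * Q n x) = (LBINT x. real (Suc n) * (G (v x) * Z x - G (v x) * Z (x - ?c)))"
      by (simp add: Q_def algebra_simps)
    also have "\<dots> = real (Suc n) * ((LBINT x. G (v x) * Z x) - (LBINT x. G (w n x) * Z x))"
      using i1 i2 sh by simp
    also have "\<dots> = - (LBINT x. real (Suc n) * (G (w n x) - G (v x)) * Z x)"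
      using i1 by (simp add: left_diff_distrib right_diff_distrib mult.assoc)
    also have "(LBINT x. real (Suc n) * (G (w n x) - G (v x)) * Z x) = (LBINT x. H (v x) (w n x) * A n x * Z x)"
    proof (rule integral_cong_AE)
      show "AE x in lborel. real (Suc n) * (G (w n x) - G (v x)) * Z x = H (v x) (w n x) * A n x * Z x"
        using line[OF n]
      proof (rule eventually_mono)
        fix x assume "x \<in> W \<longrightarrow> v (x + ?c) - v x = line_int q j (1 / real (Suc n)) x"
        then have "x \<in> K \<Longrightarrow> w n x - v x = line_int q j (1 / real (Suc n)) x"
          using K(2) by (auto simp: w_def)
        then show "real (Suc n) * (G (w n x) - G (v x)) * Z x = H (v x) (w n x) * A n x * Z x"
          using K(3)[of x] unfolding Heq A_def by (cases "x \<in> K") auto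
      qed
    qed measurable
    finally show ?thesis .
  qed
  have D0: "(\<lambda>n. \<integral>x. norm (A n x - q x) \<partial>lborel) \<longlonglongrightarrow> 0"
    using line_int_average[OF q, of j] by (simp add: A_def)
  \<comment> \<open>L^1 convergence gives pointwise convergence along a subsequence only; this
    suffices because the left-hand integrals converge along the whole sequence.\<close>
  obtain r where r: "strict_mono r" "AE x in lborel. (\<lambda>n. A (r n) x - q x) \<longlonglongrightarrow> 0"
    using tendsto_L1_AE_subseq[of lborel "\<lambda>n x. A n x - q x"] D0 Ai q by auto
  have line': "AE x in lborel. \<forall>n. n \<ge> n0 \<longrightarrow> x \<in> W \<longrightarrow> w n x - v x = line_int q j (1 / real (Suc n)) x"
    unfolding AE_all_countable w_def using line by simp
  have S: "(\<lambda>n. \<integral>x. H (v x) (w (r n) x) * q x * Z x \<partial>lborel) \<longlonglongrightarrow> (LBINT x. G' (v x) * q x * Z x)"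
  proof (rule integral_dominated_convergence[where w="\<lambda>x. C1 * \<bar>q x\<bar> * C"])
    show "AE x in lborel. norm (H (v x) (w (r n) x) * q x * Z x) \<le> C1 * \<bar>q x\<bar> * C" for n
    proof (rule AE_I2)
      fix x
      show "norm (H (v x) (w (r n) x) * q x * Z x) \<le> C1 * \<bar>q x\<bar> * C"
        using HC[of x "r n"] ZC(1)[of x] C10 C0 by (simp add: abs_mult mult_mono)
    qed
    show "AE x in lborel. (\<lambda>n. H (v x) (w (r n) x) * q x * Z x) \<longlonglongrightarrow> G' (v x) * q x * Z x"
      using r(2) line'
    proof eventually_elim
      case (elim x)
      show ?case
      proof (cases "x \<in> K")
        case True
        have "(\<lambda>n. A (r n) x) \<longlonglongrightarrow> q x" using elim(1) by (simp add: LIM_zero_iff)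
        moreover have "(\<lambda>n. 1 / real (Suc (r n))) \<longlonglongrightarrow> 0"
          using LIMSEQ_subseq_LIMSEQ[OF LIMSEQ_inverse_real_of_nat r(1)] by (simp add: o_def inverse_eq_divide)
        \<comment> \<open>The averages converge along the subsequence, so their products with the
          step lengths, which are the increments of \<open>v\<close>, tend to zero.\<close>
        ultimately have "(\<lambda>n. v x + A (r n) x * (1 / real (Suc (r n)))) \<longlonglongrightarrow> v x + q x * 0"
          by (intro tendsto_intros)
        moreover have "\<forall>\<^sub>F n in sequentially. v x + A (r n) x * (1 / real (Suc (r n))) = w (r n) x"
          unfolding eventually_sequentially
        proof (intro exI[of _ n0] allI impI)
          fix n assume "n \<ge> n0"
          then have "r n \<ge> n0" using seq_suble[OF r(1), of n] by linarith
          then have "w (r n) x - v x = line_int q j (1 / real (Suc (r n))) x"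
            using elim(2) True K(2) by blast
          then show "v x + A (r n) x * (1 / real (Suc (r n))) = w (r n) x"
            by (simp add: A_def)
        qed
        ultimately have "(\<lambda>n. w (r n) x) \<longlonglongrightarrow> v x"
          by (simp add: Lim_transform_eventually)
        then have "(\<lambda>n. H (v x) (w (r n) x)) \<longlonglongrightarrow> G' (v x)"
          unfolding H_def by (rule difference_quotient_bound_tendsto(1)[OF G])
        then show ?thesis by (intro tendsto_intros)
      qed (use K(3) in simp)
    qed
  qed (use q in auto)
  \<comment> \<open>Exchanging the averages for \<open>q\<close> costs at most \<open>C1 * C\<close>
    times an L^1 norm that tends to zero.\<close>
  have T: "(\<lambda>n. \<integral>x. H (v x) (w (r n) x) * (A (r n) x - q x) * Z x \<partial>lborel) \<longlonglongrightarrow> 0"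
  proof (rule Lim_null_comparison)
    show "(\<lambda>n. C1 * C * (LBINT x. norm (A (r n) x - q x))) \<longlonglongrightarrow> 0"
      using LIMSEQ_subseq_LIMSEQ[OF D0 r(1)] by (auto intro!: tendsto_mult_right_zero simp: o_def)
    show "\<forall>\<^sub>F n in sequentially. norm (LBINT x. H (v x) (w (r n) x) * (A (r n) x - q x) * Z x)
           \<le> C1 * C * (LBINT x. norm (A (r n) x - q x))"
    proof (intro always_eventually allI)
      fix n
      have "norm (LBINT x. H (v x) (w (r n) x) * (A (r n) x - q x) * Z x)
         \<le> (LBINT x. norm (H (v x) (w (r n) x) * (A (r n) x - q x) * Z x))"
        by (rule integral_norm_bound)
      also have "\<dots> \<le> (LBINT x. C1 * C * norm (A (r n) x - q x))"
      proof (rule integral_mono')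
        show "integrable lborel (\<lambda>x. C1 * C * norm (A (r n) x - q x))" using Ai q by simp
        fix x
        show "norm (H (v x) (w (r n) x) * (A (r n) x - q x) * Z x) \<le> C1 * C * norm (A (r n) x - q x)"
          using mult_right_mono[OF mult_mono[OF HC[of x "r n"] ZC(1)[of x]] abs_ge_zero[of "A (r n) x - q x"]] C0 C10
          by (simp add: abs_mult mult.commute mult.left_commute)
        show "0 \<le> C1 * C * norm (A (r n) x - q x)" using C0 C10 by simp
      qed
      also have "\<dots> = C1 * C * (LBINT x. norm (A (r n) x - q x))" by simp
      finally show "norm (LBINT x. H (v x) (w (r n) x) * (A (r n) x - q x) * Z x)
           \<le> C1 * C * (LBINT x. norm (A (r n) x - q x))" .
    qed
  qed
  have HZi: "integrable lborel (\<lambda>x. H (v x) (w n x) * g x * Z x)" if g: "integrable lborel g" for g n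
  proof (rule Bochner_Integration.integrable_bound[where f="\<lambda>x. C1 * g x * C"])
    have [measurable]: "g \<in> borel_measurable borel" using g by auto
    show "(\<lambda>x. H (v x) (w n x) * g x * Z x) \<in> borel_measurable lborel" by measurable
    show "AE x in lborel. norm (H (v x) (w n x) * g x * Z x) \<le> norm (C1 * g x * C)"
    proof (rule AE_I2)
      fix x
      show "norm (H (v x) (w n x) * g x * Z x) \<le> norm (C1 * g x * C)"
        using HC[of x n] ZC(1)[of x] C10 C0 by (simp add: abs_mult mult_mono)
    qed
  qed (use g in simp)
  have "(\<lambda>n. \<integral>x. H (v x) (w (r n) x) * A (r n) x * Z x \<partial>lborel) \<longlonglongrightarrow> (LBINT x. G' (v x) * q x * Z x)"
  proof -
    have "(LBINT x. H (v x) (w (r n) x) * A (r n) x * Z x)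
      = (LBINT x. H (v x) (w (r n) x) * (A (r n) x - q x) * Z x) + (LBINT x. H (v x) (w (r n) x) * q x * Z x)" for n
    proof -
      have "(LBINT x. H (v x) (w (r n) x) * A (r n) x * Z x)
        = (LBINT x. H (v x) (w (r n) x) * (A (r n) x - q x) * Z x + H (v x) (w (r n) x) * q x * Z x)"
        by (simp add: algebra_simps)
      then show ?thesis using HZi[of "\<lambda>x. A (r n) x - q x"] HZi[OF q] Ai q by simp
    qed
    then show ?thesis using tendsto_add[OF T S] by simp
  qed
  then have "(\<lambda>n. - (LBINT x. H (v x) (w (r n) x) * A (r n) x * Z x)) \<longlonglongrightarrow> - (LBINT x. G' (v x) * q x * Z x)"
    by (rule tendsto_minus)
  moreover have "\<forall>\<^sub>F n in sequentially. - (LBINT x. H (v x) (w (r n) x) * A (r n) x * Z x) = (LBINT x. G (v x) * Q (r n) x)"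
    unfolding eventually_sequentially
  proof (intro exI[of _ n0] allI impI)
    fix n assume "n \<ge> n0"
    then have "r n \<ge> n0" using seq_suble[OF r(1), of n] by linarith
    from R1[OF this] show "- (LBINT x. H (v x) (w (r n) x) * A (r n) x * Z x) = (LBINT x. G (v x) * Q (r n) x)" by simp
  qed
  ultimately have "(\<lambda>n. \<integral>x. G (v x) * Q (r n) x \<partial>lborel) \<longlonglongrightarrow> - (LBINT x. G' (v x) * q x * Z x)"
    by (rule Lim_transform_eventually)
  moreover have "(\<lambda>n. \<integral>x. G (v x) * Q (r n) x \<partial>lborel) \<longlonglongrightarrow> (LBINT x. G (v x) * Z' x)"
    using LIMSEQ_subseq_LIMSEQ[OF L r(1)] by (simp add: o_def)
  ultimately show ?thesis using LIMSEQ_unique by blast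
qed

section \<open>Convex functions of power growth\<close>

text \<open>The two half-lines have their own exponents. Negative arguments are expressed through
  \<open>f (- t)\<close>, so that reflection merely swaps the two clauses.\<close>

definition power_growth :: "(real \<Rightarrow> real) \<Rightarrow> real \<Rightarrow> real \<Rightarrow> bool" where
  "power_growth f qp qm \<longleftrightarrow> (\<exists>c>0. \<exists>C>0. \<exists>T\<ge>1.
     (\<forall>t\<ge>T. c * t powr qp \<le> f t \<and> f t \<le> C * t powr qp) \<and>
     (\<forall>t\<ge>T. c * t powr qm \<le> f (- t) \<and> f (- t) \<le> C * t powr qm))"

text \<open>Convexity is encoded as monotonicity of the derivative, the form in which it enters the
  difference inequality.\<close>

definition convex_C1 :: "(real \<Rightarrow> real) \<Rightarrow> (real \<Rightarrow> real) \<Rightarrow> bool" where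
  "convex_C1 f f' \<longleftrightarrow> (\<forall>t. f t \<ge> 0) \<and> (\<forall>t. (f has_real_derivative f' t) (at t)) \<and>
     continuous_on UNIV f' \<and> mono f'"

lemma power_growth_reflect: "power_growth f qp qm \<Longrightarrow> power_growth (\<lambda>t. f (- t)) qm qp"
  unfolding power_growth_def by fastforce

lemma convex_C1_reflect:
  assumes "convex_C1 f f'" shows "convex_C1 (\<lambda>t. f (- t)) (\<lambda>t. - f' (- t))"
proof -
  have "((\<lambda>t. f (- t)) has_real_derivative - f' (- t)) (at t)" for t
  proof -
    have "((\<lambda>t. f (- t)) has_real_derivative f' (- t) * - 1) (at t)"
      by (rule DERIV_chain2[where f=f and g=uminus]) (use assms in \<open>auto simp: convex_C1_def intro!: derivative_eq_intros\<close>)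
    then show ?thesis by simp
  qed
  moreover have "continuous_on UNIV (\<lambda>t. - f' (- t))"
    using assms unfolding convex_C1_def
    by (intro continuous_on_minus continuous_on_compose2[of UNIV f' UNIV uminus]) (auto intro!: continuous_intros)
  ultimately show ?thesis
    using assms by (auto simp: convex_C1_def mono_def)
qed

lemma convex_C1_tangent:
  assumes "convex_C1 f f'" shows "f' a * (b - a) \<le> f b - f a"
proof -
  have D: "\<And>t. (f has_real_derivative f' t) (at t)" and m: "mono f'" using assms by (auto simp: convex_C1_def)
  show ?thesis
  proof (cases a b rule: linorder_cases)
    case less
    then obtain z where z: "a < z" "z < b" "f b - f a = (b - a) * f' z" using MVT2[OF less, of f f'] D by blast
    then show ?thesis using m less by (simp add: mult.commute mult_left_mono monoD)
  next
    case greater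
    then obtain z where z: "b < z" "z < a" "f a - f b = (a - b) * f' z" using MVT2[OF greater, of f f'] D by blast
    then have "(a - b) * f' z \<le> (a - b) * f' a" using m greater by (intro mult_left_mono monoD[OF m]) auto
    then show ?thesis using z by (simp add: algebra_simps)
  qed simp
qed

text \<open>Two tangent inequalities at the intermediate point; in their weighted sum the linear
  terms cancel.\<close>

lemma convex_C1_convex:
  assumes "convex_C1 f f'" "0 \<le> s" "s \<le> 1"
  shows "f ((1 - s) * a + s * b) \<le> (1 - s) * f a + s * f b"
proof -
  let ?z = "(1 - s) * a + s * b"
  have 1: "f' ?z * (a - ?z) \<le> f a - f ?z" "f' ?z * (b - ?z) \<le> f b - f ?z"
    by (rule convex_C1_tangent[OF assms(1)])+
  have "(1 - s) * (f' ?z * (a - ?z)) + s * (f' ?z * (b - ?z)) \<le> (1 - s) * (f a - f ?z) + s * (f b - f ?z)"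
    using 1 assms by (intro add_mono mult_left_mono) auto
  moreover have "(1 - s) * (f' ?z * (a - ?z)) + s * (f' ?z * (b - ?z)) = 0"
    by (simp add: algebra_simps)
  ultimately show ?thesis by (simp add: algebra_simps)
qed

text \<open>The tangent at \<open>t\<close>, evaluated at \<open>2 * t\<close>, gives
  \<open>f' t * t \<le> f (2 * t)\<close>. So \<open>f'\<close> grows at most like the power
  \<open>qp - 1\<close> of \<open>t\<close>, which is the power \<open>1 - 1 / qp\<close> of
  \<open>f\<close>; raising this exponent to \<open>1 - 1 / Q\<close> makes it common to all
  directions.\<close>

lemma convex_C1_deriv_le_pos:
  assumes f: "convex_C1 f f'" and g: "power_growth f qp qm" and q: "1 < qp" "qp \<le> Q"
  shows "\<exists>C\<ge>0. \<forall>t\<ge>0. f' t \<le> C * (1 + f t) powr (1 - 1 / Q)"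
proof -
  obtain c C T where c: "c > 0" "C > 0" "T \<ge> 1" "\<And>t. t \<ge> T \<Longrightarrow> c * t powr qp \<le> f t" "\<And>t. t \<ge> T \<Longrightarrow> f t \<le> C * t powr qp"
    using g unfolding power_growth_def by metis
  have nn: "\<And>t. f t \<ge> 0" and m: "mono f'" using f by (auto simp: convex_C1_def)
  \<comment> \<open>The last factor arises when \<open>t powr (qp - 1)\<close> is written as a power
    of the lower bound \<open>c * t powr qp\<close>.\<close>
  define B where "B = C * 2 powr qp * c powr (1 / qp - 1)"
  have big: "f' t \<le> B * (1 + f t) powr (1 - 1 / Q)" if t: "t \<ge> T" for t
  proof -
    have tp: "t > 0" using t c by linarith
    have "f' t * t \<le> f (2 * t) - f t" using convex_C1_tangent[OF f, of t "2 * t"] by simp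
    then have "f' t * t \<le> C * (2 * t) powr qp"
      using nn[of t] c(5)[of "2 * t"] t tp by linarith
    then have "f' t \<le> C * (2 * t) powr qp / t" using tp by (simp add: field_simps)
    also have "\<dots> = C * 2 powr qp * t powr (qp - 1)"
      using tp by (simp add: powr_mult powr_diff field_simps)
    also have "t powr (qp - 1) = c powr (1 / qp - 1) * (c * t powr qp) powr (1 - 1 / qp)"
    proof -
      have "qp * (1 - 1 / qp) = qp - 1" using q by (simp add: field_simps)
      then have "(c * t powr qp) powr (1 - 1 / qp) = c powr (1 - 1 / qp) * t powr (qp - 1)"
        using c tp by (simp add: powr_mult powr_powr)
      moreover have "c powr (1 / qp - 1) * c powr (1 - 1 / qp) = 1"
        using c by (simp flip: powr_add)
      ultimately show ?thesis by (metis mult.assoc mult_1)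
    qed
    also have "(c * t powr qp) powr (1 - 1 / qp) \<le> (1 + f t) powr (1 - 1 / qp)"
      using c(1) c(4)[OF t] q by (intro powr_mono2) auto
    also have "(1 + f t) powr (1 - 1 / qp) \<le> (1 + f t) powr (1 - 1 / Q)"
      using nn[of t] q by (intro powr_mono) (auto simp: frac_le)
    finally show ?thesis using c by (simp add: B_def mult.assoc mult_left_mono)
  qed
  have B: "B \<ge> 0" using c by (simp add: B_def)
  have "f' t \<le> (B + \<bar>f' T\<bar>) * (1 + f t) powr (1 - 1 / Q)" if "t \<ge> 0" for t
  proof -
    have 1: "(1 + f t) powr (1 - 1 / Q) \<ge> 1" using nn[of t] q by (intro ge_one_powr_ge_zero) auto
    then have 2: "\<bar>f' T\<bar> * 1 \<le> \<bar>f' T\<bar> * (1 + f t) powr (1 - 1 / Q)" by (intro mult_left_mono) auto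
    have 3: "0 \<le> B * (1 + f t) powr (1 - 1 / Q)" using B by simp
    show ?thesis
    proof (cases "t \<ge> T")
      case True then show ?thesis using big[OF True] 2 by (simp add: distrib_right)
    next
      case False
      then have "f' t \<le> \<bar>f' T\<bar>" using monoD[OF m, of t T] by auto
      then show ?thesis using 2 3 by (simp add: distrib_right)
    qed
  qed
  then show ?thesis using B by (intro exI[of _ "B + \<bar>f' T\<bar>"]) auto
qed

lemma convex_C1_deriv_le:
  assumes f: "convex_C1 f f'" and g: "power_growth f qp qm" and q: "1 < qp" "qp \<le> Q" "1 < qm" "qm \<le> Q"
  shows "\<exists>C\<ge>0. \<forall>t. \<bar>f' t\<bar> \<le> C * (1 + f t) powr (1 - 1 / Q)"
proof -
  have nn: "\<And>t. f t \<ge> 0" and m: "mono f'" using f by (auto simp: convex_C1_def)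
  obtain C1 where C1: "C1 \<ge> 0" "\<And>t. t \<ge> 0 \<Longrightarrow> f' t \<le> C1 * (1 + f t) powr (1 - 1 / Q)"
    using convex_C1_deriv_le_pos[OF f g q(1,2)] by blast
  obtain C2 where C2: "C2 \<ge> 0" "\<And>t. t \<ge> 0 \<Longrightarrow> - f' (- t) \<le> C2 * (1 + f (- t)) powr (1 - 1 / Q)"
    using convex_C1_deriv_le_pos[OF convex_C1_reflect[OF f] power_growth_reflect[OF g] q(3,4)] by blast
  have "\<bar>f' t\<bar> \<le> (C1 + C2 + \<bar>f' 0\<bar>) * (1 + f t) powr (1 - 1 / Q)" for t
  proof -
    define P where "P = (1 + f t) powr (1 - 1 / Q)"
    have P: "P \<ge> 1" unfolding P_def using nn[of t] q by (intro ge_one_powr_ge_zero) auto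
    have 2: "\<bar>f' 0\<bar> \<le> \<bar>f' 0\<bar> * P" "0 \<le> C1 * P" "0 \<le> C2 * P"
      using P C1 C2 by (auto simp: mult_le_cancel_left1)
    show ?thesis
    proof (cases "t \<ge> 0")
      case True
      then have "f' 0 \<le> f' t" by (rule monoD[OF m])
      then have "\<bar>f' t\<bar> \<le> C1 * P + \<bar>f' 0\<bar>" using C1(2)[OF True] 2 unfolding P_def by linarith
      then show ?thesis using 2 unfolding P_def[symmetric] by (simp add: distrib_right)
    next
      case False
      then have "f' t \<le> f' 0" by (intro monoD[OF m]) auto
      moreover have "- f' t \<le> C2 * P" using C2(2)[of "- t"] False by (simp add: P_def)
      ultimately have "\<bar>f' t\<bar> \<le> C2 * P + \<bar>f' 0\<bar>" using 2 by linarith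
      then show ?thesis using 2 unfolding P_def[symmetric] by (simp add: distrib_right)
    qed
  qed
  then show ?thesis using C1 C2 by (intro exI[of _ "C1 + C2 + \<bar>f' 0\<bar>"]) auto
qed

lemma power_growth_shift_pos:
  assumes g: "power_growth f qp qm" and q: "0 \<le> qp" and c0: "c0 \<ge> 0"
  shows "\<exists>C\<ge>0. \<exists>T\<ge>0. \<forall>t s. t \<ge> T \<longrightarrow> \<bar>s\<bar> \<le> c0 \<longrightarrow> f (t + s) \<le> C * f t"
proof -
  obtain c C T where c: "c > 0" "C > 0" "T \<ge> 1" "\<And>t. t \<ge> T \<Longrightarrow> c * t powr qp \<le> f t" "\<And>t. t \<ge> T \<Longrightarrow> f t \<le> C * t powr qp"
    using g unfolding power_growth_def by metis
  have "f (t + s) \<le> C * 2 powr qp / c * f t" if t: "t \<ge> T + c0" "\<bar>s\<bar> \<le> c0" for t s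
  proof -
    have tT: "t + s \<ge> T" "t \<ge> T" "t > 0" "t + s \<ge> 0" "t + s \<le> 2 * t" using t c c0 by auto
    have "f (t + s) \<le> C * (t + s) powr qp" using c tT by auto
    also have "\<dots> \<le> C * (2 * t) powr qp" using tT c q by (intro mult_left_mono powr_mono2) auto
    also have "\<dots> = C * 2 powr qp / c * (c * t powr qp)" using c tT by (simp add: powr_mult)
    also have "\<dots> \<le> C * 2 powr qp / c * f t" using c(4)[OF tT(2)] c by (intro mult_left_mono) auto
    finally show ?thesis .
  qed
  then show ?thesis
    using c c0 by (intro exI[of _ "C * 2 powr qp / c"] conjI exI[of _ "T + c0"]) auto
qed

text \<open>A bounded shift at most doubles large arguments, which costs a constant factor, and the
  remaining arguments stay in a compact interval. This absorbs the derivatives of the cutoff in the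
  competitor.\<close>

lemma power_growth_shift:
  assumes f: "convex_C1 f f'" and g: "power_growth f qp qm" and q: "1 < qp" "1 < qm"
  shows "\<exists>C\<ge>0. \<forall>t s. \<bar>s\<bar> \<le> c0 \<longrightarrow> f (t + s) \<le> C * (1 + f t)"
proof (cases "c0 \<ge> 0")
  case True
  have nn: "\<And>t. f t \<ge> 0" and fD: "\<And>t. (f has_real_derivative f' t) (at t)"
    using f by (auto simp: convex_C1_def)
  obtain C1 T1 where 1: "C1 \<ge> 0" "T1 \<ge> 0" "\<And>t s. t \<ge> T1 \<Longrightarrow> \<bar>s\<bar> \<le> c0 \<Longrightarrow> f (t + s) \<le> C1 * f t"
    using power_growth_shift_pos[OF g _ True] q by (metis less_eq_real_def less_trans zero_less_one)
  obtain C2 T2 where 2: "C2 \<ge> 0" "T2 \<ge> 0" "\<And>t s. t \<ge> T2 \<Longrightarrow> \<bar>s\<bar> \<le> c0 \<Longrightarrow> f (- (t + s)) \<le> C2 * f (- t)"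
    using power_growth_shift_pos[OF power_growth_reflect[OF g] _ True] q by (metis less_eq_real_def less_trans zero_less_one)
  define R where "R = T1 + T2 + c0"
  have "continuous_on {-R..R} f"
    using fD DERIV_isCont by (intro continuous_at_imp_continuous_on) blast
  then have "bounded (f ` {-R..R})"
    by (intro compact_imp_bounded compact_continuous_image) auto
  then obtain B where B: "\<And>t. \<bar>t\<bar> \<le> R \<Longrightarrow> \<bar>f t\<bar> \<le> B"
    by (force simp: bounded_iff abs_le_iff)
  have B0: "B \<ge> 0" using B[of 0] 1 2 True by (auto simp: R_def)
  have "f (t + s) \<le> (C1 + C2 + B) * (1 + f t)" if s: "\<bar>s\<bar> \<le> c0" for t s
  proof -
    have nnt: "C1 * f t \<ge> 0" "C2 * f t \<ge> 0" "B * f t \<ge> 0" using nn[of t] 1 2 B0 by auto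
    consider "t \<ge> T1" | "- t \<ge> T2" | "t \<le> T1" "- T2 \<le> t" by linarith
    then have "f (t + s) \<le> C1 * f t \<or> f (t + s) \<le> C2 * f t \<or> f (t + s) \<le> B"
    proof cases
      case 1 then show ?thesis using \<open>\<And>t s. t \<ge> T1 \<Longrightarrow> \<bar>s\<bar> \<le> c0 \<Longrightarrow> f (t + s) \<le> C1 * f t\<close> s by blast
    next
      case 2 then show ?thesis using \<open>\<And>t s. t \<ge> T2 \<Longrightarrow> \<bar>s\<bar> \<le> c0 \<Longrightarrow> f (- (t + s)) \<le> C2 * f (- t)\<close>[of "- t" "- s"] s by (auto simp: add.commute)
    next
      case 3
      then have "\<bar>t + s\<bar> \<le> R" using s 1(2) 2(2) by (auto simp: R_def)
      then show ?thesis using B[of "t + s"] by auto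
    qed
    then show ?thesis using nnt 1(1) 2(1) B0 by (auto simp: distrib_left distrib_right)
  qed
  then show ?thesis using 1(1) 2(1) B0 by (intro exI[of _ "C1 + C2 + B"]) auto
qed (auto intro!: exI[of _ 0])

text \<open>Superlinear growth separates \<open>f' A\<close> from \<open>f' (A / K)\<close> by a
  multiple of \<open>A powr (qp - 1)\<close> once \<open>K\<close> is large. The lower bound is
  linear in \<open>b\<close>, so it can be integrated along a segment on which only the average of
  the derivative is known; for \<open>b\<close> above \<open>A / K\<close> it is negative and
  monotonicity suffices.\<close>

lemma power_growth_monotonicity_gain:
  assumes f: "convex_C1 f f'" and g: "power_growth f qp qm" and q: "1 < qp"
  shows "\<exists>c>0. \<exists>K\<ge>2. \<exists>L>0. \<forall>A\<ge>L. \<forall>b. c * A powr (qp - 1) * (A / K - b) \<le> (f' A - f' b) * (A - b)"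
proof -
  obtain c C T where c: "c > 0" "C > 0" "T \<ge> 1" "\<And>t. t \<ge> T \<Longrightarrow> c * t powr qp \<le> f t" "\<And>t. t \<ge> T \<Longrightarrow> f t \<le> C * t powr qp"
    using g unfolding power_growth_def by metis
  have nn: "\<And>t. f t \<ge> 0" and m: "mono f'" using f by (auto simp: convex_C1_def)
  \<comment> \<open>Large enough for the upper bound on \<open>f' (A / K)\<close> to be half the
    lower bound on \<open>f' A\<close>, namely \<open>c / 4\<close> against \<open>c / 2\<close>
    times \<open>A powr (qp - 1)\<close>.\<close>
  define K where "K = max 2 ((4 * C * 2 powr qp / c) powr (1 / (qp - 1)))"
  have K: "K \<ge> 2" by (simp add: K_def)
  have Kq: "C * 2 powr qp / K powr (qp - 1) \<le> c / 4"
  proof -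
    have "4 * C * 2 powr qp / c = ((4 * C * 2 powr qp / c) powr (1 / (qp - 1))) powr (qp - 1)"
      using c q by (simp add: powr_powr)
    also have "\<dots> \<le> K powr (qp - 1)"
      using q by (intro powr_mono2) (auto simp: K_def)
    finally show ?thesis using K c by (simp add: field_simps)
  qed
  have "filterlim (\<lambda>A. A powr qp) at_top at_top" using q by (intro real_powr_at_top) auto
  then have "\<forall>\<^sub>F A in at_top. 2 * f 0 / c \<le> A powr qp" by (simp add: filterlim_at_top)
  then obtain L0 where L0: "\<And>A. A \<ge> L0 \<Longrightarrow> 2 * f 0 / c \<le> A powr qp" by (auto simp: eventually_at_top_linorder)
  \<comment> \<open>\<open>L0\<close> makes \<open>f 0\<close> at most half of
    \<open>c * A powr qp\<close>; \<open>K * T\<close> keeps \<open>A / K\<close> in the range of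
    the growth bounds.\<close>
  define L where "L = max L0 (K * T)"
  have L: "L > 0" using K c by (auto simp: L_def less_max_iff_disj)
  have "c / 4 * A powr (qp - 1) * (A / K - b) \<le> (f' A - f' b) * (A - b)" if A: "A \<ge> L" for A b
  proof (cases "b \<le> A / K")
    case True
    have Ap: "A > 0" using A L by linarith
    have AK: "A / K \<ge> T" using A K by (simp add: L_def field_simps)
    then have AT: "A \<ge> T" using K Ap by (smt (verit) divide_le_eq_1 div_by_1 frac_le)
    have p: "A powr qp = A * A powr (qp - 1)" using Ap by (simp add: powr_diff)
    have up: "f' A \<ge> c / 2 * A powr (qp - 1)"
    proof -
      have "f' A * (0 - A) \<le> f 0 - f A" by (rule convex_C1_tangent[OF f])
      moreover have "2 * f 0 \<le> c * A powr qp"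
        using L0[of A] A c by (simp add: L_def field_simps)
      ultimately have "c / 2 * A powr qp \<le> f' A * A" using c(4)[OF AT] by (simp add: field_simps)
      then show ?thesis using Ap by (simp add: p)
    qed
    have dn: "f' (A / K) \<le> c / 4 * A powr (qp - 1)"
    proof -
      have "f' X * X \<le> f (2 * X) - f X" for X using convex_C1_tangent[OF f, of X "2 * X"] by simp
      from this[of "A / K"] have "f' (A / K) * (A / K) \<le> C * (2 * (A / K)) powr qp"
        using nn[of "A / K"] c(5)[of "2 * (A / K)"] AK c(3) by linarith
      also have "\<dots> = C * 2 powr qp * ((A / K) * (A / K) powr (qp - 1))"
      proof -
        have eq: "C * (2 * X) powr qp = C * 2 powr qp * (X * X powr (qp - 1))" if "X > 0" for X
          using that by (simp add: powr_mult powr_diff)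
        have "A / K > 0" using Ap K by simp
        from eq[OF this] show ?thesis .
      qed
      finally have "f' (A / K) \<le> C * 2 powr qp * (A / K) powr (qp - 1)"
        using Ap K by (simp add: field_simps)
      also have "\<dots> = C * 2 powr qp / K powr (qp - 1) * A powr (qp - 1)"
        using Ap K by (simp add: powr_divide)
      also have "\<dots> \<le> c / 4 * A powr (qp - 1)" using Kq by (intro mult_right_mono) auto
      finally show ?thesis .
    qed
    have "f' b \<le> f' (A / K)" using True by (rule monoD[OF m])
    then have 1: "c / 4 * A powr (qp - 1) \<le> f' A - f' b" using up dn by (simp add: field_simps)
    have AKA: "A / K \<le> A" using Ap K by (simp add: field_simps)
    have "c / 4 * A powr (qp - 1) * (A / K - b) \<le> c / 4 * A powr (qp - 1) * (A - b)"
      using AKA c by (intro mult_left_mono) auto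
    also have "\<dots> \<le> (f' A - f' b) * (A - b)" using 1 True AKA by (intro mult_right_mono) auto
    finally show ?thesis .
  next
    case False
    have "c / 4 * A powr (qp - 1) * (A / K - b) \<le> 0" using False c by (intro mult_nonneg_nonpos) auto
    also have "0 \<le> (f' A - f' b) * (A - b)"
      using monoD[OF m, of A b] monoD[OF m, of b A] by (cases "A \<le> b") (auto simp: mult_nonpos_nonpos)
    finally show ?thesis .
  qed
  then show ?thesis using c K L by (intro exI[of _ "c / 4"] conjI exI[of _ K] exI[of _ L]) auto
qed

text \<open>On the compact range below \<open>T\<close> both quantities are bounded, which the
  summands 1 absorb; powers of the derivative and of the energy density thus become interchangeable
  in questions of integrability.\<close>

lemma power_growth_compare:
  assumes f: "convex_C1 f f'" and g: "power_growth f qp qm" and q: "1 < qp"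
  shows "\<exists>C\<ge>0. \<forall>t\<ge>0. t powr qp \<le> C * (1 + f t) \<and> f t \<le> C * (1 + t powr qp)"
proof -
  obtain c C T where c: "c > 0" "C > 0" "T \<ge> 1" "\<And>t. t \<ge> T \<Longrightarrow> c * t powr qp \<le> f t" "\<And>t. t \<ge> T \<Longrightarrow> f t \<le> C * t powr qp"
    using g unfolding power_growth_def by metis
  have nn: "\<And>t. f t \<ge> 0" and fD: "\<And>t. (f has_real_derivative f' t) (at t)"
    using f by (auto simp: convex_C1_def)
  have "continuous_on {0..T} f"
    using fD DERIV_isCont by (intro continuous_at_imp_continuous_on) blast
  then have "bounded (f ` {0..T})"
    by (intro compact_imp_bounded compact_continuous_image) auto
  then obtain B where B: "\<And>t. 0 \<le> t \<Longrightarrow> t \<le> T \<Longrightarrow> \<bar>f t\<bar> \<le> B"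
    by (force simp: bounded_iff)
  have B0: "B \<ge> 0" using B[of 0] c by auto
  define D where "D = 1 / c + C + B + T powr qp"
  have D: "D \<ge> 1 / c" "D \<ge> C" "D \<ge> B" "D \<ge> T powr qp" "D \<ge> 0" using c B0 by (auto simp: D_def)
  have "t powr qp \<le> D * (1 + f t) \<and> f t \<le> D * (1 + t powr qp)" if t: "t \<ge> 0" for t
  proof (cases "t \<ge> T")
    case True
    have "t powr qp \<le> 1 / c * f t" using c(1) c(4)[OF True] by (simp add: field_simps)
    also have "\<dots> \<le> D * f t" using D nn by (intro mult_right_mono) auto
    finally have 1: "t powr qp \<le> D * f t" .
    have "f t \<le> C * t powr qp" using c(5)[OF True] .
    also have "\<dots> \<le> D * t powr qp" using D by (intro mult_right_mono) auto
    finally show ?thesis using 1 D by (simp add: distrib_left)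
  next
    case False
    have "t powr qp \<le> T powr qp" using False t q by (intro powr_mono2) auto
    then have "t powr qp \<le> D" using D by linarith
    moreover have "f t \<le> D" using B[of t] False t D by auto
    moreover have "D * f t \<ge> 0" "D * t powr qp \<ge> 0" using D nn by auto
    ultimately show ?thesis by (simp add: distrib_left)
  qed
  then show ?thesis using D by (intro exI[of _ D]) auto
qed

section \<open>The Euler inequality and difference quotients\<close>

text \<open>The weak chain rule with \<open>\<eta> * \<Theta>\<close> as test function; the product
  rule contributes the term with the derivative of \<open>\<eta>\<close>. The cutoff supplies the
  compact support in \<open>W\<close>, so \<open>\<Theta>\<close> may belong to any set
  \<open>U\<close>, as translated variations will require.\<close>

lemma cutoff_chain_rule:
  fixes v q \<eta> \<Theta> :: "real ^ 'n \<Rightarrow> real" and G G' :: "real \<Rightarrow> real"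
  assumes v[measurable]: "v \<in> borel_measurable borel" and vM: "\<And>x. \<bar>v x\<bar> \<le> M"
    and q: "integrable lborel q"
    and line: "\<And>n. n \<ge> n0 \<Longrightarrow> AE x in lborel. x \<in> W \<longrightarrow>
          v (x + (1 / real (Suc n)) *\<^sub>R axis j 1) - v x = line_int q j (1 / real (Suc n)) x"
    and G: "\<And>t. (G has_real_derivative G' t) (at t)" and G'c: "continuous_on UNIV G'"
    and \<eta>: "\<eta> \<in> test_functions W" and \<Theta>: "\<Theta> \<in> test_functions U"
  shows "(LBINT x. \<eta> x * G (v x) * grad \<Theta> x $ j)
       = - (LBINT x. (\<eta> x * G' (v x) * q x + G (v x) * grad \<eta> x $ j) * \<Theta> x)"
proof -
  obtain C where C: "C \<ge> 0" "\<And>x. \<bar>\<eta> x\<bar> \<le> C" "\<And>x j. \<bar>grad \<eta> x $ j\<bar> \<le> C"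
    using test_function_bounded[OF \<eta>] by blast
  obtain D where D: "D \<ge> 0" "\<And>x. \<bar>\<Theta> x\<bar> \<le> D" "\<And>x j. \<bar>grad \<Theta> x $ j\<bar> \<le> D"
    using test_function_bounded[OF \<Theta>] by blast
  have m[measurable]: "\<eta> \<in> borel_measurable borel" "(\<lambda>x. grad \<eta> x $ j) \<in> borel_measurable borel"
    "\<Theta> \<in> borel_measurable borel" "(\<lambda>x. grad \<Theta> x $ j) \<in> borel_measurable borel" "q \<in> borel_measurable borel"
    using test_function_borel[OF \<eta>] test_function_grad_borel[OF \<eta>]
      test_function_borel[OF \<Theta>] test_function_grad_borel[OF \<Theta>] q by auto
  have [measurable]: "G \<in> borel_measurable borel" "G' \<in> borel_measurable borel"
    using C1_borel[OF G] G'c by (auto intro: borel_measurable_continuous_onI)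
  obtain C1 where C1: "\<And>t. \<bar>t\<bar> \<le> M \<Longrightarrow> \<bar>G t\<bar> \<le> C1" "\<And>t. \<bar>t\<bar> \<le> M \<Longrightarrow> \<bar>G' t\<bar> \<le> C1"
    by (rule C1_bounds[OF G G'c, of M]) blast
  have C10: "C1 \<ge> 0" using C1(1)[OF vM[of 0]] by linarith
  obtain K where K: "compact K" "K \<subseteq> W" and z: "\<And>x. x \<notin> K \<Longrightarrow> \<eta> x = 0"
  proof (rule that[of "closure {x. \<eta> x \<noteq> 0}"])
    show "compact (closure {x. \<eta> x \<noteq> 0})" "closure {x. \<eta> x \<noteq> 0} \<subseteq> W"
      using \<eta> by (simp_all only: test_functions_def compactly_contained_def mem_Collect_eq)
    show "\<eta> x = 0" if "x \<notin> closure {x. \<eta> x \<noteq> 0}" for x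
      using that closure_subset[of "{x. \<eta> x \<noteq> 0}"] by blast
  qed
  have gz: "grad \<eta> x $ j = 0" if "x \<notin> K" for x
    using grad_eq_0_outside[OF compact_imp_closed[OF K(1)] z that] by simp
  note iK = integrable_compact_support[OF _ K(1)]
  have 1: "(LBINT x. G (v x) * (\<eta> x * grad \<Theta> x $ j + grad \<eta> x $ j * \<Theta> x)) = - (LBINT x. G' (v x) * q x * (\<eta> x * \<Theta> x))"
  proof (rule chain_rule_weak[OF v vM q line G G'c, where C="2 * (C * D)" and K=K])
    show "\<bar>\<eta> x * \<Theta> x\<bar> \<le> 2 * (C * D)" for x
    proof -
      have "\<bar>\<eta> x\<bar> * \<bar>\<Theta> x\<bar> \<le> C * D" using C D by (intro mult_mono) auto
      then show ?thesis using mult_nonneg_nonneg[OF C(1) D(1)] unfolding abs_mult by linarith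
    qed
    show "\<bar>\<eta> x * grad \<Theta> x $ j + grad \<eta> x $ j * \<Theta> x\<bar> \<le> 2 * (C * D)" for x
      using mult_mono[OF C(2)[of x] D(3)[of x j]] mult_mono[OF C(3)[of x j] D(2)[of x]] C(1) D(1)
        abs_triangle_ineq[of "\<eta> x * grad \<Theta> x $ j" "grad \<eta> x $ j * \<Theta> x"]
      unfolding abs_mult by simp
    show "((\<lambda>r. \<eta> (x + r *\<^sub>R axis j 1) * \<Theta> (x + r *\<^sub>R axis j 1)) has_real_derivative
        \<eta> (x + r *\<^sub>R axis j 1) * grad \<Theta> (x + r *\<^sub>R axis j 1) $ j + grad \<eta> (x + r *\<^sub>R axis j 1) $ j * \<Theta> (x + r *\<^sub>R axis j 1)) (at r)" for x r
      using DERIV_mult[OF has_real_derivative_line[where x=x and r=r and j=j, OF test_function_differentiable[OF \<eta>]]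
          has_real_derivative_line[where x=x and r=r and j=j, OF test_function_differentiable[OF \<Theta>]]]
      by (simp add: algebra_simps)
  qed (use K z in auto)
  have i1: "integrable lborel (\<lambda>x. G (v x) * (\<eta> x * grad \<Theta> x $ j))"
  proof (rule iK[of _ "C1 * (C * D)"])
    show "\<bar>G (v x) * (\<eta> x * grad \<Theta> x $ j)\<bar> \<le> C1 * (C * D)" for x
      unfolding abs_mult using C1(1)[OF vM[of x]] C D C10 by (intro mult_mono) auto
  qed (use z in auto)
  have i2: "integrable lborel (\<lambda>x. G (v x) * (grad \<eta> x $ j * \<Theta> x))"
  proof (rule iK[of _ "C1 * (C * D)"])
    show "\<bar>G (v x) * (grad \<eta> x $ j * \<Theta> x)\<bar> \<le> C1 * (C * D)" for x
      unfolding abs_mult using C1(1)[OF vM[of x]] C D C10 by (intro mult_mono) auto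
  qed (use gz in auto)
  have i3: "integrable lborel (\<lambda>x. G' (v x) * q x * (\<eta> x * \<Theta> x))"
  proof (rule Bochner_Integration.integrable_bound[where f="\<lambda>x. C1 * q x * (C * D)"])
    show "AE x in lborel. norm (G' (v x) * q x * (\<eta> x * \<Theta> x)) \<le> norm (C1 * q x * (C * D))"
    proof (rule AE_I2)
      fix x
      have "\<bar>G' (v x)\<bar> * \<bar>q x\<bar> * (\<bar>\<eta> x\<bar> * \<bar>\<Theta> x\<bar>) \<le> C1 * \<bar>q x\<bar> * (C * D)"
        using C1(2)[OF vM[of x]] C D C10 by (intro mult_mono) auto
      then show "norm (G' (v x) * q x * (\<eta> x * \<Theta> x)) \<le> norm (C1 * q x * (C * D))"
        using C1 C10 C(1) D(1) by (simp add: abs_mult)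
    qed
  qed (use q in auto)
  have "(LBINT x. \<eta> x * G (v x) * grad \<Theta> x $ j) = (LBINT x. G (v x) * (\<eta> x * grad \<Theta> x $ j))"
    by (simp add: ac_simps)
  also have "\<dots> = - (LBINT x. G' (v x) * q x * (\<eta> x * \<Theta> x)) - (LBINT x. G (v x) * (grad \<eta> x $ j * \<Theta> x))"
    using 1 i1 i2 by (simp add: distrib_left)
  also have "\<dots> = - (LBINT x. G' (v x) * q x * (\<eta> x * \<Theta> x) + G (v x) * (grad \<eta> x $ j * \<Theta> x))"
    using i2 i3 by simp
  also have "(LBINT x. G' (v x) * q x * (\<eta> x * \<Theta> x) + G (v x) * (grad \<eta> x $ j * \<Theta> x))
     = (LBINT x. (\<eta> x * G' (v x) * q x + G (v x) * grad \<eta> x $ j) * \<Theta> x)"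
    by (rule Bochner_Integration.integral_cong) (auto simp: algebra_simps)
  finally show ?thesis .
qed

section \<open>Variations of finite energy and the Euler inequality\<close>

definition split_energy :: "(real ^ 'n) set \<Rightarrow> ('n \<Rightarrow> real \<Rightarrow> real) \<Rightarrow> ('n \<Rightarrow> real ^ 'n \<Rightarrow> real) \<Rightarrow> ennreal" where
  "split_energy \<Omega> f p = (\<integral>\<^sup>+x. ennreal (indicator \<Omega> x * (\<Sum>j\<in>UNIV. f j (p j x))) \<partial>lborel)"

text \<open>A variation is carried together with an explicit gradient \<open>\<psi>\<close>, so that
  energies can be compared without choosing weak gradients.\<close>

definition admissible_variation ::
    "(real ^ 'n) set \<Rightarrow> (real ^ 'n \<Rightarrow> real) \<Rightarrow> ('n \<Rightarrow> real ^ 'n \<Rightarrow> real) \<Rightarrow> bool" where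
  "admissible_variation \<Omega> \<phi> \<psi> \<longleftrightarrow> \<phi> \<in> borel_measurable borel \<and> (\<exists>B. \<forall>x. \<bar>\<phi> x\<bar> \<le> B) \<and>
     (\<forall>j. integrable lborel (\<psi> j) \<and> weak_pd \<Omega> \<phi> (\<psi> j) j) \<and>
     (\<exists>K. compact K \<and> K \<subseteq> \<Omega> \<and> (\<forall>x. x \<notin> K \<longrightarrow> \<phi> x = 0 \<and> (\<forall>j. \<psi> j x = 0)))"

lemma admissible_variation_scale:
  assumes "admissible_variation \<Omega> \<phi> \<psi>"
  shows "admissible_variation \<Omega> (\<lambda>x. t * \<phi> x) (\<lambda>j x. t * \<psi> j x)"
proof -
  obtain B where B: "\<And>x. \<bar>\<phi> x\<bar> \<le> B" using assms by (auto simp: admissible_variation_def)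
  then have "\<bar>t * \<phi> x\<bar> \<le> \<bar>t\<bar> * B" for x by (simp add: abs_mult mult_left_mono)
  then have "\<exists>B. \<forall>x. \<bar>t * \<phi> x\<bar> \<le> B" by blast
  with assms show ?thesis
    unfolding admissible_variation_def weak_pd_def
    by (auto simp: mult.assoc)
qed

text \<open>An abstract form of the situation with Borel functions on the whole space: translations
  need no change of domain, \<open>u\<close> is bounded at every point, and minimality speaks about
  gradient components. The assumptions are symmetric under reflection of the values, with
  \<open>qp\<close> and \<open>qm\<close> exchanged.\<close>

locale split_minimizer =
  fixes \<Omega> :: "(real ^ 'n) set" and f f' :: "'n \<Rightarrow> real \<Rightarrow> real" and qp qm :: "'n \<Rightarrow> real"
    and Q M :: real and u :: "real ^ 'n \<Rightarrow> real" and p :: "'n \<Rightarrow> real ^ 'n \<Rightarrow> real"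
    and \<zeta> :: "real ^ 'n \<Rightarrow> real"
  assumes open_\<Omega>: "open \<Omega>"
    and bump: "std_bump \<zeta>"
    and f_C1: "\<And>j. convex_C1 (f j) (f' j)"
    and f_growth: "\<And>j. power_growth (f j) (qp j) (qm j)"
    and q: "\<And>j. 1 < qp j" "\<And>j. 1 < qm j" "\<And>j. qp j \<le> Q" "\<And>j. qm j \<le> Q"
    and u_borel[measurable]: "u \<in> borel_measurable borel"
    and u_int: "integrable lborel u"
    and u_bound: "\<And>x. \<bar>u x\<bar> \<le> M"
    and p_int: "\<And>j. integrable lborel (p j)"
    and p_weak: "\<And>j. weak_pd \<Omega> u (p j) j"
    and energy_finite: "split_energy \<Omega> f p < \<infinity>"
    and minimal: "\<And>\<phi> \<psi>. admissible_variation \<Omega> \<phi> \<psi> \<Longrightarrow>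
        split_energy \<Omega> f (\<lambda>j x. p j x + \<psi> j x) < \<infinity> \<Longrightarrow>
        split_energy \<Omega> f p \<le> split_energy \<Omega> f (\<lambda>j x. p j x + \<psi> j x)"
begin

lemma f_nonneg: "f j t \<ge> 0" using f_C1[of j] by (simp add: convex_C1_def)

lemma f_deriv: "(f j has_real_derivative f' j t) (at t)" using f_C1[of j] by (simp add: convex_C1_def)

lemma f_borel[measurable]: "f j \<in> borel_measurable borel"
  using f_deriv DERIV_isCont by (intro borel_measurable_continuous_onI continuous_at_imp_continuous_on) blast

lemma f'_borel[measurable]: "f' j \<in> borel_measurable borel"
  using f_C1[of j] by (intro borel_measurable_continuous_onI) (simp add: convex_C1_def)

lemma p_borel[measurable]: "p j \<in> borel_measurable borel" using p_int[of j] by auto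

lemma f'_mono: "(f' j a - f' j b) * (a - b) \<ge> 0"
proof -
  have "mono (f' j)" using f_C1[of j] by (simp add: convex_C1_def)
  then show ?thesis
    by (cases a b rule: linorder_cases) (auto dest: monoD[of _ a b] monoD[of _ b a] simp: mult_nonpos_nonpos)
qed

lemma \<Omega>_borel[measurable]: "\<Omega> \<in> sets borel" using open_\<Omega> by simp

lemma split_energy_integrable:
  assumes [measurable]: "\<And>j. g j \<in> borel_measurable borel"
  shows "split_energy \<Omega> f g < \<infinity> \<longleftrightarrow> integrable lborel (\<lambda>x. indicator \<Omega> x * (\<Sum>j\<in>UNIV. f j (g j x)))"
proof -
  have "\<bar>indicator \<Omega> x * (\<Sum>j\<in>UNIV. f j (g j x))\<bar> = indicator \<Omega> x * (\<Sum>j\<in>UNIV. f j (g j x))" for x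
    using f_nonneg by (simp add: sum_nonneg)
  then show ?thesis
    unfolding split_energy_def integrable_iff_bounded by simp
qed

lemma split_energy_eq:
  assumes "integrable lborel (\<lambda>x. indicator \<Omega> x * (\<Sum>j\<in>UNIV. f j (g j x)))"
  shows "split_energy \<Omega> f g = ennreal (LBINT x. indicator \<Omega> x * (\<Sum>j\<in>UNIV. f j (g j x)))"
  unfolding split_energy_def using f_nonneg
  by (intro nn_integral_eq_integral assms AE_I2 mult_nonneg_nonneg sum_nonneg) auto

text \<open>A one-sided variation is enough: convexity makes the energy finite on the whole segment
  from \<open>p\<close> to the perturbed gradient and bounds every difference quotient by the one at
  parameter 1, so that Fatou's lemma applies to the gap. Integrability of the derivative is obtained
  along the way.\<close>

lemma euler_inequality:
  assumes adm: "admissible_variation \<Omega> \<phi> \<psi>" and fin: "split_energy \<Omega> f (\<lambda>j x. p j x + \<psi> j x) < \<infinity>"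
  shows "integrable lborel (\<lambda>x. \<Sum>j\<in>UNIV. f' j (p j x) * \<psi> j x)"
    and "0 \<le> (LBINT x. (\<Sum>j\<in>UNIV. f' j (p j x) * \<psi> j x))"
proof -
  have [measurable]: "\<psi> j \<in> borel_measurable borel" for j
    using adm borel_measurable_integrable[of lborel "\<psi> j"] by (auto simp: admissible_variation_def)
  have \<psi>0: "\<psi> j x = 0" if "x \<notin> \<Omega>" for j x
    using adm that unfolding admissible_variation_def by blast
  define I where "I t x = indicator \<Omega> x * (\<Sum>j\<in>UNIV. f j (p j x + t * \<psi> j x))" for t x
  have [measurable]: "I t \<in> borel_measurable borel" for t unfolding I_def by measurable
  have I_nonneg: "I t x \<ge> 0" for t x unfolding I_def using f_nonneg by (simp add: sum_nonneg)
  have conv: "f j (a + t * b) \<le> (1 - t) * f j a + t * f j (a + b)" if "0 \<le> t" "t \<le> 1" for j t a b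
  proof -
    have "f j ((1 - t) * a + t * (a + b)) \<le> (1 - t) * f j a + t * f j (a + b)"
      by (rule convex_C1_convex[OF f_C1 that])
    moreover have "(1 - t) * a + t * (a + b) = a + t * b" by (simp add: algebra_simps)
    ultimately show ?thesis by simp
  qed
  have I_conv: "I t x \<le> (1 - t) * I 0 x + t * I 1 x" if "0 \<le> t" "t \<le> 1" for t x
  proof -
    have "(\<Sum>j\<in>UNIV. f j (p j x + t * \<psi> j x)) \<le> (\<Sum>j\<in>UNIV. (1 - t) * f j (p j x) + t * f j (p j x + \<psi> j x))"
      using conv[OF that] by (intro sum_mono)
    then show ?thesis
      unfolding I_def by (simp add: indicator_def sum.distrib sum_distrib_left)
  qed
  have I0: "integrable lborel (I 0)"
    using energy_finite split_energy_integrable[of p] by (simp add: I_def[abs_def])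
  have I1: "integrable lborel (I 1)"
    using fin split_energy_integrable[of "\<lambda>j x. p j x + \<psi> j x"] by (simp add: I_def[abs_def])
  have It: "integrable lborel (I t)" if t: "0 \<le> t" "t \<le> 1" for t
  proof (rule Bochner_Integration.integrable_bound)
    show "integrable lborel (\<lambda>x. (1 - t) * I 0 x + t * I 1 x)" using I0 I1 by simp
    show "AE x in lborel. norm (I t x) \<le> norm ((1 - t) * I 0 x + t * I 1 x)"
      using order_trans[OF I_conv[OF t] abs_ge_self] I_nonneg by (intro AE_I2) auto
  qed simp
  define E where "E x = (\<Sum>j\<in>UNIV. f' j (p j x) * \<psi> j x)" for x
  have [measurable]: "E \<in> borel_measurable borel" unfolding E_def by measurable
  \<comment> \<open>Since \<open>t 0 = 1\<close>, the quotient \<open>g 0\<close> is the full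
    increment \<open>I 1 - I 0\<close>, the common majorant.\<close>
  define t where "t n = 1 / real (Suc n)" for n
  have t: "0 < t n" "0 \<le> t n" "t n \<le> 1" for n by (auto simp: t_def)
  define g where "g n x = (I (t n) x - I 0 x) / t n" for n x
  have [measurable]: "g n \<in> borel_measurable borel" for n unfolding g_def by measurable
  have gi: "integrable lborel (g n)" for n
    unfolding g_def using It[OF t(2,3)] I0 by simp
  have g_nonneg: "0 \<le> (LBINT x. g n x)" for n
  proof -
    have adm': "admissible_variation \<Omega> (\<lambda>x. t n * \<phi> x) (\<lambda>j x. t n * \<psi> j x)"
      by (rule admissible_variation_scale[OF adm])
    have "split_energy \<Omega> f p \<le> split_energy \<Omega> f (\<lambda>j x. p j x + t n * \<psi> j x)"
      using minimal[OF adm'] split_energy_integrable[of "\<lambda>j x. p j x + t n * \<psi> j x"] It[OF t(2,3), of n]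
      by (simp add: I_def[abs_def])
    then have "ennreal (LBINT x. I 0 x) \<le> ennreal (LBINT x. I (t n) x)"
      using split_energy_eq[of p] split_energy_eq[of "\<lambda>j x. p j x + t n * \<psi> j x"] I0 It[OF t(2,3), of n]
      by (simp add: I_def[abs_def])
    then have "(LBINT x. I 0 x) \<le> (LBINT x. I (t n) x)"
      using I_nonneg by (subst (asm) ennreal_le_iff) (auto intro: integral_nonneg)
    then show ?thesis
      unfolding g_def using It[OF t(2,3), of n] I0 t(1)[of n] by simp
  qed
  have g_le: "g n x \<le> g 0 x" for n x
  proof -
    have "I (t n) x - I 0 x \<le> t n * (I 1 x - I 0 x)"
      using I_conv[OF t(2,3), of n x] by (simp add: algebra_simps)
    then have "g n x \<le> I 1 x - I 0 x"
      unfolding g_def using t(1)[of n] by (simp add: divide_le_eq mult.commute)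
    then show ?thesis by (simp add: g_def t_def)
  qed
  have g_lim: "(\<lambda>n. g n x) \<longlonglongrightarrow> E x" for x
  proof (cases "x \<in> \<Omega>")
    case True
    have tl: "filterlim t (at 0) sequentially"
      unfolding filterlim_at
    proof
      show "\<forall>\<^sub>F n in sequentially. t n \<in> UNIV \<and> t n \<noteq> 0" using t(1) by (simp add: less_imp_neq[symmetric])
      show "t \<longlonglongrightarrow> 0"
        using LIMSEQ_inverse_real_of_nat by (simp add: inverse_eq_divide t_def[abs_def])
    qed
    have lim1: "(\<lambda>n. (f j (p j x + t n * \<psi> j x) - f j (p j x)) / t n) \<longlonglongrightarrow> f' j (p j x) * \<psi> j x" for j
    proof -
      have "((\<lambda>s. f j (p j x + s * \<psi> j x)) has_real_derivative f' j (p j x) * \<psi> j x) (at 0)"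
        by (rule DERIV_chain2[where f="f j" and g="\<lambda>s. p j x + s * \<psi> j x"])
          (use f_deriv[of j "p j x"] in \<open>auto intro!: derivative_eq_intros\<close>)
      then have "((\<lambda>h. (f j (p j x + h * \<psi> j x) - f j (p j x)) / h) \<longlongrightarrow> f' j (p j x) * \<psi> j x) (at 0)"
        by (simp add: has_field_derivative_iff)
      from filterlim_compose[OF this tl] show ?thesis .
    qed
    have "(\<lambda>n. \<Sum>j\<in>UNIV. (f j (p j x + t n * \<psi> j x) - f j (p j x)) / t n) \<longlonglongrightarrow> E x"
      unfolding E_def by (intro tendsto_sum lim1)
    then show ?thesis
      using True by (simp add: g_def I_def sum_subtractf flip: sum_divide_distrib)
  qed (auto simp: g_def I_def E_def \<psi>0)
  have Ele: "E x \<le> g 0 x" for x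
    using LIMSEQ_le_const2[OF g_lim[of x]] g_le by blast
  have "(\<integral>\<^sup>+x. ennreal (g 0 x - E x) \<partial>lborel) = (\<integral>\<^sup>+x. liminf (\<lambda>n. ennreal (g 0 x - g n x)) \<partial>lborel)"
  proof (rule nn_integral_cong)
    fix x
    have "(\<lambda>n. ennreal (g 0 x - g n x)) \<longlonglongrightarrow> ennreal (g 0 x - E x)"
      by (intro tendsto_ennrealI tendsto_diff tendsto_const g_lim)
    then show "ennreal (g 0 x - E x) = liminf (\<lambda>n. ennreal (g 0 x - g n x))"
      by (simp add: lim_imp_Liminf)
  qed
  \<comment> \<open>Fatou for the nonnegative gaps \<open>g 0 - g n\<close>. The resulting bound
    yields both the integrability of \<open>E\<close> and the sign of its integral.\<close>
  also have "\<dots> \<le> liminf (\<lambda>n. \<integral>\<^sup>+x. ennreal (g 0 x - g n x) \<partial>lborel)"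
    by (rule nn_integral_liminf) simp
  also have "\<dots> \<le> liminf (\<lambda>n. ennreal (LBINT x. g 0 x))"
  proof (intro Liminf_mono always_eventually allI)
    fix n
    have "(\<integral>\<^sup>+x. ennreal (g 0 x - g n x) \<partial>lborel) = ennreal (LBINT x. g 0 x - g n x)"
      using gi g_le by (intro nn_integral_eq_integral) auto
    also have "\<dots> \<le> ennreal (LBINT x. g 0 x)"
      using gi g_nonneg[of n] by (intro ennreal_leI) simp
    finally show "(\<integral>\<^sup>+x. ennreal (g 0 x - g n x) \<partial>lborel) \<le> ennreal (LBINT x. g 0 x)" .
  qed
  also have "\<dots> = ennreal (LBINT x. g 0 x)" by (simp add: Liminf_const)
  finally have fatou: "(\<integral>\<^sup>+x. ennreal (g 0 x - E x) \<partial>lborel) \<le> ennreal (LBINT x. g 0 x)" .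
  then have "(\<integral>\<^sup>+x. ennreal (g 0 x - E x) \<partial>lborel) < \<infinity>"
    using le_less_trans by fastforce
  then have gE: "integrable lborel (\<lambda>x. g 0 x - E x)"
    using Ele by (intro integrableI_nonneg) auto
  then have Ei: "integrable lborel E"
    using Bochner_Integration.integrable_diff[OF gi[of 0] gE] by simp
  then show "integrable lborel (\<lambda>x. \<Sum>j\<in>UNIV. f' j (p j x) * \<psi> j x)" by (simp add: E_def[abs_def])
  have "ennreal (LBINT x. g 0 x - E x) \<le> ennreal (LBINT x. g 0 x)"
    using fatou nn_integral_eq_integral[OF gE] Ele by simp
  then have "(LBINT x. g 0 x - E x) \<le> (LBINT x. g 0 x)"
    using g_nonneg[of 0] by (simp add: ennreal_le_iff)
  then show "0 \<le> (LBINT x. (\<Sum>j\<in>UNIV. f' j (p j x) * \<psi> j x))"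
    using gi[of 0] Ei by (simp add: E_def[abs_def])
qed

end

section \<open>Comparison of the minimizer with its translate\<close>

context split_minimizer
begin

lemma f_integrable_subset:
  assumes "K \<subseteq> \<Omega>" "K \<in> sets borel"
  shows "integrable lborel (\<lambda>x. indicator K x * f j (p j x))"
proof (rule Bochner_Integration.integrable_bound)
  show "integrable lborel (\<lambda>x. indicator \<Omega> x * (\<Sum>j\<in>UNIV. f j (p j x)))"
    using energy_finite split_energy_integrable[of p] by simp
  show "(\<lambda>x. indicator K x * f j (p j x)) \<in> borel_measurable lborel" using assms(2) by measurable
  show "AE x in lborel. norm (indicator K x * f j (p j x)) \<le> norm (indicator \<Omega> x * (\<Sum>j\<in>UNIV. f j (p j x)))"
  proof (rule AE_I2)
    fix x
    have "f j (p j x) \<le> (\<Sum>j\<in>UNIV. f j (p j x))" by (rule member_le_sum) (use f_nonneg in auto)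
    moreover have "0 \<le> (\<Sum>j\<in>UNIV. f j (p j x))" using f_nonneg by (simp add: sum_nonneg)
    ultimately show "norm (indicator K x * f j (p j x)) \<le> norm (indicator \<Omega> x * (\<Sum>j\<in>UNIV. f j (p j x)))"
      using assms(1) f_nonneg[of j "p j x"] by (auto simp: indicator_def)
  qed
qed

text \<open>The radii are nested: a segment of length at most \<open>\<epsilon>\<close> starting
  within \<open>4 * \<epsilon>\<close> of \<open>z\<close> stays within
  \<open>5 * \<epsilon>\<close>. A further translation by \<open>h\<close> lowers the radius to
  \<open>3 * \<epsilon>\<close>, and the cutoff is supported within
  \<open>2 * \<epsilon>\<close>.\<close>

lemma u_line:
  assumes \<epsilon>: "0 < \<epsilon>" "cball z (5 * \<epsilon>) \<subseteq> \<Omega>" and s: "0 \<le> s" "s \<le> \<epsilon>"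
  shows "AE x in lborel. x \<in> ball z (4 * \<epsilon>) \<longrightarrow> u (x + s *\<^sub>R axis j 1) - u x = line_int (p j) j s x"
proof (rule weak_pd_line[OF bump u_int p_int p_weak _ s(1)])
  fix x r assume x: "x \<in> ball z (4 * \<epsilon>)" "0 \<le> r" "r \<le> s"
  have "dist z (x + r *\<^sub>R axis j 1) \<le> dist z x + norm (r *\<^sub>R axis j 1 :: real ^ 'n)"
    by (rule dist_add_le)
  also have "\<dots> \<le> 4 * \<epsilon> + \<epsilon>" using x s by auto
  finally show "x + r *\<^sub>R axis j 1 \<in> \<Omega>" using \<epsilon> by auto
qed auto

text \<open>The increment of \<open>u\<close> in direction \<open>i\<close> inherits the line
  formula by linearity, used at \<open>x\<close> and at its translate; this is the input to the
  chain rule.\<close>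

lemma translated_line:
  assumes \<epsilon>: "0 < \<epsilon>" "cball z (5 * \<epsilon>) \<subseteq> \<Omega>" and h: "0 < h" "h \<le> \<epsilon>" and s: "0 \<le> s" "s \<le> \<epsilon>"
  shows "AE x in lborel. x \<in> ball z (3 * \<epsilon>) \<longrightarrow>
     (u (x + s *\<^sub>R axis j 1 + h *\<^sub>R axis i 1) - u (x + s *\<^sub>R axis j 1)) - (u (x + h *\<^sub>R axis i 1) - u x)
      = line_int (\<lambda>x. p j (x + h *\<^sub>R axis i 1) - p j x) j s x"
proof -
  let ?h = "h *\<^sub>R axis i 1 :: real ^ 'n"
  have A: "AE x in lborel. x \<in> ball z (4 * \<epsilon>) \<longrightarrow> u (x + s *\<^sub>R axis j 1) - u x = line_int (p j) j s x"
    by (rule u_line[OF \<epsilon> s])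
  have B: "AE x in lborel. integrable lborel (\<lambda>r. indicator {0..s} r * p j (x + r *\<^sub>R axis j 1))"
    by (rule line_integrable_AE[OF p_int])
  from A B AE_lborel_shift[OF A, of ?h] AE_lborel_shift[OF B, of ?h] show ?thesis
  proof eventually_elim
    case (elim x)
    show ?case
    proof
      assume x: "x \<in> ball z (3 * \<epsilon>)"
      have "dist z (x + ?h) \<le> dist z x + norm ?h"
        by (rule dist_add_le)
      then have xh: "x + ?h \<in> ball z (4 * \<epsilon>)" using x h by auto
      have xx: "x \<in> ball z (4 * \<epsilon>)" using x \<epsilon> by auto
      have "line_int (\<lambda>x. p j (x + ?h) - p j x) j s x
        = (LBINT r. indicator {0..s} r * p j (x + ?h + r *\<^sub>R axis j 1) - indicator {0..s} r * p j (x + r *\<^sub>R axis j 1))"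
        unfolding line_int_def by (simp add: right_diff_distrib ac_simps)
      also have "\<dots> = line_int (p j) j s (x + ?h) - line_int (p j) j s x"
        unfolding line_int_def using elim(2,4) by simp
      also have "\<dots> = (u (x + ?h + s *\<^sub>R axis j 1) - u (x + ?h)) - (u (x + s *\<^sub>R axis j 1) - u x)"
        using elim(1,3) xh xx by simp
      finally show "(u (x + s *\<^sub>R axis j 1 + ?h) - u (x + s *\<^sub>R axis j 1)) - (u (x + ?h) - u x)
        = line_int (\<lambda>x. p j (x + ?h) - p j x) j s x"
        by (simp add: ac_simps)
    qed
  qed
qed

text \<open>Two Euler inequalities are combined, one for the variation \<open>\<phi>\<close> and one
  for minus its translate. After translating back, they test f_j' at p_j and at the shifted p_j
  against the same \<open>\<psi>\<close> with opposite signs, so their sum contains the monotone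
  difference of f_j'.\<close>

lemma difference_inequality:
  fixes z :: "real ^ 'n" and i :: 'n
  assumes \<epsilon>: "0 < \<epsilon>" "cball z (5 * \<epsilon>) \<subseteq> \<Omega>" and h: "0 < h" "h \<le> \<epsilon>"
    and G: "\<And>t. (G has_real_derivative G' t) (at t)" and G'c: "continuous_on UNIV G'" and G'0: "\<And>t. G' t \<ge> 0"
  defines "\<eta> \<equiv> bump_at \<zeta> z \<epsilon>" and "v \<equiv> \<lambda>x. u (x + h *\<^sub>R axis i 1) - u x"
    and "sh \<equiv> \<lambda>j x. p j (x + h *\<^sub>R axis i 1)"
  shows "(\<integral>\<^sup>+x. ennreal (\<eta> x * G' (v x) * ((f' i (sh i x) - f' i (p i x)) * (sh i x - p i x))) \<partial>lborel)
     \<le> (\<integral>\<^sup>+x. ennreal (\<bar>G (v x)\<bar> * (\<Sum>j\<in>UNIV. \<bar>grad \<eta> x $ j\<bar> * (\<bar>f' j (sh j x)\<bar> + \<bar>f' j (p j x)\<bar>))) \<partial>lborel)"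
proof -
  let ?h = "h *\<^sub>R axis i 1 :: real ^ 'n"
  define K where "K = cball z (2 * \<epsilon>)"
  have [measurable]: "K \<in> sets borel" by (simp add: K_def)
  have K: "compact K" "K \<subseteq> \<Omega>" "K \<subseteq> ball z (3 * \<epsilon>)" using \<epsilon> by (auto simp: K_def)
  have Kh: "x + ?h \<in> \<Omega>" if "x \<in> K" for x
  proof -
    have "dist z (x + ?h) \<le> dist z x + norm ?h"
      by (rule dist_add_le)
    then show ?thesis using that h \<epsilon> by (auto simp: K_def)
  qed
  have \<eta>T: "\<eta> \<in> test_functions (ball z (3 * \<epsilon>))"
    unfolding \<eta>_def using bump \<epsilon> by (intro bump_at_test_function) auto
  obtain L where L: "L \<ge> 0" "\<And>x. \<bar>\<eta> x\<bar> \<le> L" "\<And>x j. \<bar>grad \<eta> x $ j\<bar> \<le> L"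
    using test_function_bounded[OF \<eta>T] by blast
  have \<eta>01: "0 \<le> \<eta> x" "\<eta> x \<le> 1" for x unfolding \<eta>_def by (rule bump_at_nonneg[OF bump] bump_at_le_1[OF bump])+
  have \<eta>0: "\<eta> x = 0" if "x \<notin> K" for x
    using bump_at_eq_0[OF bump \<epsilon>(1)] that by (simp add: \<eta>_def K_def)
  have g\<eta>0: "grad \<eta> x $ j = 0" if "x \<notin> K" for x j
    using grad_eq_0_outside[OF compact_imp_closed[OF K(1)] \<eta>0 that] by simp
  have m[measurable]: "\<eta> \<in> borel_measurable borel" "\<And>j. (\<lambda>x. grad \<eta> x $ j) \<in> borel_measurable borel"
    by (rule test_function_borel[OF \<eta>T] test_function_grad_borel[OF \<eta>T])+
  have [measurable]: "G \<in> borel_measurable borel" "G' \<in> borel_measurable borel"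
    using C1_borel[OF G] G'c by (auto intro: borel_measurable_continuous_onI)
  have v[measurable]: "v \<in> borel_measurable borel" unfolding v_def by measurable
  have [measurable]: "sh j \<in> borel_measurable borel" for j unfolding sh_def by measurable
  have vM: "\<bar>v x\<bar> \<le> 2 * M" for x
    using u_bound[of x] u_bound[of "x + ?h"] unfolding v_def by linarith
  obtain C1 where C1: "\<And>t. \<bar>t\<bar> \<le> 2 * M \<Longrightarrow> \<bar>G t\<bar> \<le> C1" "\<And>t. \<bar>t\<bar> \<le> 2 * M \<Longrightarrow> \<bar>G' t\<bar> \<le> C1"
    by (rule C1_bounds[OF G G'c, of "2 * M"]) blast
  \<comment> \<open>The maximum with 1 keeps \<open>B\<close> positive, so that
    \<open>\<tau> = 1 / B\<close> normalises both \<open>G\<close> and \<open>G'\<close>.\<close>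
  define B where "B = max C1 1"
  have B: "B > 0" "\<And>x. \<bar>G (v x)\<bar> \<le> B" "\<And>x. G' (v x) \<le> B"
    using C1[OF vM] G'0 by (auto simp: B_def le_max_iff_disj abs_le_iff)
  define \<tau> where "\<tau> = 1 / B"
  have \<tau>: "\<tau> > 0" "\<And>x. \<tau> * \<bar>G (v x)\<bar> \<le> 1" "\<And>x. \<tau> * G' (v x) \<le> 1" using B by (auto simp: \<tau>_def)
  \<comment> \<open>The weight that the perturbed gradient gives to the translated one; it lies
    between 0 and 1 and is the same in every direction.\<close>
  define \<sigma> where "\<sigma> x = \<tau> * (\<eta> x * G' (v x))" for x
  have \<sigma>: "0 \<le> \<sigma> x" "\<sigma> x \<le> 1" for x
  proof -
    show "0 \<le> \<sigma> x" using \<tau> \<eta>01 G'0 by (simp add: \<sigma>_def)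
    have "\<sigma> x = \<eta> x * (\<tau> * G' (v x))" by (simp add: \<sigma>_def)
    also have "\<dots> \<le> 1 * 1" using \<eta>01 \<tau>(3) \<tau>(1) G'0 by (intro mult_mono) auto
    finally show "\<sigma> x \<le> 1" by simp
  qed
  define c where "c j x = \<tau> * (G (v x) * grad \<eta> x $ j)" for j x
  have cL: "\<bar>c j x\<bar> \<le> L" for j x
  proof -
    have "\<bar>c j x\<bar> = (\<tau> * \<bar>G (v x)\<bar>) * \<bar>grad \<eta> x $ j\<bar>" using \<tau>(1) by (simp add: c_def abs_mult)
    also have "\<dots> \<le> 1 * L" using \<tau> L by (intro mult_mono) auto
    finally show ?thesis by simp
  qed
  define \<phi> where "\<phi> x = \<tau> * (\<eta> x * G (v x))" for x
  define \<psi> where "\<psi> j x = \<sigma> x * (sh j x - p j x) + c j x" for j x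
  have [measurable]: "\<sigma> \<in> borel_measurable borel" "\<And>j. c j \<in> borel_measurable borel" "\<phi> \<in> borel_measurable borel"
    unfolding \<sigma>_def c_def \<phi>_def by measurable
  have [measurable]: "\<psi> j \<in> borel_measurable borel" for j unfolding \<psi>_def by measurable
  have \<psi>0: "\<psi> j x = 0" "\<phi> x = 0" if "x \<notin> K" for x j
    using \<eta>0[OF that] g\<eta>0[OF that] by (auto simp: \<psi>_def \<phi>_def \<sigma>_def c_def)
  have shi: "integrable lborel (sh j)" for j
    unfolding sh_def using p_int by (subst integrable_lborel_shift) auto
  have Ki: "integrable lborel (indicator K :: _ \<Rightarrow> real)" by (rule integrable_indicator_compact[OF K(1)])
  have ci: "integrable lborel (c j)" for j
    by (rule integrable_compact_support[OF _ K(1) cL]) (use g\<eta>0 in \<open>auto simp: c_def\<close>)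
  have \<psi>i: "integrable lborel (\<psi> j)" for j
  proof -
    have "integrable lborel (\<lambda>x. \<sigma> x * (sh j x - p j x))"
    proof (rule Bochner_Integration.integrable_bound)
      show "integrable lborel (\<lambda>x. sh j x - p j x)" using shi p_int by simp
      show "AE x in lborel. norm (\<sigma> x * (sh j x - p j x)) \<le> norm (sh j x - p j x)"
      proof (rule AE_I2)
        fix x
        show "norm (\<sigma> x * (sh j x - p j x)) \<le> norm (sh j x - p j x)"
          using \<sigma>[of x] by (simp add: abs_mult mult_left_le_one_le)
      qed
    qed simp
    then show ?thesis unfolding \<psi>_def using ci by simp
  qed
  have \<phi>B: "\<bar>\<phi> x\<bar> \<le> 1" for x
  proof -
    have "\<bar>\<phi> x\<bar> = \<eta> x * (\<tau> * \<bar>G (v x)\<bar>)" using \<tau>(1) \<eta>01 by (simp add: \<phi>_def abs_mult)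
    also have "\<dots> \<le> 1 * 1" using \<eta>01 \<tau> by (intro mult_mono) auto
    finally show ?thesis by simp
  qed
  \<comment> \<open>An arbitrary \<open>U\<close> is allowed because the second variation is tested
    by shifting the test function, whose support may then leave \<open>\<Omega>\<close>.\<close>
  have weak: "(LBINT x. \<phi> x * grad \<Theta> x $ j) = - (LBINT x. \<psi> j x * \<Theta> x)" if \<Theta>: "\<Theta> \<in> test_functions U" for \<Theta> U j
  proof -
    obtain n0 where n0: "1 / real (Suc n0) < \<epsilon>" using \<epsilon>(1) nat_approx_posE by blast
    have line: "AE x in lborel. x \<in> ball z (3 * \<epsilon>) \<longrightarrow>
          v (x + (1 / real (Suc n)) *\<^sub>R axis j 1) - v x = line_int (\<lambda>x. sh j x - p j x) j (1 / real (Suc n)) x"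
      if n: "n \<ge> n0" for n
    proof -
      have "1 / real (Suc n) \<le> 1 / real (Suc n0)" using n by (intro divide_left_mono) auto
      then show ?thesis
        unfolding v_def sh_def using n0 by (intro translated_line[OF \<epsilon> h]) auto
    qed
    have "(LBINT x. \<eta> x * G (v x) * grad \<Theta> x $ j)
       = - (LBINT x. (\<eta> x * G' (v x) * (sh j x - p j x) + G (v x) * grad \<eta> x $ j) * \<Theta> x)"
      by (rule cutoff_chain_rule[OF v vM _ line G G'c \<eta>T \<Theta>]) (use shi p_int in auto)
    then have "\<tau> * (LBINT x. \<eta> x * G (v x) * grad \<Theta> x $ j)
       = - (\<tau> * (LBINT x. (\<eta> x * G' (v x) * (sh j x - p j x) + G (v x) * grad \<eta> x $ j) * \<Theta> x))" by simp
    moreover have "\<tau> * (LBINT x. \<eta> x * G (v x) * grad \<Theta> x $ j) = (LBINT x. \<phi> x * grad \<Theta> x $ j)"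
      by (subst integral_mult_right_zero[symmetric]) (simp add: \<phi>_def mult.assoc)
    moreover have "\<tau> * (LBINT x. (\<eta> x * G' (v x) * (sh j x - p j x) + G (v x) * grad \<eta> x $ j) * \<Theta> x) = (LBINT x. \<psi> j x * \<Theta> x)"
      by (subst integral_mult_right_zero[symmetric]) (simp add: \<psi>_def \<sigma>_def c_def algebra_simps)
    ultimately show ?thesis by simp
  qed
  have "\<exists>C\<ge>0. \<forall>t s. \<bar>s\<bar> \<le> L \<longrightarrow> f j (t + s) \<le> C * (1 + f j t)" for j
    by (rule power_growth_shift[OF f_C1 f_growth q(1,2)])
  then obtain C2 where C2: "\<And>j. C2 j \<ge> 0" "\<And>j t s. \<bar>s\<bar> \<le> L \<Longrightarrow> f j (t + s) \<le> C2 j * (1 + f j t)"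
    by metis
  define R where "R x = (\<Sum>j\<in>UNIV. indicator K x * (C2 j * (2 + f j (p j x) + f j (sh j x))))" for x
  have [measurable]: "R \<in> borel_measurable borel" unfolding R_def by measurable
  have fi1: "integrable lborel (\<lambda>x. indicator K x * f j (p j x))" for j
    using K(2) by (intro f_integrable_subset) auto
  have fi2: "integrable lborel (\<lambda>x. indicator K x * f j (sh j x))" for j
  proof -
    have eq: "(\<lambda>x. indicator K x * f j (sh j x)) = (\<lambda>x. (\<lambda>y. indicator ((\<lambda>x. x + ?h) ` K) y * f j (p j y)) (x + ?h))"
    proof
      fix x
      have "x + ?h \<in> (\<lambda>x. x + ?h) ` K \<longleftrightarrow> x \<in> K" by (auto simp: image_iff)
      then show "indicator K x * f j (sh j x) = (\<lambda>y. indicator ((\<lambda>x. x + ?h) ` K) y * f j (p j y)) (x + ?h)"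
        by (simp add: sh_def indicator_def)
    qed
    have Kb: "(\<lambda>x. x + ?h) ` K \<in> sets borel"
      using compact_translation[OF K(1), of ?h] by (auto simp: add.commute intro: borel_compact)
    have i: "integrable lborel (\<lambda>y. indicator ((\<lambda>x. x + ?h) ` K) y * f j (p j y))"
      using Kh Kb by (intro f_integrable_subset) auto
    then have "(\<lambda>y. indicator ((\<lambda>x. x + ?h) ` K) y * f j (p j y)) \<in> borel_measurable borel"
      using borel_measurable_integrable by force
    from integrable_lborel_shift[OF this, of ?h] i show ?thesis unfolding eq by blast
  qed
  have Ri: "integrable lborel R"
    unfolding R_def
  proof (rule Bochner_Integration.integrable_sum)
    fix j
    have "integrable lborel (\<lambda>x. C2 j * (2 * indicator K x + indicator K x * f j (p j x) + indicator K x * f j (sh j x)))"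
      using Ki fi1 fi2 by simp
    then show "integrable lborel (\<lambda>x. indicator K x * (C2 j * (2 + f j (p j x) + f j (sh j x))))"
      by (simp add: algebra_simps)
  qed
  have R0: "R x \<ge> 0" for x unfolding R_def using C2 f_nonneg by (intro sum_nonneg mult_nonneg_nonneg) auto
  \<comment> \<open>Convexity is applied between the two shifted values, so \<open>C2\<close> pays
    for the bounded shift \<open>d\<close> at each of them.\<close>
  have conv: "f j ((1 - s) * a + s * b + d) \<le> C2 j * (2 + f j a + f j b)" if "0 \<le> s" "s \<le> 1" "\<bar>d\<bar> \<le> L" for j s a b d
  proof -
    have "(1 - s) * a + s * b + d = (1 - s) * (a + d) + s * (b + d)" by (simp add: algebra_simps)
    then have "f j ((1 - s) * a + s * b + d) \<le> (1 - s) * f j (a + d) + s * f j (b + d)"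
      using convex_C1_convex[OF f_C1[of j] that(1,2), of "a + d" "b + d"] by simp
    also have "\<dots> \<le> 1 * f j (a + d) + 1 * f j (b + d)"
      using that f_nonneg by (intro add_mono mult_right_mono) auto
    also have "\<dots> \<le> C2 j * (1 + f j a) + C2 j * (1 + f j b)"
      using C2(2)[OF that(3), of j a] C2(2)[OF that(3), of j b] by simp
    finally show ?thesis by (simp add: algebra_simps)
  qed
  have adm1: "admissible_variation \<Omega> \<phi> \<psi>"
    unfolding admissible_variation_def weak_pd_def using \<psi>i weak \<phi>B \<psi>0 K by auto
  have I0: "integrable lborel (\<lambda>x. indicator \<Omega> x * (\<Sum>j\<in>UNIV. f j (p j x)))"
    using energy_finite split_energy_integrable[of p] by simp
  \<comment> \<open>A criterion for both variations: at each point either nothing changes or the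
    perturbed density is below an integrable \<open>S\<close>.\<close>
  have fin: "split_energy \<Omega> f (\<lambda>j x. p j x + \<xi> j x) < \<infinity>"
    if [measurable]: "\<And>j. \<xi> j \<in> borel_measurable borel" and S: "integrable lborel S" "\<And>x. S x \<ge> 0"
      and le: "\<And>x. (\<forall>j. \<xi> j x = 0) \<or> (\<Sum>j\<in>UNIV. f j (p j x + \<xi> j x)) \<le> S x" for \<xi> S
  proof -
    have "integrable lborel (\<lambda>x. indicator \<Omega> x * (\<Sum>j\<in>UNIV. f j (p j x + \<xi> j x)))"
    proof (rule Bochner_Integration.integrable_bound)
      show "integrable lborel (\<lambda>x. indicator \<Omega> x * (\<Sum>j\<in>UNIV. f j (p j x)) + S x)" using I0 S by simp
      show "AE x in lborel. norm (indicator \<Omega> x * (\<Sum>j\<in>UNIV. f j (p j x + \<xi> j x)))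
         \<le> norm (indicator \<Omega> x * (\<Sum>j\<in>UNIV. f j (p j x)) + S x)"
      proof (rule AE_I2)
        fix x
        have "0 \<le> (\<Sum>j\<in>UNIV. f j (p j x + \<xi> j x))" "0 \<le> (\<Sum>j\<in>UNIV. f j (p j x))"
          using f_nonneg by (auto intro: sum_nonneg)
        then show "norm (indicator \<Omega> x * (\<Sum>j\<in>UNIV. f j (p j x + \<xi> j x)))
         \<le> norm (indicator \<Omega> x * (\<Sum>j\<in>UNIV. f j (p j x)) + S x)"
          using le[of x] S(2)[of x] by (auto simp: indicator_def)
      qed
    qed measurable
    then show ?thesis using split_energy_integrable[of "\<lambda>j x. p j x + \<xi> j x"] by simp
  qed
  have fin1: "split_energy \<Omega> f (\<lambda>j x. p j x + \<psi> j x) < \<infinity>"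
  proof (rule fin[OF _ Ri R0])
    fix x
    show "(\<forall>j. \<psi> j x = 0) \<or> (\<Sum>j\<in>UNIV. f j (p j x + \<psi> j x)) \<le> R x"
    proof (cases "x \<in> K")
      case True
      have "f j (p j x + \<psi> j x) \<le> C2 j * (2 + f j (p j x) + f j (sh j x))" for j
        using conv[OF \<sigma> cL, of j x "p j x" "sh j x" j x] by (simp add: \<psi>_def algebra_simps)
      then show ?thesis using True by (auto simp: R_def intro!: sum_mono)
    qed (use \<psi>0 in auto)
  qed simp
  \<comment> \<open>The second variation is the first one moved by h e_i with opposite sign; by
    \<open>Kh\<close> its support still lies in \<open>\<Omega>\<close>.\<close>
  define \<phi>2 where "\<phi>2 x = - \<phi> (x - ?h)" for x
  define \<psi>2 where "\<psi>2 j x = - \<psi> j (x - ?h)" for j x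
  have [measurable]: "\<phi>2 \<in> borel_measurable borel" "\<And>j. \<psi>2 j \<in> borel_measurable borel"
    unfolding \<phi>2_def \<psi>2_def by measurable
  have adm2: "admissible_variation \<Omega> \<phi>2 \<psi>2"
    unfolding admissible_variation_def weak_pd_def
  proof (intro conjI allI ballI)
    show "\<exists>B. \<forall>x. \<bar>\<phi>2 x\<bar> \<le> B" using \<phi>B by (auto simp: \<phi>2_def)
    show "integrable lborel (\<psi>2 j)" for j
      unfolding \<psi>2_def using \<psi>i integrable_lborel_shift[of "\<psi> j" "- ?h"] by simp
    show "(LBINT x. \<phi>2 x * grad \<Theta> x $ j) = - (LBINT x. \<psi>2 j x * \<Theta> x)" if \<Theta>: "\<Theta> \<in> test_functions \<Omega>" for \<Theta> j
    proof -
      have [measurable]: "\<Theta> \<in> borel_measurable borel" "(\<lambda>x. grad \<Theta> x $ j) \<in> borel_measurable borel"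
        by (rule test_function_borel[OF \<Theta>] test_function_grad_borel[OF \<Theta>])+
      have T: "(\<lambda>x. \<Theta> (x - (- ?h))) \<in> test_functions UNIV"
        by (rule test_function_shift[OF \<Theta>]) simp
      have "(LBINT x. \<phi>2 x * grad \<Theta> x $ j) = - (LBINT x. \<phi> (x - ?h) * grad \<Theta> x $ j)"
        by (simp add: \<phi>2_def)
      also have "(LBINT x. \<phi> (x - ?h) * grad \<Theta> x $ j) = (LBINT x. \<phi> x * grad \<Theta> (x + ?h) $ j)"
        using integral_lborel_shift[of "\<lambda>x. \<phi> (x - ?h) * grad \<Theta> x $ j" ?h] by simp
      also have "\<dots> = (LBINT x. \<phi> x * grad (\<lambda>x. \<Theta> (x - (- ?h))) x $ j)"
        by (subst grad_shift[OF test_function_differentiable[OF \<Theta>]]) simp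
      also have "\<dots> = - (LBINT x. \<psi> j x * \<Theta> (x - (- ?h)))" by (rule weak[OF T])
      also have "(LBINT x. \<psi> j x * \<Theta> (x - (- ?h))) = (LBINT x. \<psi> j (x - ?h) * \<Theta> x)"
        using integral_lborel_shift[of "\<lambda>x. \<psi> j (x - ?h) * \<Theta> x" ?h] by simp
      finally show ?thesis by (simp add: \<psi>2_def)
    qed
    show "\<exists>K. compact K \<and> K \<subseteq> \<Omega> \<and> (\<forall>x. x \<notin> K \<longrightarrow> \<phi>2 x = 0 \<and> (\<forall>j. \<psi>2 j x = 0))"
    proof (intro exI[of _ "(+) ?h ` K"] conjI allI impI)
      show "compact ((+) ?h ` K)" by (rule compact_translation[OF K(1)])
      show "(+) ?h ` K \<subseteq> \<Omega>" using Kh by (auto simp: add.commute)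
      fix x assume x: "x \<notin> (+) ?h ` K"
      have "x - ?h \<notin> K"
      proof
        assume "x - ?h \<in> K"
        then have "?h + (x - ?h) \<in> (+) ?h ` K" by blast
        then show False using x by simp
      qed
      then show "\<phi>2 x = 0" "\<psi>2 j x = 0" for j using \<psi>0 by (auto simp: \<phi>2_def \<psi>2_def)
    qed
  qed simp
  have fin2: "split_energy \<Omega> f (\<lambda>j x. p j x + \<psi>2 j x) < \<infinity>"
  proof (rule fin[where S="\<lambda>x. R (x - ?h)"])
    show "integrable lborel (\<lambda>x. R (x - ?h))" using Ri integrable_lborel_shift[of R "- ?h"] by simp
    fix x
    show "R (x - ?h) \<ge> 0" by (rule R0)
    define y where "y = x - ?h"
    have xy: "p j x = sh j y" for j by (simp add: y_def sh_def)
    show "(\<forall>j. \<psi>2 j x = 0) \<or> (\<Sum>j\<in>UNIV. f j (p j x + \<psi>2 j x)) \<le> R (x - ?h)"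
    proof (cases "y \<in> K")
      case True
      have "f j (p j x + \<psi>2 j x) \<le> C2 j * (2 + f j (p j y) + f j (sh j y))" for j
      proof -
        \<comment> \<open>At the translated point the roles are exchanged: the same two gradients
          are combined with the weights interchanged.\<close>
        have eq: "p j x + \<psi>2 j x = (1 - \<sigma> y) * sh j y + \<sigma> y * p j y + (- c j y)"
          by (simp add: xy \<psi>2_def \<psi>_def algebra_simps flip: y_def)
        have "f j (p j x + \<psi>2 j x) \<le> C2 j * (2 + f j (sh j y) + f j (p j y))"
          unfolding eq by (rule conv[OF \<sigma>]) (use cL in simp)
        then show ?thesis by (simp add: ac_simps)
      qed
      then show ?thesis using True unfolding y_def[symmetric] by (auto simp: R_def intro!: sum_mono)
    qed (use \<psi>0 in \<open>auto simp: \<psi>2_def y_def\<close>)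
  qed simp
  note E1 = euler_inequality[OF adm1 fin1] and E2 = euler_inequality[OF adm2 fin2]
  have e2: "(\<lambda>x. \<Sum>j\<in>UNIV. f' j (sh j x) * \<psi> j x) = (\<lambda>x. - (\<lambda>y. \<Sum>j\<in>UNIV. f' j (p j y) * \<psi>2 j y) (x + ?h))"
    by (simp add: sh_def \<psi>2_def sum_negf)
  have E2': "integrable lborel (\<lambda>x. \<Sum>j\<in>UNIV. f' j (sh j x) * \<psi> j x)"
  proof -
    have mE: "(\<lambda>y. \<Sum>j\<in>UNIV. f' j (p j y) * \<psi>2 j y) \<in> borel_measurable borel" by measurable
    have "integrable lborel (\<lambda>x. (\<lambda>y. \<Sum>j\<in>UNIV. f' j (p j y) * \<psi>2 j y) (x + ?h))"
      using E2(1) integrable_lborel_shift[OF mE, of ?h] by blast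
    then show ?thesis unfolding e2 by (rule Bochner_Integration.integrable_minus)
  qed
  have E2'': "(LBINT x. (\<Sum>j\<in>UNIV. f' j (sh j x) * \<psi> j x)) \<le> 0"
  proof -
    have "(LBINT x. (\<Sum>j\<in>UNIV. f' j (sh j x) * \<psi> j x)) = - (LBINT x. (\<lambda>y. \<Sum>j\<in>UNIV. f' j (p j y) * \<psi>2 j y) (x + ?h))"
      unfolding e2 by simp
    also have "(LBINT x. (\<lambda>y. \<Sum>j\<in>UNIV. f' j (p j y) * \<psi>2 j y) (x + ?h)) = (LBINT y. (\<Sum>j\<in>UNIV. f' j (p j y) * \<psi>2 j y))"
      by (rule integral_lborel_shift) measurable
    finally show ?thesis using E2(2) by simp
  qed
  define D where "D j x = (f' j (sh j x) - f' j (p j x)) * (sh j x - p j x)" for j x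
  define main where "main x = \<eta> x * G' (v x) * (\<Sum>j\<in>UNIV. D j x)" for x
  define err where "err x = (\<Sum>j\<in>UNIV. (f' j (sh j x) - f' j (p j x)) * (G (v x) * grad \<eta> x $ j))" for x
  define Rr where "Rr x = \<bar>G (v x)\<bar> * (\<Sum>j\<in>UNIV. \<bar>grad \<eta> x $ j\<bar> * (\<bar>f' j (sh j x)\<bar> + \<bar>f' j (p j x)\<bar>))" for x
  have [measurable]: "\<And>j. D j \<in> borel_measurable borel" unfolding D_def by measurable
  have [measurable]: "main \<in> borel_measurable borel" "err \<in> borel_measurable borel" "Rr \<in> borel_measurable borel"
    unfolding main_def err_def Rr_def by measurable
  have D0: "D j x \<ge> 0" for j x unfolding D_def by (rule f'_mono)
  have main0: "main x \<ge> 0" for x unfolding main_def using \<eta>01 G'0 D0 by (intro mult_nonneg_nonneg sum_nonneg) auto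
  \<comment> \<open>The two tested expressions differ by a monotone main term and an error that
    carries the gradient of the cutoff.\<close>
  have split: "(\<Sum>j\<in>UNIV. f' j (sh j x) * \<psi> j x) - (\<Sum>j\<in>UNIV. f' j (p j x) * \<psi> j x) = \<tau> * (main x + err x)" for x
  proof -
    have "(\<Sum>j\<in>UNIV. f' j (sh j x) * \<psi> j x) - (\<Sum>j\<in>UNIV. f' j (p j x) * \<psi> j x)
      = (\<Sum>j\<in>UNIV. \<tau> * (\<eta> x * G' (v x) * D j x + (f' j (sh j x) - f' j (p j x)) * (G (v x) * grad \<eta> x $ j)))"
      unfolding sum_subtractf[symmetric]
      by (rule sum.cong) (auto simp: \<psi>_def \<sigma>_def c_def D_def algebra_simps)
    also have "\<dots> = \<tau> * (main x + err x)"
      unfolding main_def err_def sum_distrib_left sum.distrib[symmetric] by (rule refl)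
    finally show ?thesis .
  qed
  have err_le: "\<bar>err x\<bar> \<le> Rr x" for x
  proof -
    have "\<bar>err x\<bar> \<le> (\<Sum>j\<in>UNIV. \<bar>(f' j (sh j x) - f' j (p j x)) * (G (v x) * grad \<eta> x $ j)\<bar>)"
      unfolding err_def by (rule sum_abs)
    also have "\<dots> \<le> (\<Sum>j\<in>UNIV. \<bar>G (v x)\<bar> * (\<bar>grad \<eta> x $ j\<bar> * (\<bar>f' j (sh j x)\<bar> + \<bar>f' j (p j x)\<bar>)))"
    proof (rule sum_mono)
      fix j
      have "\<bar>f' j (sh j x) - f' j (p j x)\<bar> * (\<bar>G (v x)\<bar> * \<bar>grad \<eta> x $ j\<bar>) \<le> (\<bar>f' j (sh j x)\<bar> + \<bar>f' j (p j x)\<bar>) * (\<bar>G (v x)\<bar> * \<bar>grad \<eta> x $ j\<bar>)"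
        by (intro mult_right_mono) auto
      then show "\<bar>(f' j (sh j x) - f' j (p j x)) * (G (v x) * grad \<eta> x $ j)\<bar> \<le> \<bar>G (v x)\<bar> * (\<bar>grad \<eta> x $ j\<bar> * (\<bar>f' j (sh j x)\<bar> + \<bar>f' j (p j x)\<bar>))"
        by (simp add: abs_mult mult.commute mult.left_commute)
    qed
    finally show ?thesis by (simp add: Rr_def sum_distrib_left)
  qed
  have "\<exists>C\<ge>0. \<forall>t. \<bar>f' j t\<bar> \<le> C * (1 + f j t) powr (1 - 1 / Q)" for j
    by (rule convex_C1_deriv_le[OF f_C1 f_growth]) (use q in auto)
  then obtain C3 where C3: "\<And>j. C3 j \<ge> 0" "\<And>j t. \<bar>f' j t\<bar> \<le> C3 j * (1 + f j t) powr (1 - 1 / Q)"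
    by metis
  have C3': "\<bar>f' j t\<bar> \<le> C3 j * (1 + f j t)" for j t
  proof -
    have "Q > 0" using q(1,3)[of j] by linarith
    then have "(1 + f j t) powr (1 - 1 / Q) \<le> (1 + f j t) powr 1" using f_nonneg[of j t] by (intro powr_mono) auto
    then have "C3 j * (1 + f j t) powr (1 - 1 / Q) \<le> C3 j * (1 + f j t)" using C3(1)[of j] f_nonneg[of j t] by (intro mult_left_mono) auto
    then show ?thesis using C3(2)[of j t] by linarith
  qed
  \<comment> \<open>For fixed \<open>h\<close> it is enough to bound f_j' by a multiple of 1 + f_j;
    the smaller power \<open>1 - 1 / Q\<close> is exploited in the estimate that is uniform in
    \<open>h\<close>.\<close>
  have Rri: "integrable lborel Rr"
  proof (rule Bochner_Integration.integrable_bound)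
    show "integrable lborel (\<lambda>x. B * (\<Sum>j\<in>UNIV. L * (C3 j * (2 * indicator K x + indicator K x * f j (p j x) + indicator K x * f j (sh j x)))))"
      using Ki fi1 fi2 by (intro integrable_mult_right Bochner_Integration.integrable_sum Bochner_Integration.integrable_add) auto
    show "AE x in lborel. norm (Rr x) \<le> norm (B * (\<Sum>j\<in>UNIV. L * (C3 j * (2 * indicator K x + indicator K x * f j (p j x) + indicator K x * f j (sh j x)))))"
    proof (rule AE_I2)
      fix x
      have Rr0: "0 \<le> Rr x" unfolding Rr_def by (intro mult_nonneg_nonneg sum_nonneg) auto
      have tj: "\<bar>grad \<eta> x $ j\<bar> * (\<bar>f' j (sh j x)\<bar> + \<bar>f' j (p j x)\<bar>)
          \<le> L * (C3 j * (2 * indicator K x + indicator K x * f j (p j x) + indicator K x * f j (sh j x)))" for j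
      proof (cases "x \<in> K")
        case True
        have "\<bar>f' j (sh j x)\<bar> + \<bar>f' j (p j x)\<bar> \<le> C3 j * (2 + f j (p j x) + f j (sh j x))"
          using C3'[of j "sh j x"] C3'[of j "p j x"] by (simp add: algebra_simps)
        then show ?thesis using True L by (simp, intro mult_mono) auto
      qed (use g\<eta>0 in simp)
      have "Rr x \<le> B * (\<Sum>j\<in>UNIV. L * (C3 j * (2 * indicator K x + indicator K x * f j (p j x) + indicator K x * f j (sh j x))))"
        unfolding Rr_def by (rule mult_mono[OF B(2) sum_mono[OF tj]]) (use B in \<open>auto intro!: sum_nonneg\<close>)
      then show "norm (Rr x) \<le> norm (B * (\<Sum>j\<in>UNIV. L * (C3 j * (2 * indicator K x + indicator K x * f j (p j x) + indicator K x * f j (sh j x)))))"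
        using Rr0 by simp
    qed
  qed simp
  have erri: "integrable lborel err"
    by (rule Bochner_Integration.integrable_bound[OF Rri]) (use err_le in \<open>auto intro!: AE_I2 intro: order_trans[OF _ abs_ge_self]\<close>)
  have si: "integrable lborel (\<lambda>x. \<tau> * (main x + err x))"
    using Bochner_Integration.integrable_diff[OF E2' E1(1)] by (simp add: split)
  then have mei: "integrable lborel (\<lambda>x. main x + err x)" using \<tau>(1) by simp
  then have maini: "integrable lborel main" using Bochner_Integration.integrable_diff[OF mei erri] by simp
  have "(LBINT x. \<tau> * (main x + err x)) \<le> 0"
    using E1(2) E2'' E2' E1(1) unfolding split[symmetric] by simp
  then have "(LBINT x. main x) + (LBINT x. err x) \<le> 0"
    using maini erri \<tau>(1) by (simp add: mult_le_0_iff)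
  moreover have "- (LBINT x. err x) \<le> (LBINT x. Rr x)"
  proof -
    have "(LBINT x. - err x) \<le> (LBINT x. Rr x)"
    proof (rule Bochner_Integration.integral_mono)
      show "- err x \<le> Rr x" for x using err_le[of x] by linarith
    qed (use erri Rri in auto)
    then show ?thesis by simp
  qed
  ultimately have "(LBINT x. main x) \<le> (LBINT x. Rr x)" by linarith
  then have le: "(\<integral>\<^sup>+x. ennreal (main x) \<partial>lborel) \<le> (\<integral>\<^sup>+x. ennreal (Rr x) \<partial>lborel)"
    using maini Rri main0 order_trans[OF abs_ge_zero err_le]
    by (simp add: nn_integral_eq_integral ennreal_leI)
  have "(\<integral>\<^sup>+x. ennreal (\<eta> x * G' (v x) * D i x) \<partial>lborel) \<le> (\<integral>\<^sup>+x. ennreal (main x) \<partial>lborel)"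
  proof (intro nn_integral_mono ennreal_leI)
    fix x
    \<comment> \<open>All directions contribute nonnegatively to the main term, so the direction of
      the translation alone may be kept.\<close>
    have "D i x \<le> (\<Sum>j\<in>UNIV. D j x)" by (rule member_le_sum) (use D0 in auto)
    then show "\<eta> x * G' (v x) * D i x \<le> main x"
      unfolding main_def using \<eta>01 G'0 by (intro mult_left_mono) auto
  qed
  also note le
  finally show ?thesis unfolding D_def Rr_def .
qed

end

section \<open>Gain of integrability\<close>

text \<open>Lower bounds are computed with real integrals, but the integrand \<open>F\<close> they
  are meant for may have infinite integral.\<close>

lemma nn_integral_ge_integral:
  fixes g :: "'a \<Rightarrow> real" and F :: "'a \<Rightarrow> real"
  assumes g: "integrable M g" and le: "AE x in M. g x \<le> F x"
  shows "ennreal (\<integral>x. g x \<partial>M) \<le> (\<integral>\<^sup>+x. ennreal (F x) \<partial>M)"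
proof -
  have "(\<integral>x. g x \<partial>M) \<le> (\<integral>x. max 0 (g x) \<partial>M)"
    using g by (intro Bochner_Integration.integral_mono) auto
  then have "ennreal (\<integral>x. g x \<partial>M) \<le> ennreal (\<integral>x. max 0 (g x) \<partial>M)" by (rule ennreal_leI)
  also have "\<dots> = (\<integral>\<^sup>+x. ennreal (max 0 (g x)) \<partial>M)"
    using g by (intro nn_integral_eq_integral[symmetric]) auto
  also have "\<dots> \<le> (\<integral>\<^sup>+x. ennreal (F x) \<partial>M)"
    using le by (intro nn_integral_mono_AE) (auto elim!: eventually_mono simp: max_def ennreal_neg intro: ennreal_leI)
  finally show ?thesis .
qed

lemma indefinite_integral_continuous:
  fixes P :: "real \<Rightarrow> real"
  assumes P: "integrable lborel (\<lambda>r. indicator {0..h0} r * P r)"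
  shows "continuous_on {0..h0} (\<lambda>s. \<integral>r. indicator {0..s} r * P r \<partial>lborel)"
proof -
  have si: "set_integrable lborel {0..s} P" if "s \<le> h0" for s
  proof -
    have "integrable lborel (\<lambda>r. indicator {0..s} r * (indicator {0..h0} r * P r))"
      by (rule integrable_mult_indicator[where 'b=real, simplified]) (use P in auto)
    moreover have "(\<lambda>r. indicator {0..s} r * (indicator {0..h0} r * P r)) = (\<lambda>r. indicator {0..s} r * P r)"
      using that by (auto simp: indicator_def)
    ultimately show ?thesis by (simp add: set_integrable_def)
  qed
  have eq: "(LBINT r. indicator {0..s} r * P r) = integral {0..s} P" if "s \<in> {0..h0}" for s
    using set_borel_integral_eq_integral(2)[OF si[of s]] that by (simp add: set_lebesgue_integral_def)
  have "P integrable_on {0..h0}" using set_borel_integral_eq_integral(1)[OF si[of h0]] by simp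
  then have "continuous_on {0..h0} (\<lambda>s. integral {0..s} P)" by (rule indefinite_integral_continuous_1)
  then show ?thesis using eq by (subst continuous_on_cong[OF refl]) auto
qed

text \<open>The interval of scales is cut off at the first scale \<open>h2\<close> at which the average of \<open>P\<close> has dropped to
  \<open>A / (2 K)\<close>: up to \<open>h2\<close> the average stays large, yet \<open>P\<close> itself must on average lie well below \<open>A\<close>.\<close>

lemma scale_selection:
  fixes P D :: "real \<Rightarrow> real"
  assumes P: "integrable lborel (\<lambda>r. indicator {0..h0} r * P r)"
  defines "V \<equiv> \<lambda>s. \<integral>r. indicator {0..s} r * P r \<partial>lborel"
  assumes V: "V h0 \<le> 2 * M" and h1: "0 < h1" "h1 < h0" "A / 2 * h1 \<le> V h1"
    and A: "A > 0" and K: "K \<ge> 2" and h0: "4 * K * M \<le> A * h0" and \<gamma>: "\<gamma> \<ge> 0" and c: "c \<ge> 0"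
    and D: "\<And>r. D r \<ge> 0" "\<And>r. c * (A / K - P r) \<le> D r"
  shows "ennreal (c * (A / (2 * K)) powr (\<gamma> + 1))
     \<le> (\<integral>\<^sup>+r. ennreal (indicator {0<..<h0} r * (r powr (- \<gamma> - 1) * (max (V r) 0 powr \<gamma> * D r))) \<partial>lborel)"
proof -
  \<comment> \<open>The threshold for the average \<open>V s / s\<close>: half of
    \<open>A / K\<close>, and at most \<open>A / 4\<close> because \<open>K \<ge> 2\<close>.\<close>
  define a where "a = A / (2 * K)"
  have a: "a > 0" using A K by (simp add: a_def)
  have Vc: "continuous_on {0..h0} V" unfolding V_def by (rule indefinite_integral_continuous[OF P])
  \<comment> \<open>The scales with small average. Continuity of \<open>V\<close> makes the set
    closed, and it contains \<open>h0\<close> because the total increment, at most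
    \<open>2 * M\<close>, does not exceed \<open>a * h0\<close>.\<close>
  define S where "S = {s \<in> {h1..h0}. V s \<le> a * s}"
  have "closed S"
    unfolding S_def using h1 by (intro continuous_on_closed_Collect_le continuous_on_subset[OF Vc] continuous_intros) auto
  moreover have "h0 \<in> S"
  proof -
    have "2 * M \<le> a * h0" using h0 K A by (simp add: a_def field_simps)
    then show ?thesis using V h1 by (simp add: S_def)
  qed
  moreover have bb: "bdd_below S" by (auto simp: S_def intro!: bdd_belowI[of _ h1])
  ultimately have h2S: "Inf S \<in> S" by (intro closed_contains_Inf) auto
  define h2 where "h2 = Inf S"
  have h2: "h2 \<in> S" using h2S by (simp add: h2_def)
  have Kl: "a * 2 \<le> A / 2" "A / K = 2 * a" using A K by (auto simp: a_def field_simps)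
  have "h1 \<notin> S"
  proof
    assume "h1 \<in> S"
    then have "V h1 \<le> a * h1" by (simp add: S_def)
    then have "A / 2 * h1 \<le> a * h1" using h1(3) by linarith
    then show False using h1(1) Kl a by (simp add: mult_le_cancel_right)
  qed
  then have h12: "h1 < h2" "h2 \<le> h0" using h2 by (auto simp: S_def less_le)
  have low: "a * r < V r" if "h1 < r" "r < h2" for r
  proof (rule ccontr)
    assume "\<not> a * r < V r"
    then have "r \<in> S" using that h12 by (simp add: S_def)
    then have "h2 \<le> r" unfolding h2_def using bb by (rule cInf_lower)
    then show False using that by simp
  qed
  \<comment> \<open>Between \<open>h1\<close> and \<open>h2\<close> the weight equals (1 / r) (V r /
    r)^\<gamma>, which is at least \<open>1 / h2 * a powr \<gamma>\<close>; the factor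
    \<open>c\<close> comes from the lower bound for \<open>D\<close>.\<close>
  define k where "k = 1 / h2 * a powr \<gamma> * c"
  have h2p: "h2 > 0" using h1 h12 by linarith
  have k: "k \<ge> 0" using h2p c by (simp add: k_def)
  have iP: "integrable lborel (\<lambda>r. indicator {0..s} r * P r)" if "s \<le> h0" for s
  proof -
    have "integrable lborel (\<lambda>r. indicator {0..s} r * (indicator {0..h0} r * P r))"
      by (rule integrable_mult_indicator[where 'b=real, simplified]) (use P in auto)
    moreover have "(\<lambda>r. indicator {0..s} r * (indicator {0..h0} r * P r)) = (\<lambda>r. indicator {0..s} r * P r)"
      using that by (auto simp: indicator_def)
    ultimately show ?thesis by simp
  qed
  define g where "g r = k * (indicator {h1<..h2} r * (A / K) - (indicator {0..h2} r * P r - indicator {0..h1} r * P r))" for r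
  have ii: "integrable lborel (indicator {h1<..h2} :: real \<Rightarrow> real)"
    by (intro integrable_real_indicator) (use h12 in auto)
  have gi: "integrable lborel g"
    unfolding g_def using iP[of h1] iP[of h2] ii h12
    by (intro integrable_mult_right Bochner_Integration.integrable_diff integrable_mult_left) auto
  have "(LBINT r. g r) = k * ((h2 - h1) * (A / K) - (V h2 - V h1))"
    unfolding g_def V_def using iP[of h1] iP[of h2] ii h12 by simp
  \<comment> \<open>The deficit of \<open>P\<close> below \<open>A / K = 2 * a\<close>: over the
    interval \<open>V\<close> increases by at most \<open>a * h2 - 2 * a * h1\<close>, and
    comparison with \<open>2 * a * (h2 - h1)\<close> leaves \<open>a * h2\<close>. The factor
    \<open>1 / h2\<close> in \<open>k\<close> then cancels the unknown scale.\<close>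
  moreover have "a * h2 \<le> (h2 - h1) * (A / K) - (V h2 - V h1)"
  proof -
    have "V h2 \<le> a * h2" using h2 by (simp add: S_def)
    moreover have "a * 2 * h1 \<le> V h1" using mult_right_mono[OF Kl(1), of h1] h1 by linarith
    ultimately show ?thesis unfolding Kl(2) by (simp add: algebra_simps)
  qed
  ultimately have "k * (a * h2) \<le> (LBINT r. g r)" using k by (simp add: mult_left_mono)
  moreover have "k * (a * h2) = c * (A / (2 * K)) powr (\<gamma> + 1)"
    using h2p a by (simp add: k_def powr_add flip: a_def)
  ultimately have "ennreal (c * (A / (2 * K)) powr (\<gamma> + 1)) \<le> ennreal (LBINT r. g r)" by (simp add: ennreal_leI)
  also have "\<dots> \<le> (\<integral>\<^sup>+r. ennreal (indicator {0<..<h0} r * (r powr (- \<gamma> - 1) * (max (V r) 0 powr \<gamma> * D r))) \<partial>lborel)"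
  proof (rule nn_integral_ge_integral[OF gi])
    have "AE r in lborel. r \<noteq> h2" by (rule AE_lborel_singleton)
    then show "AE r in lborel. g r \<le> indicator {0<..<h0} r * (r powr (- \<gamma> - 1) * (max (V r) 0 powr \<gamma> * D r))"
    proof (rule eventually_mono)
      fix r assume r2: "r \<noteq> h2"
      show "g r \<le> indicator {0<..<h0} r * (r powr (- \<gamma> - 1) * (max (V r) 0 powr \<gamma> * D r))"
      proof (cases "h1 < r \<and> r < h2")
        case True
        have rp: "r > 0" using True h1 by linarith
        have "g r = k * (A / K - P r)" using True h1 by (simp add: g_def)
        also have "\<dots> = 1 / h2 * a powr \<gamma> * (c * (A / K - P r))" by (simp add: k_def)
        also have "\<dots> \<le> 1 / h2 * a powr \<gamma> * D r" using D(2)[of r] h2p by (intro mult_left_mono) auto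
        also have "\<dots> \<le> (1 / r * (V r / r) powr \<gamma>) * D r"
        proof (intro mult_right_mono mult_mono powr_mono2)
          show "a \<le> V r / r" using low[of r] True rp by (simp add: field_simps)
        qed (use True rp h2p a \<gamma> D(1) in \<open>auto simp: frac_le\<close>)
        also have "1 / r * (V r / r) powr \<gamma> = r powr (- \<gamma> - 1) * max (V r) 0 powr \<gamma>"
        proof -
          have Vp: "V r > 0" using low[of r] True rp a by (meson less_trans mult_pos_pos)
          have "r powr (- \<gamma> - 1) = 1 / r * (1 / r powr \<gamma>)"
            using rp by (simp add: powr_diff powr_minus field_simps)
          then show ?thesis using Vp rp by (simp add: powr_divide max_def)
        qed
        finally show ?thesis using True h12 rp by (simp add: mult.assoc)
      next
        case False
        then have "g r = 0" using r2 h12 h1 by (auto simp: g_def indicator_def)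
        moreover have "0 \<le> indicator {0<..<h0} r * (r powr (- \<gamma> - 1) * (max (V r) 0 powr \<gamma> * D r))"
          using D(1)[of r] by simp
        ultimately show ?thesis by simp
      qed
    qed
  qed
  finally show ?thesis .
qed

section \<open>Power inequalities: tangents, Jensen on segments, positive parts,
  interpolation\<close>

lemma powr_tangent:
  assumes "s \<ge> 1" "X \<ge> 0" "y \<ge> (0::real)"
  shows "s * X powr (s - 1) * y - (s - 1) * X powr s \<le> y powr s"
proof (cases "X = 0 \<or> y = 0")
  case True
  then show ?thesis using assms by (cases "s = 1") (auto simp: powr_def)
next
  case False
  then have p: "X > 0" "y > 0" using assms by auto
  have "1 + s * (y / X - 1) \<le> (y / X) powr s"
  proof -
    define w where "w = y / X"
    have w: "w > 0" using p by (simp add: w_def)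
    have D: "((\<lambda>x. x powr s) has_real_derivative s * x powr (s - 1)) (at x)" if "x > 0" for x
      using that by (auto intro!: derivative_eq_intros)
    have "w powr s - 1 powr s \<ge> s * (w - 1)"
    proof (cases w "1::real" rule: linorder_cases)
      case less
      then obtain x where x: "w < x" "x < 1" "1 powr s - w powr s = (1 - w) * (s * x powr (s - 1))"
        using MVT2[OF less, of "\<lambda>x. x powr s" "\<lambda>x. s * x powr (s - 1)"] D w by force
      have "x powr (s - 1) \<le> 1 powr (s - 1)" using x w assms by (intro powr_mono2) auto
      then have "(1 - w) * (s * x powr (s - 1)) \<le> (1 - w) * (s * 1)" using less assms by (intro mult_left_mono) auto
      then show ?thesis using x by (simp add: algebra_simps)
    next
      case greater
      then obtain x where x: "1 < x" "x < w" "w powr s - 1 powr s = (w - 1) * (s * x powr (s - 1))"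
        using MVT2[OF greater, of "\<lambda>x. x powr s" "\<lambda>x. s * x powr (s - 1)"] D by force
      have "1 powr (s - 1) \<le> x powr (s - 1)" using x assms by (intro powr_mono2) auto
      then have "(w - 1) * (s * 1) \<le> (w - 1) * (s * x powr (s - 1))" using greater assms by (intro mult_left_mono) auto
      then show ?thesis using x by (simp add: algebra_simps)
    qed simp
    then show ?thesis by (simp add: w_def)
  qed
  then have "X powr s * (1 + s * (y / X - 1)) \<le> X powr s * (y / X) powr s" by (intro mult_left_mono) auto
  moreover have "X powr s * (y / X) powr s = y powr s" using p by (simp flip: powr_mult)
  moreover have "X powr s * (1 + s * (y / X - 1)) = s * X powr (s - 1) * y - (s - 1) * X powr s"
    using p by (simp add: powr_diff field_simps)
  ultimately show ?thesis by simp
qed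

text \<open>Jensen's inequality on a segment, by integrating the tangent of the power at the average
  \<open>X\<close>. In this form the left side is real while the right side may be infinite.\<close>

lemma average_powr_le:
  fixes P :: "real \<Rightarrow> real"
  assumes P: "integrable lborel (\<lambda>r. indicator {0..h} r * P r)" and h: "h > 0" and s: "s \<ge> 1"
  defines "X \<equiv> max ((LBINT r. indicator {0..h} r * P r) / h) 0"
  shows "ennreal (X powr s) \<le> (\<integral>\<^sup>+r. ennreal (1 / h * (indicator {0..h} r * max (P r) 0 powr s)) \<partial>lborel)"
proof -
  have X: "X \<ge> 0" by (simp add: X_def)
  have iP: "integrable lborel (\<lambda>r. indicator {0..h} r * max (P r) 0)"
  proof -
    have "(\<lambda>r. indicator {0..h} r * max (P r) 0) = (\<lambda>r. max (indicator {0..h} r * P r) 0)"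
      by (auto simp: indicator_def)
    then show ?thesis using P by simp
  qed
  have Xle: "X * h \<le> (LBINT r. indicator {0..h} r * max (P r) 0)"
  proof -
    have 1: "(LBINT r. indicator {0..h} r * P r) \<le> (LBINT r. indicator {0..h} r * max (P r) 0)"
      using P iP by (intro Bochner_Integration.integral_mono) (auto simp: indicator_def)
    have 2: "0 \<le> (LBINT r. indicator {0..h} r * max (P r) 0)" by (intro Bochner_Integration.integral_nonneg) auto
    show ?thesis using 1 2 h by (auto simp: X_def max_def)
  qed
  define g where "g r = 1 / h * (s * X powr (s - 1) * (indicator {0..h} r * max (P r) 0) - (s - 1) * X powr s * indicator {0..h} r)" for r
  have ii: "integrable lborel (indicator {0..h} :: real \<Rightarrow> real)"
    by (intro integrable_real_indicator) (use h in auto)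
  have gi: "integrable lborel g"
    unfolding g_def using iP ii by (intro integrable_mult_right Bochner_Integration.integrable_diff) auto
  have "(LBINT r. g r) = 1 / h * (s * X powr (s - 1) * (LBINT r. indicator {0..h} r * max (P r) 0) - (s - 1) * X powr s * h)"
    unfolding g_def using iP ii h by simp
  moreover have "\<dots> \<ge> X powr s"
  proof -
    have "s * X powr (s - 1) * (X * h) \<le> s * X powr (s - 1) * (LBINT r. indicator {0..h} r * max (P r) 0)"
      using Xle s by (intro mult_left_mono) auto
    moreover have "s * X powr (s - 1) * (X * h) = s * X powr s * h"
      using X by (cases "X = 0") (auto simp: powr_diff)
    moreover have "(s - 1) * X powr s * h = s * X powr s * h - X powr s * h" by (simp add: algebra_simps)
    ultimately have "X powr s * h \<le> s * X powr (s - 1) * (LBINT r. indicator {0..h} r * max (P r) 0) - (s - 1) * X powr s * h"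
      by linarith
    then show ?thesis using h by (simp add: field_simps)
  qed
  ultimately have "ennreal (X powr s) \<le> ennreal (LBINT r. g r)" by (simp add: ennreal_leI)
  also have "\<dots> \<le> (\<integral>\<^sup>+r. ennreal (1 / h * (indicator {0..h} r * max (P r) 0 powr s)) \<partial>lborel)"
  proof (rule nn_integral_ge_integral[OF gi AE_I2])
    fix r
    have "s * X powr (s - 1) * max (P r) 0 - (s - 1) * X powr s \<le> max (P r) 0 powr s"
      by (rule powr_tangent[OF s X]) simp
    then show "g r \<le> 1 / h * (indicator {0..h} r * max (P r) 0 powr s)"
      unfolding g_def using h by (auto simp: indicator_def divide_right_mono)
  qed
  finally show ?thesis .
qed

text \<open>An exponent above 1 makes the one-sided power continuously differentiable across 0, as
  is required of \<open>G\<close>.\<close>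

lemma powr_plus_C1:
  fixes \<gamma> :: real
  assumes \<gamma>: "\<gamma> > 0"
  shows "((\<lambda>t. max t 0 powr (1 + \<gamma>)) has_real_derivative (1 + \<gamma>) * max t 0 powr \<gamma>) (at t)"
    and "continuous_on UNIV (\<lambda>t. (1 + \<gamma>) * max t 0 powr \<gamma>)"
proof -
  have c: "continuous_on UNIV (\<lambda>t::real. max t 0 powr \<gamma>)"
    using \<gamma> by (intro continuous_on_powr' continuous_intros) auto
  then show "continuous_on UNIV (\<lambda>t. (1 + \<gamma>) * max t 0 powr \<gamma>)" by (intro continuous_on_mult continuous_on_const)
  show "((\<lambda>t. max t 0 powr (1 + \<gamma>)) has_real_derivative (1 + \<gamma>) * max t 0 powr \<gamma>) (at t)"
  proof (cases t "0::real" rule: linorder_cases)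
    case less
    have "((\<lambda>t::real. 0) has_real_derivative 0) (at t)" by simp
    then have "((\<lambda>t. max t 0 powr (1 + \<gamma>)) has_real_derivative 0) (at t)"
      by (rule DERIV_cong_ev[THEN iffD1, rotated 3])
        (use less \<gamma> in \<open>auto simp: eventually_nhds intro!: exI[of _ "{..<0}"]\<close>)
    then show ?thesis using less \<gamma> by simp
  next
    case equal
    have "isCont (\<lambda>t::real. max t 0 powr \<gamma>) 0" using c by (simp add: continuous_on_eq_continuous_at)
    then have "((\<lambda>h::real. max h 0 powr \<gamma>) \<longlongrightarrow> 0) (at 0)" using \<gamma> by (simp add: isCont_def)
    then have "((\<lambda>h::real. max h 0 powr (1 + \<gamma>) / h) \<longlongrightarrow> 0) (at 0)"
    proof (rule Lim_transform_eventually)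
      show "\<forall>\<^sub>F h in at (0::real). max h 0 powr \<gamma> = max h 0 powr (1 + \<gamma>) / h"
        using \<gamma> by (auto simp: eventually_at max_def powr_add intro!: exI[of _ 1])
    qed
    then show ?thesis using equal \<gamma> by (simp add: has_field_derivative_iff)
  next
    case greater
    have "((\<lambda>t. t powr (1 + \<gamma>)) has_real_derivative (1 + \<gamma>) * t powr \<gamma>) (at t)"
      using greater by (auto intro!: derivative_eq_intros)
    then have "((\<lambda>t. max t 0 powr (1 + \<gamma>)) has_real_derivative (1 + \<gamma>) * t powr \<gamma>) (at t)"
      by (rule DERIV_cong_ev[THEN iffD1, rotated 3])
        (use greater in \<open>auto simp: eventually_nhds intro!: exI[of _ "{0<..}"]\<close>)
    then show ?thesis using greater by simp
  qed
qed

text \<open>Both factors are bounded by powers of the larger of \<open>X powr q\<close> and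
  \<open>F\<close>; the exponents \<open>b + 1 / Q\<close> and \<open>1 - 1 / Q\<close> add up to
  \<open>1 + b\<close>.\<close>

lemma powr_interpolation:
  fixes X F b q Q :: real
  assumes "X \<ge> 0" "F \<ge> 1" "b \<ge> 0" "q > 0" "Q \<ge> 1"
  shows "X powr (q * (b + 1 / Q)) * F powr (1 - 1 / Q) \<le> X powr (q * (1 + b)) + F powr (1 + b)"
proof -
  define T where "T = max (X powr q) F"
  have T: "T \<ge> 1" "X powr q \<le> T" "F \<le> T" using assms by (auto simp: T_def)
  have Q1: "0 \<le> b + 1 / Q" "0 \<le> 1 - 1 / Q" using assms by auto
  have "X powr (q * (b + 1 / Q)) * F powr (1 - 1 / Q) = (X powr q) powr (b + 1 / Q) * F powr (1 - 1 / Q)"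
    by (simp add: powr_powr)
  also have "\<dots> \<le> T powr (b + 1 / Q) * T powr (1 - 1 / Q)"
    using T assms Q1 by (intro mult_mono powr_mono2) auto
  also have "\<dots> = T powr (1 + b)" by (simp flip: powr_add add: add.commute)
  also have "\<dots> \<le> X powr (q * (1 + b)) + F powr (1 + b)"
  proof (cases "X powr q \<le> F")
    case False
    then have "T = X powr q" by (simp add: T_def)
    then show ?thesis by (simp add: powr_powr)
  qed (simp add: T_def)
  finally show ?thesis .
qed

lemma nn_integral_powr_finite:
  fixes \<epsilon> e :: real
  assumes "e > 0" "\<epsilon> > 0"
  shows "(\<integral>\<^sup>+h. ennreal (indicator {0<..<\<epsilon>} h * h powr (e - 1)) \<partial>lborel) < \<infinity>"
proof -
  have "((\<lambda>x. x powr (e - 1)) has_integral (\<epsilon> powr (e - 1 + 1) / (e - 1 + 1))) {0..\<epsilon>}"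
    by (rule has_integral_powr_from_0) (use assms in auto)
  then have "((\<lambda>x. indicator {0..\<epsilon>} x * x powr (e - 1)) has_integral (\<epsilon> powr e / e)) UNIV"
  proof -
    have "(\<lambda>x. indicator {0..\<epsilon>} x * x powr (e - 1)) = (\<lambda>x. if x \<in> {0..\<epsilon>} then x powr (e - 1) else 0)"
      by (auto simp: indicator_def)
    moreover assume "((\<lambda>x. x powr (e - 1)) has_integral (\<epsilon> powr (e - 1 + 1) / (e - 1 + 1))) {0..\<epsilon>}"
    ultimately show ?thesis by (simp only: has_integral_restrict_UNIV) simp
  qed
  then have "(\<integral>\<^sup>+h. ennreal (indicator {0..\<epsilon>} h * h powr (e - 1)) \<partial>lborel) = ennreal (\<epsilon> powr e / e)"
    by (intro nn_integral_has_integral_lborel) auto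
  moreover have "(\<integral>\<^sup>+h. ennreal (indicator {0<..<\<epsilon>} h * h powr (e - 1)) \<partial>lborel) \<le> (\<integral>\<^sup>+h. ennreal (indicator {0..\<epsilon>} h * h powr (e - 1)) \<partial>lborel)"
    by (intro nn_integral_mono ennreal_leI) (auto simp: indicator_def)
  ultimately show ?thesis by (simp add: le_less_trans)
qed

text \<open>Writing the indicator of the variable interval as a conditional exposes joint
  measurability in the point and the length, which the exchange of almost-everywhere quantifiers
  needs.\<close>

lemma line_int_measurable[measurable]:
  fixes g :: "real ^ 'n \<Rightarrow> real"
  assumes [measurable]: "g \<in> borel_measurable borel"
  shows "(\<lambda>(x, s). line_int g j s x) \<in> borel_measurable (lborel \<Otimes>\<^sub>M lborel)"
proof -
  have "(\<lambda>(x, s). line_int g j s x) = (\<lambda>w. \<integral>r. (if 0 \<le> r \<and> r \<le> snd w then g (fst w + r *\<^sub>R axis j 1) else 0) \<partial>lborel)"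
    by (auto simp: line_int_def indicator_def case_prod_unfold intro!: Bochner_Integration.integral_cong)
  also have "\<dots> \<in> borel_measurable (lborel \<Otimes>\<^sub>M lborel)"
    by measurable
  finally show ?thesis .
qed

section \<open>The error term under known local integrability\<close>

context split_minimizer
begin

definition local_int :: "real \<Rightarrow> bool" where
  "local_int b \<longleftrightarrow> (\<forall>K j. compact K \<longrightarrow> K \<subseteq> \<Omega> \<longrightarrow>
     (\<integral>\<^sup>+x. ennreal (indicator K x * (1 + f j (p j x)) powr (1 + b)) \<partial>lborel) < \<infinity>)"

lemma Q_gt_1: "Q > 1" using q(1,3) less_le_trans by blast

lemma M_nonneg: "M \<ge> 0" using u_bound[of 0] by linarith

text \<open>The power \<open>1 + \<gamma>\<close> of the increment is split: the part
  \<open>1 - e\<close> is bounded through \<open>u\<close>, the part \<open>\<gamma> + e\<close> is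
  that power of \<open>h\<close> times the same power of a segment average of p_i. The latter and
  f_j' interpolate to quantities integrable by \<open>local_int b\<close>.\<close>

lemma error_bound:
  fixes z :: "real ^ 'n" and i :: 'n
  assumes \<epsilon>: "0 < \<epsilon>" "cball z (5 * \<epsilon>) \<subseteq> \<Omega>" and b: "b \<ge> 0" and LI: "local_int b"
    and \<gamma>: "\<gamma> > 0" "e > 0" "e \<le> 1" "\<gamma> + e = qp i * (b + 1 / Q)"
  shows "\<exists>C\<ge>0. \<forall>h. 0 < h \<longrightarrow> h \<le> \<epsilon> \<longrightarrow>
     (\<integral>\<^sup>+x. ennreal (\<bar>max (u (x + h *\<^sub>R axis i 1) - u x) 0 powr (1 + \<gamma>)\<bar> *
        (\<Sum>j\<in>UNIV. \<bar>grad (bump_at \<zeta> z \<epsilon>) x $ j\<bar> * (\<bar>f' j (p j (x + h *\<^sub>R axis i 1))\<bar> + \<bar>f' j (p j x)\<bar>))) \<partial>lborel)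
     \<le> ennreal (C * h powr (\<gamma> + e))"
proof -
  define \<eta> where "\<eta> = bump_at \<zeta> z \<epsilon>"
  define K2 where "K2 = cball z (2 * \<epsilon>)"
  define K3 where "K3 = cball z (3 * \<epsilon>)"
  have [measurable]: "K2 \<in> sets borel" "K3 \<in> sets borel" by (auto simp: K2_def K3_def)
  have K3: "compact K3" "K3 \<subseteq> \<Omega>" using \<epsilon> by (auto simp: K3_def)
  have K23: "x + r *\<^sub>R axis i 1 \<in> K3" if "x \<in> K2" "0 \<le> r" "r \<le> \<epsilon>" for x r
  proof -
    have "dist z (x + r *\<^sub>R axis i 1) \<le> dist z x + norm (r *\<^sub>R axis i 1 :: real ^ 'n)"
      by (rule dist_add_le)
    then show ?thesis using that by (auto simp: K2_def K3_def)
  qed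
  have \<eta>T: "\<eta> \<in> test_functions (ball z (3 * \<epsilon>))"
    unfolding \<eta>_def using bump \<epsilon> by (intro bump_at_test_function) auto
  obtain L where L: "L \<ge> 0" "\<And>x j. \<bar>grad \<eta> x $ j\<bar> \<le> L"
    using test_function_bounded[OF \<eta>T] by metis
  have \<eta>0: "\<eta> x = 0" if "x \<notin> K2" for x
    using bump_at_eq_0[OF bump \<epsilon>(1)] that by (simp add: \<eta>_def K2_def)
  have g\<eta>0: "grad \<eta> x $ j = 0" if "x \<notin> K2" for x j
    using grad_eq_0_outside[of K2 \<eta> x] \<eta>0 that by (simp add: K2_def)
  have "\<exists>C\<ge>0. \<forall>t. \<bar>f' j t\<bar> \<le> C * (1 + f j t) powr (1 - 1 / Q)" for j
    by (rule convex_C1_deriv_le[OF f_C1 f_growth]) (use q in auto)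
  then obtain C3 where C3: "\<And>j. C3 j \<ge> 0" "\<And>j t. \<bar>f' j t\<bar> \<le> C3 j * (1 + f j t) powr (1 - 1 / Q)"
    by metis
  obtain C4 where C4: "C4 \<ge> 0" "\<And>t. t \<ge> 0 \<Longrightarrow> t powr qp i \<le> C4 * (1 + f i t)"
    using power_growth_compare[OF f_C1 f_growth q(1)] by blast
  \<comment> \<open>The exponent at which the positive part of p_i is integrable under
    \<open>local_int b\<close>; it is at least 1, as Jensen's inequality requires.\<close>
  define s where "s = qp i * (1 + b)"
  have s: "s \<ge> 1" using q(1)[of i] b unfolding s_def by (metis add_increasing2 le_numeral_extra(4) less_eq_real_def mult_ge1_I)
  define T1 where "T1 = (\<integral>\<^sup>+x. ennreal (indicator K3 x * max (p i x) 0 powr s) \<partial>lborel)"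
  define T2 where "T2 j = (\<integral>\<^sup>+x. ennreal (indicator K3 x * (1 + f j (p j x)) powr (1 + b)) \<partial>lborel)" for j
  have T2: "T2 j < \<infinity>" for j using LI K3 unfolding local_int_def T2_def by blast
  have T1: "T1 < \<infinity>"
  proof -
    have "T1 \<le> (\<integral>\<^sup>+x. ennreal (C4 powr (1 + b)) * ennreal (indicator K3 x * (1 + f i (p i x)) powr (1 + b)) \<partial>lborel)"
      unfolding T1_def
    proof (rule nn_integral_mono)
      fix x
      have "max (p i x) 0 powr s \<le> C4 powr (1 + b) * (1 + f i (p i x)) powr (1 + b)"
      proof (cases "p i x \<ge> 0")
        case True
        have "max (p i x) 0 powr s = (p i x powr qp i) powr (1 + b)" using True by (simp add: s_def powr_powr max_def)
        also have "\<dots> \<le> (C4 * (1 + f i (p i x))) powr (1 + b)" using C4(2)[OF True] b by (intro powr_mono2) auto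
        also have "\<dots> = C4 powr (1 + b) * (1 + f i (p i x)) powr (1 + b)" using C4 f_nonneg[of i "p i x"] by (simp add: powr_mult)
        finally show ?thesis .
      qed simp
      then show "ennreal (indicator K3 x * max (p i x) 0 powr s)
          \<le> ennreal (C4 powr (1 + b)) * ennreal (indicator K3 x * (1 + f i (p i x)) powr (1 + b))"
        by (subst ennreal_mult[symmetric]) (auto simp: indicator_def intro!: ennreal_leI)
    qed
    also have "\<dots> = ennreal (C4 powr (1 + b)) * T2 i" unfolding T2_def by (rule nn_integral_cmult) measurable
    also have "\<dots> < \<infinity>" using T2[of i] by (simp add: ennreal_mult_less_top)
    finally show ?thesis .
  qed
  define CM where "CM = (2 * M) powr (1 - e)"
  have CM: "CM \<ge> 0" by (simp add: CM_def)
  define TT where "TT = (\<Sum>j\<in>UNIV. ennreal (L * C3 j) * (2 * T1 + T2 j + T2 j))"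
  have TT: "TT < \<infinity>"
    unfolding TT_def using T1 T2 by (simp add: ennreal_mult_less_top)
  have main: "(\<integral>\<^sup>+x. ennreal (\<bar>max (u (x + h *\<^sub>R axis i 1) - u x) 0 powr (1 + \<gamma>)\<bar> *
        (\<Sum>j\<in>UNIV. \<bar>grad \<eta> x $ j\<bar> * (\<bar>f' j (p j (x + h *\<^sub>R axis i 1))\<bar> + \<bar>f' j (p j x)\<bar>))) \<partial>lborel)
     \<le> ennreal (CM * h powr (\<gamma> + e)) * TT" if h: "0 < h" "h \<le> \<epsilon>" for h
  proof -
    let ?h = "h *\<^sub>R axis i 1 :: real ^ 'n"
    let ?E = "\<lambda>x. \<bar>max (u (x + ?h) - u x) 0 powr (1 + \<gamma>)\<bar> *
        (\<Sum>j\<in>UNIV. \<bar>grad \<eta> x $ j\<bar> * (\<bar>f' j (p j (x + ?h))\<bar> + \<bar>f' j (p j x)\<bar>))"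
    \<comment> \<open>The positive part of the average slope: on the support of the cutoff
      \<open>h * X x\<close> is almost everywhere the positive increment of
      \<open>u\<close>.\<close>
    define X where "X x = max (line_int (p i) i h x / h) 0" for x
    have [measurable]: "line_int (p i) i h \<in> borel_measurable borel" using line_int_integrable[OF p_int] by auto
    have [measurable]: "X \<in> borel_measurable borel" unfolding X_def by measurable
    have X0: "X x \<ge> 0" for x by (simp add: X_def)
    define S where "S j x = indicator K2 x * (2 * X x powr s + (1 + f j (p j (x + ?h))) powr (1 + b) + (1 + f j (p j x)) powr (1 + b))" for j x
    have [measurable]: "S j \<in> borel_measurable borel" for j unfolding S_def by measurable
    have S0: "S j x \<ge> 0" for j x by (simp add: S_def)
    have pt: "AE x in lborel. ?E x \<le> CM * h powr (\<gamma> + e) * (\<Sum>j\<in>UNIV. L * C3 j * S j x)"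
      using u_line[OF \<epsilon> less_imp_le[OF h(1)] h(2), of i]
    proof (rule eventually_mono)
      fix x assume elim: "x \<in> ball z (4 * \<epsilon>) \<longrightarrow> u (x + ?h) - u x = line_int (p i) i h x"
      show "?E x \<le> CM * h powr (\<gamma> + e) * (\<Sum>j\<in>UNIV. L * C3 j * S j x)"
      proof (cases "x \<in> K2")
        case False
        then show ?thesis using g\<eta>0 S0 CM L C3 by (auto intro!: mult_nonneg_nonneg sum_nonneg)
      next
        case True
        then have "x \<in> ball z (4 * \<epsilon>)" using \<epsilon> by (auto simp: K2_def)
        then have v: "u (x + ?h) - u x = line_int (p i) i h x" using elim by blast
        have hX: "max (u (x + ?h) - u x) 0 = h * X x" unfolding v X_def using h by (auto simp: max_def field_simps)
        have hXM: "h * X x \<le> 2 * M"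
          using u_bound[of x] u_bound[of "x + ?h"] M_nonneg unfolding hX[symmetric] by (simp add: abs_le_iff)
        \<comment> \<open>The assumption \<open>e \<le> 1\<close> keeps the exponent
          \<open>1 - e\<close> nonnegative, so this part of the increment may be replaced by its
          bound \<open>2 * M\<close>.\<close>
        have GX: "max (u (x + ?h) - u x) 0 powr (1 + \<gamma>) \<le> CM * h powr (\<gamma> + e) * X x powr (\<gamma> + e)"
        proof -
          have "(h * X x) powr (1 + \<gamma>) = (h * X x) powr (1 - e) * (h * X x) powr (\<gamma> + e)"
            by (simp flip: powr_add)
          also have "\<dots> \<le> CM * (h * X x) powr (\<gamma> + e)"
            unfolding CM_def using hXM h X0[of x] \<gamma> by (intro mult_right_mono powr_mono2) auto
          finally show ?thesis unfolding hX using h X0[of x] by (simp add: powr_mult mult.assoc)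
        qed
        have tj: "X x powr (\<gamma> + e) * (\<bar>grad \<eta> x $ j\<bar> * (\<bar>f' j (p j (x + ?h))\<bar> + \<bar>f' j (p j x)\<bar>)) \<le> L * C3 j * S j x" for j
        proof -
          have F: "X x powr (\<gamma> + e) * \<bar>f' j t\<bar> \<le> C3 j * (X x powr s + (1 + f j t) powr (1 + b))" for t
          proof -
            have "X x powr (\<gamma> + e) * \<bar>f' j t\<bar> \<le> X x powr (\<gamma> + e) * (C3 j * (1 + f j t) powr (1 - 1 / Q))"
              using C3(2) by (intro mult_left_mono) auto
            also have "\<dots> = C3 j * (X x powr (qp i * (b + 1 / Q)) * (1 + f j t) powr (1 - 1 / Q))"
              using \<gamma>(4) by (simp add: mult.left_commute)
            also have "\<dots> \<le> C3 j * (X x powr s + (1 + f j t) powr (1 + b))"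
              unfolding s_def using X0 f_nonneg b q(1)[of i] Q_gt_1 C3(1)
              by (intro mult_left_mono powr_interpolation) auto
            finally show ?thesis .
          qed
          have "X x powr (\<gamma> + e) * (\<bar>grad \<eta> x $ j\<bar> * (\<bar>f' j (p j (x + ?h))\<bar> + \<bar>f' j (p j x)\<bar>))
             = \<bar>grad \<eta> x $ j\<bar> * (X x powr (\<gamma> + e) * \<bar>f' j (p j (x + ?h))\<bar> + X x powr (\<gamma> + e) * \<bar>f' j (p j x)\<bar>)"
            by (simp add: algebra_simps)
          also have "\<dots> \<le> L * (C3 j * (X x powr s + (1 + f j (p j (x + ?h))) powr (1 + b)) + C3 j * (X x powr s + (1 + f j (p j x)) powr (1 + b)))"
            by (rule mult_mono[OF L(2) add_mono[OF F F]]) (use L in auto)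
          also have "\<dots> = L * C3 j * S j x" using True by (simp add: S_def algebra_simps)
          finally show ?thesis .
        qed
        have "\<bar>max (u (x + ?h) - u x) 0 powr (1 + \<gamma>)\<bar> * (\<Sum>j\<in>UNIV. \<bar>grad \<eta> x $ j\<bar> * (\<bar>f' j (p j (x + ?h))\<bar> + \<bar>f' j (p j x)\<bar>))
           \<le> CM * h powr (\<gamma> + e) * X x powr (\<gamma> + e) * (\<Sum>j\<in>UNIV. \<bar>grad \<eta> x $ j\<bar> * (\<bar>f' j (p j (x + ?h))\<bar> + \<bar>f' j (p j x)\<bar>))"
          using GX by (intro mult_right_mono sum_nonneg) auto
        also have "\<dots> = CM * h powr (\<gamma> + e) * (\<Sum>j\<in>UNIV. X x powr (\<gamma> + e) * (\<bar>grad \<eta> x $ j\<bar> * (\<bar>f' j (p j (x + ?h))\<bar> + \<bar>f' j (p j x)\<bar>)))"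
          by (simp add: sum_distrib_left mult.assoc)
        also have "\<dots> \<le> CM * h powr (\<gamma> + e) * (\<Sum>j\<in>UNIV. L * C3 j * S j x)"
          using CM by (intro mult_left_mono sum_mono tj) auto
        finally show ?thesis .
      qed
    qed
    have "(\<integral>\<^sup>+x. ennreal (indicator K2 x * X x powr s) \<partial>lborel)
       \<le> (\<integral>\<^sup>+x. (\<integral>\<^sup>+r. ennreal (indicator K2 x * (1 / h * (indicator {0..h} r * max (p i (x + r *\<^sub>R axis i 1)) 0 powr s))) \<partial>lborel) \<partial>lborel)"
    proof (rule nn_integral_mono_AE)
      show "AE x in lborel. ennreal (indicator K2 x * X x powr s)
        \<le> (\<integral>\<^sup>+r. ennreal (indicator K2 x * (1 / h * (indicator {0..h} r * max (p i (x + r *\<^sub>R axis i 1)) 0 powr s))) \<partial>lborel)"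
        using line_integrable_AE[OF p_int, of h i i]
      proof (rule eventually_mono)
        fix x assume "integrable lborel (\<lambda>r. indicator {0..h} r * p i (x + r *\<^sub>R axis i 1))"
        from average_powr_le[OF this h(1) s]
        show "ennreal (indicator K2 x * X x powr s)
          \<le> (\<integral>\<^sup>+r. ennreal (indicator K2 x * (1 / h * (indicator {0..h} r * max (p i (x + r *\<^sub>R axis i 1)) 0 powr s))) \<partial>lborel)"
          by (cases "x \<in> K2") (auto simp: X_def line_int_def)
      qed
    qed
    \<comment> \<open>After Jensen on each segment, Tonelli integrates over \<open>x\<close> first;
      the translates of \<open>K2\<close> stay in \<open>K3\<close>, so each shift contributes at
      most \<open>T1\<close>, and their mean is no larger.\<close>
    also have "\<dots> = (\<integral>\<^sup>+r. (\<integral>\<^sup>+x. ennreal (indicator K2 x * (1 / h * (indicator {0..h} r * max (p i (x + r *\<^sub>R axis i 1)) 0 powr s))) \<partial>lborel) \<partial>lborel)"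
      by (rule lborel_pair.Fubini'[symmetric]) measurable
    also have "\<dots> \<le> (\<integral>\<^sup>+r. ennreal (1 / h) * T1 * indicator {0..h} r \<partial>lborel)"
    proof (rule nn_integral_mono)
      fix r :: real
      show "(\<integral>\<^sup>+x. ennreal (indicator K2 x * (1 / h * (indicator {0..h} r * max (p i (x + r *\<^sub>R axis i 1)) 0 powr s))) \<partial>lborel)
         \<le> ennreal (1 / h) * T1 * indicator {0..h} r"
      proof (cases "r \<in> {0..h}")
        case True
        have "(\<integral>\<^sup>+x. ennreal (indicator K2 x * (1 / h * (indicator {0..h} r * max (p i (x + r *\<^sub>R axis i 1)) 0 powr s))) \<partial>lborel)
          \<le> (\<integral>\<^sup>+x. ennreal (1 / h) * (\<lambda>y. ennreal (indicator K3 y * max (p i y) 0 powr s)) (x + r *\<^sub>R axis i 1) \<partial>lborel)"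
        proof (rule nn_integral_mono)
          fix x
          show "ennreal (indicator K2 x * (1 / h * (indicator {0..h} r * max (p i (x + r *\<^sub>R axis i 1)) 0 powr s)))
            \<le> ennreal (1 / h) * (\<lambda>y. ennreal (indicator K3 y * max (p i y) 0 powr s)) (x + r *\<^sub>R axis i 1)"
            using K23[of x r] True h by (subst ennreal_mult[symmetric]) (auto simp: indicator_def)
        qed
        also have "\<dots> = ennreal (1 / h) * (\<integral>\<^sup>+x. (\<lambda>y. ennreal (indicator K3 y * max (p i y) 0 powr s)) (x + r *\<^sub>R axis i 1) \<partial>lborel)"
          by (rule nn_integral_cmult) measurable
        also have "(\<integral>\<^sup>+x. (\<lambda>y. ennreal (indicator K3 y * max (p i y) 0 powr s)) (x + r *\<^sub>R axis i 1) \<partial>lborel) = T1"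
          unfolding T1_def by (rule nn_integral_lborel_shift) measurable
        finally show ?thesis using True by simp
      qed simp
    qed
    also have "\<dots> = ennreal (1 / h) * T1 * ennreal h" using h by (simp add: nn_integral_cmult)
    also have "\<dots> = ennreal (1 / h) * ennreal h * T1" by (simp add: ac_simps)
    also have "\<dots> = T1" using h by (simp flip: ennreal_mult)
    finally have IX: "(\<integral>\<^sup>+x. ennreal (indicator K2 x * X x powr s) \<partial>lborel) \<le> T1" .
    have I2: "(\<integral>\<^sup>+x. ennreal (indicator K2 x * (1 + f j (p j (x + r *\<^sub>R axis i 1))) powr (1 + b)) \<partial>lborel) \<le> T2 j" if "0 \<le> r" "r \<le> \<epsilon>" for j r
    proof -
      have "(\<integral>\<^sup>+x. ennreal (indicator K2 x * (1 + f j (p j (x + r *\<^sub>R axis i 1))) powr (1 + b)) \<partial>lborel)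
         \<le> (\<integral>\<^sup>+x. (\<lambda>y. ennreal (indicator K3 y * (1 + f j (p j y)) powr (1 + b))) (x + r *\<^sub>R axis i 1) \<partial>lborel)"
        using K23 that by (intro nn_integral_mono) (auto simp: indicator_def)
      also have "\<dots> = T2 j"
        unfolding T2_def by (rule nn_integral_lborel_shift) measurable
      finally show ?thesis .
    qed
    have IS: "(\<integral>\<^sup>+x. ennreal (S j x) \<partial>lborel) \<le> 2 * T1 + T2 j + T2 j" for j
    proof -
      have "(\<integral>\<^sup>+x. ennreal (S j x) \<partial>lborel) = (\<integral>\<^sup>+x. 2 * ennreal (indicator K2 x * X x powr s)
          + ennreal (indicator K2 x * (1 + f j (p j (x + ?h))) powr (1 + b)) + ennreal (indicator K2 x * (1 + f j (p j x)) powr (1 + b)) \<partial>lborel)"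
        by (rule nn_integral_cong) (auto simp: S_def indicator_def ennreal_plus ennreal_mult)
      also have "\<dots> = 2 * (\<integral>\<^sup>+x. ennreal (indicator K2 x * X x powr s) \<partial>lborel)
          + (\<integral>\<^sup>+x. ennreal (indicator K2 x * (1 + f j (p j (x + ?h))) powr (1 + b)) \<partial>lborel) + (\<integral>\<^sup>+x. ennreal (indicator K2 x * (1 + f j (p j x)) powr (1 + b)) \<partial>lborel)"
        by (subst nn_integral_add; (simp | subst nn_integral_add | subst nn_integral_cmult)+)
      also have "\<dots> \<le> 2 * T1 + T2 j + T2 j"
        using IX I2[of h j] I2[of 0 j] h \<epsilon> by (intro add_mono mult_left_mono) auto
      finally show ?thesis .
    qed
    have "(\<integral>\<^sup>+x. ennreal (?E x) \<partial>lborel)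
      \<le> (\<integral>\<^sup>+x. ennreal (CM * h powr (\<gamma> + e)) * (\<Sum>j\<in>UNIV. ennreal (L * C3 j) * ennreal (S j x)) \<partial>lborel)"
    proof (rule nn_integral_mono_AE)
      show "AE x in lborel. ennreal (?E x) \<le> ennreal (CM * h powr (\<gamma> + e)) * (\<Sum>j\<in>UNIV. ennreal (L * C3 j) * ennreal (S j x))"
        using pt
      proof (rule eventually_mono)
        fix x assume le: "?E x \<le> CM * h powr (\<gamma> + e) * (\<Sum>j\<in>UNIV. L * C3 j * S j x)"
        have "ennreal (CM * h powr (\<gamma> + e)) * (\<Sum>j\<in>UNIV. ennreal (L * C3 j) * ennreal (S j x)) = ennreal (CM * h powr (\<gamma> + e) * (\<Sum>j\<in>UNIV. L * C3 j * S j x))"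
          using S0 CM L C3 by (simp add: ennreal_mult sum_nonneg flip: sum_ennreal)
        with le show "ennreal (?E x) \<le> ennreal (CM * h powr (\<gamma> + e)) * (\<Sum>j\<in>UNIV. ennreal (L * C3 j) * ennreal (S j x))"
          by (simp add: ennreal_leI)
      qed
    qed
    also have "\<dots> = ennreal (CM * h powr (\<gamma> + e)) * (\<Sum>j\<in>UNIV. ennreal (L * C3 j) * (\<integral>\<^sup>+x. ennreal (S j x) \<partial>lborel))"
      by (simp add: nn_integral_cmult nn_integral_sum)
    also have "\<dots> \<le> ennreal (CM * h powr (\<gamma> + e)) * TT"
      unfolding TT_def by (intro mult_left_mono sum_mono IS) auto
    finally show ?thesis .
  qed
  obtain tt where tt: "tt \<ge> 0" "TT = ennreal tt" using TT by (cases TT) auto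
  have "ennreal (CM * h powr (\<gamma> + e)) * TT = ennreal (CM * tt * h powr (\<gamma> + e))" for h
    unfolding tt(2) using CM tt(1) by (subst ennreal_mult[symmetric]) (auto simp: ac_simps)
  with main show ?thesis
    using CM tt(1) by (intro exI[of _ "CM * tt"]) (auto simp: \<eta>_def)
qed

end

section \<open>Integration over all scales\<close>

context split_minimizer
begin

text \<open>The left side of the difference inequality for the one-sided power
  \<open>1 + \<gamma>\<close>, before integration in \<open>x\<close>. The weight divides the power
  \<open>\<gamma>\<close> of the increment by the same power of \<open>h\<close> and leaves the
  scale-invariant measure dh / h.\<close>

definition difference_energy :: "'n \<Rightarrow> real \<Rightarrow> real ^ 'n \<Rightarrow> real \<Rightarrow> real ^ 'n \<Rightarrow> ennreal" where
  "difference_energy i \<gamma> z \<epsilon> x = (\<integral>\<^sup>+h. ennreal (indicator {0<..<\<epsilon>} h * (h powr (- \<gamma> - 1) * (bump_at \<zeta> z \<epsilon> x *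
        ((1 + \<gamma>) * max (u (x + h *\<^sub>R axis i 1) - u x) 0 powr \<gamma>) *
        ((f' i (p i (x + h *\<^sub>R axis i 1)) - f' i (p i x)) * (p i (x + h *\<^sub>R axis i 1) - p i x))))) \<partial>lborel)"

text \<open>The error is of order \<open>h powr (\<gamma> + e)\<close>, so the weight leaves
  \<open>h powr (e - 1)\<close>, which is integrable at 0 because \<open>e > 0\<close>.\<close>

lemma difference_energy_finite:
  fixes z :: "real ^ 'n" and i :: 'n
  assumes \<epsilon>: "0 < \<epsilon>" "cball z (5 * \<epsilon>) \<subseteq> \<Omega>" and b: "b \<ge> 0" and LI: "local_int b"
    and \<gamma>: "\<gamma> > 0" "e > 0" "e \<le> 1" "\<gamma> + e = qp i * (b + 1 / Q)"
  shows "(\<integral>\<^sup>+x. difference_energy i \<gamma> z \<epsilon> x \<partial>lborel) < \<infinity>"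
proof -
  let ?e = "axis i 1 :: real ^ 'n"
  define \<eta> where "\<eta> = bump_at \<zeta> z \<epsilon>"
  have [measurable]: "\<eta> \<in> borel_measurable borel"
    using test_function_borel[OF bump_at_test_function[OF bump \<epsilon>(1) order_refl, of z]] by (simp add: \<eta>_def)
  have \<eta>01: "0 \<le> \<eta> x" for x unfolding \<eta>_def by (rule bump_at_nonneg[OF bump])
  define \<Theta> where "\<Theta> h x = \<eta> x * ((1 + \<gamma>) * max (u (x + h *\<^sub>R ?e) - u x) 0 powr \<gamma>) *
        ((f' i (p i (x + h *\<^sub>R ?e)) - f' i (p i x)) * (p i (x + h *\<^sub>R ?e) - p i x))" for h x
  have \<Theta>0: "\<Theta> h x \<ge> 0" for h x unfolding \<Theta>_def using \<eta>01 \<gamma>(1) by (intro mult_nonneg_nonneg[OF _ f'_mono]) simp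
  have \<Theta>m[measurable]: "(\<lambda>(x, h). \<Theta> h x) \<in> borel_measurable (lborel \<Otimes>\<^sub>M lborel)" unfolding \<Theta>_def by measurable
  have \<Theta>m1[measurable]: "\<Theta> h \<in> borel_measurable borel" for h unfolding \<Theta>_def by measurable
  obtain C where C: "C \<ge> 0" and Cb: "\<And>h. 0 < h \<Longrightarrow> h \<le> \<epsilon> \<Longrightarrow>
     (\<integral>\<^sup>+x. ennreal (\<bar>max (u (x + h *\<^sub>R ?e) - u x) 0 powr (1 + \<gamma>)\<bar> *
        (\<Sum>j\<in>UNIV. \<bar>grad (bump_at \<zeta> z \<epsilon>) x $ j\<bar> * (\<bar>f' j (p j (x + h *\<^sub>R ?e))\<bar> + \<bar>f' j (p j x)\<bar>))) \<partial>lborel)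
     \<le> ennreal (C * h powr (\<gamma> + e))"
    using error_bound[OF \<epsilon> b LI \<gamma>] by blast
  have \<Theta>b: "(\<integral>\<^sup>+x. ennreal (\<Theta> h x) \<partial>lborel) \<le> ennreal (C * h powr (\<gamma> + e))" if h: "0 < h" "h \<le> \<epsilon>" for h
    using order_trans[OF difference_inequality[OF \<epsilon> h powr_plus_C1[OF \<gamma>(1)], of i] Cb[OF h]] \<gamma>
    by (simp add: \<Theta>_def \<eta>_def)
  have "(\<integral>\<^sup>+x. (\<integral>\<^sup>+h. ennreal (indicator {0<..<\<epsilon>} h * (h powr (- \<gamma> - 1) * \<Theta> h x)) \<partial>lborel) \<partial>lborel)
     = (\<integral>\<^sup>+h. (\<integral>\<^sup>+x. ennreal (indicator {0<..<\<epsilon>} h * (h powr (- \<gamma> - 1) * \<Theta> h x)) \<partial>lborel) \<partial>lborel)"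
    by (rule lborel_pair.Fubini'[symmetric]) measurable
  also have "\<dots> \<le> (\<integral>\<^sup>+h. ennreal C * ennreal (indicator {0<..<\<epsilon>} h * h powr (e - 1)) \<partial>lborel)"
  proof (rule nn_integral_mono)
    fix h :: real
    show "(\<integral>\<^sup>+x. ennreal (indicator {0<..<\<epsilon>} h * (h powr (- \<gamma> - 1) * \<Theta> h x)) \<partial>lborel) \<le> ennreal C * ennreal (indicator {0<..<\<epsilon>} h * h powr (e - 1))"
    proof (cases "h \<in> {0<..<\<epsilon>}")
      case True
      then have h: "0 < h" "h \<le> \<epsilon>" by auto
      have "(\<integral>\<^sup>+x. ennreal (indicator {0<..<\<epsilon>} h * (h powr (- \<gamma> - 1) * \<Theta> h x)) \<partial>lborel) = (\<integral>\<^sup>+x. ennreal (h powr (- \<gamma> - 1)) * ennreal (\<Theta> h x) \<partial>lborel)"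
        using True \<Theta>0 by (simp add: ennreal_mult)
      also have "\<dots> = ennreal (h powr (- \<gamma> - 1)) * (\<integral>\<^sup>+x. ennreal (\<Theta> h x) \<partial>lborel)"
        by (rule nn_integral_cmult) simp
      also have "\<dots> \<le> ennreal (h powr (- \<gamma> - 1)) * ennreal (C * h powr (\<gamma> + e))"
        by (intro mult_left_mono \<Theta>b h) auto
      also have "\<dots> = ennreal (C * h powr (e - 1))"
        using C h by (simp add: ennreal_mult[symmetric] mult.left_commute flip: powr_add)
      finally show ?thesis using True C by (simp add: ennreal_mult)
    qed simp
  qed
  also have "\<dots> = ennreal C * (\<integral>\<^sup>+h. ennreal (indicator {0<..<\<epsilon>} h * h powr (e - 1)) \<partial>lborel)"
    by (rule nn_integral_cmult) measurable
  also have "\<dots> < \<infinity>"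
    using nn_integral_powr_finite[OF \<gamma>(2) \<epsilon>(1)] by (simp add: ennreal_mult_less_top)
  finally show ?thesis unfolding \<Theta>_def \<eta>_def difference_energy_def .
qed

text \<open>\<open>scale_selection\<close> on the line through \<open>x\<close>, with the
  monotonicity gain as lower bound for \<open>D\<close>. The power \<open>qp i - 1\<close> of the
  gain and \<open>\<gamma> + 1\<close> of the scales combine to
  \<open>qp i + \<gamma>\<close>.\<close>

lemma pointwise_gain:
  fixes z :: "real ^ 'n" and i :: 'n
  assumes \<epsilon>: "0 < \<epsilon>" "cball z (5 * \<epsilon>) \<subseteq> \<Omega>" and \<gamma>: "\<gamma> > 0"
  shows "\<exists>\<kappa>>0. \<exists>\<Lambda>>0. AE x in lborel. x \<in> ball z \<epsilon> \<longrightarrow> \<Lambda> \<le> p i x \<longrightarrow>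
     ennreal (\<kappa> * p i x powr (qp i + \<gamma>)) \<le>
     difference_energy i \<gamma> z \<epsilon> x"
proof -
  let ?e = "axis i 1 :: real ^ 'n"
  obtain c K L where c: "c > 0" "K \<ge> 2" "L > 0"
    and gain: "\<And>A b. A \<ge> L \<Longrightarrow> c * A powr (qp i - 1) * (A / K - b) \<le> (f' i A - f' i b) * (A - b)"
    using power_growth_monotonicity_gain[OF f_C1 f_growth q(1)] by metis
  \<comment> \<open>Above \<open>L\<close> the monotonicity gain is available; the other bound makes
    the average slope at scale \<open>\<epsilon>\<close> fall below the threshold, since
    \<open>u\<close> varies by at most \<open>2 * M\<close>.\<close>
  define \<Lambda> where "\<Lambda> = max L (4 * K * M / \<epsilon>)"
  have \<Lambda>: "\<Lambda> > 0" using c by (simp add: \<Lambda>_def less_max_iff_disj)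
  define \<kappa> where "\<kappa> = (1 + \<gamma>) * c * (1 / (2 * K)) powr (\<gamma> + 1)"
  have \<kappa>: "\<kappa> > 0" using c \<gamma> by (simp add: \<kappa>_def)
  have l1: "AE x in lborel. x \<in> ball z (4 * \<epsilon>) \<longrightarrow> u (x + \<epsilon> *\<^sub>R ?e) - u x = line_int (p i) i \<epsilon> x"
    using \<epsilon> by (intro u_line) auto
  \<comment> \<open>For each \<open>h\<close> the line formula may fail on a null set depending on
    \<open>h\<close>; exchanging the quantifiers makes almost every \<open>x\<close> serve almost
    all scales at once.\<close>
  have l2: "AE x in lborel. AE h in lborel. 0 < h \<and> h < \<epsilon> \<and> x \<in> ball z (4 * \<epsilon>) \<longrightarrow> u (x + h *\<^sub>R ?e) - u x = line_int (p i) i h x"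
  proof (subst lborel_pair.AE_commute)
    have [measurable]: "(\<lambda>w. line_int (p i) i (snd w) (fst w)) \<in> borel_measurable (lborel \<Otimes>\<^sub>M lborel)"
      using line_int_measurable[of "p i" i] by (simp add: case_prod_unfold)
    have [measurable]: "ball z (4 * \<epsilon>) \<in> sets borel" by simp
    show "{x \<in> space (lborel \<Otimes>\<^sub>M lborel). 0 < snd x \<and> snd x < \<epsilon> \<and> fst x \<in> ball z (4 * \<epsilon>) \<longrightarrow>
       u (fst x + snd x *\<^sub>R ?e) - u (fst x) = line_int (p i) i (snd x) (fst x)} \<in> sets (lborel \<Otimes>\<^sub>M lborel)"
      by measurable
    show "AE h in lborel. AE x in lborel. 0 < h \<and> h < \<epsilon> \<and> x \<in> ball z (4 * \<epsilon>) \<longrightarrow> u (x + h *\<^sub>R ?e) - u x = line_int (p i) i h x"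
    proof (rule AE_I2)
      fix h :: real
      show "AE x in lborel. 0 < h \<and> h < \<epsilon> \<and> x \<in> ball z (4 * \<epsilon>) \<longrightarrow> u (x + h *\<^sub>R ?e) - u x = line_int (p i) i h x"
      proof (cases "0 < h \<and> h < \<epsilon>")
        case True
        then show ?thesis using u_line[OF \<epsilon>, of h i] by (auto elim!: eventually_mono)
      qed auto
    qed
  qed
  have l3: "AE x in lborel. integrable lborel (\<lambda>r. indicator {0..\<epsilon>} r * p i (x + r *\<^sub>R ?e))"
    by (rule line_integrable_AE[OF p_int])
  have i4: "integrable lborel (\<lambda>x. real (Suc n) * line_int (p i) i (1 / real (Suc n)) x - p i x)" for n
    using line_int_integrable[OF p_int] p_int by simp
  \<comment> \<open>Along a subsequence the short averages of p_i converge almost everywhere to p_i;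
    this supplies a starting scale \<open>h1\<close> on which the average is still at least
    \<open>A / 2\<close>.\<close>
  obtain r :: "nat \<Rightarrow> nat" where r: "strict_mono r"
    and l4: "AE x in lborel. (\<lambda>n. real (Suc (r n)) * line_int (p i) i (1 / real (Suc (r n))) x - p i x) \<longlonglongrightarrow> 0"
    using tendsto_L1_AE_subseq[of lborel "\<lambda>n x. real (Suc n) * line_int (p i) i (1 / real (Suc n)) x - p i x", OF i4]
      line_int_average[OF p_int, of i i] by auto
  have "AE x in lborel. x \<in> ball z \<epsilon> \<longrightarrow> \<Lambda> \<le> p i x \<longrightarrow>
     ennreal (\<kappa> * p i x powr (qp i + \<gamma>)) \<le>
     difference_energy i \<gamma> z \<epsilon> x"
    using l1 l2 l3 l4
  proof eventually_elim
    case (elim x)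
    show ?case
    proof (intro impI)
      assume x: "x \<in> ball z \<epsilon>" and A: "\<Lambda> \<le> p i x"
      define A where "A = p i x"
      define P where "P h = p i (x + h *\<^sub>R ?e)" for h
      define D where "D h = (f' i A - f' i (P h)) * (A - P h)" for h
      have AL: "A \<ge> L" "A > 0" "4 * K * M \<le> A * \<epsilon>"
        using A c(3) \<epsilon>(1) by (auto simp: A_def \<Lambda>_def field_simps)
      have x4: "x \<in> ball z (4 * \<epsilon>)" using x \<epsilon> by auto
      have Veq: "line_int (p i) i h x = (LBINT r. indicator {0..h} r * P r)" for h
        by (simp add: line_int_def P_def)
      have V0: "(LBINT r. indicator {0..\<epsilon>} r * P r) \<le> 2 * M"
        using elim(1) x4 u_bound[of x] u_bound[of "x + \<epsilon> *\<^sub>R ?e"] by (simp add: Veq[symmetric] abs_le_iff)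
      obtain h1 where h1: "0 < h1" "h1 < \<epsilon>" "A / 2 * h1 \<le> (LBINT r. indicator {0..h1} r * P r)"
      proof -
        have "(\<lambda>n. real (Suc (r n)) * line_int (p i) i (1 / real (Suc (r n))) x) \<longlonglongrightarrow> A"
          using elim(4) by (simp add: LIM_zero_iff A_def)
        then have "\<forall>\<^sub>F n in sequentially. A / 2 < real (Suc (r n)) * line_int (p i) i (1 / real (Suc (r n))) x"
          by (rule order_tendstoD) (use AL in auto)
        moreover have "(\<lambda>n. 1 / real (Suc (r n))) \<longlonglongrightarrow> 0"
          using LIMSEQ_subseq_LIMSEQ[OF LIMSEQ_inverse_real_of_nat r] by (simp add: o_def inverse_eq_divide)
        then have "\<forall>\<^sub>F n in sequentially. 1 / real (Suc (r n)) < \<epsilon>"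
          by (rule order_tendstoD) (rule \<epsilon>(1))
        ultimately have "\<forall>\<^sub>F n in sequentially. A / 2 < real (Suc (r n)) * line_int (p i) i (1 / real (Suc (r n))) x \<and> 1 / real (Suc (r n)) < \<epsilon>"
          by eventually_elim simp
        then obtain n where n: "A / 2 < real (Suc (r n)) * line_int (p i) i (1 / real (Suc (r n))) x" "1 / real (Suc (r n)) < \<epsilon>"
          by (metis (no_types, lifting) eventually_sequentially order_refl)
        show ?thesis
        proof (rule that[of "1 / real (Suc (r n))"])
          show "A / 2 * (1 / real (Suc (r n))) \<le> (LBINT ra. indicator {0..1 / real (Suc (r n))} ra * P ra)"
            using n(1) unfolding Veq[symmetric] by (simp add: field_simps)
        qed (use n(2) in auto)
      qed
      have \<eta>1: "bump_at \<zeta> z \<epsilon> x = 1" by (rule bump_at_eq_1[OF bump \<epsilon>(1) x])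
      have "ennreal (\<kappa> * p i x powr (qp i + \<gamma>)) = ennreal (1 + \<gamma>) * ennreal (c * A powr (qp i - 1) * (A / (2 * K)) powr (\<gamma> + 1))"
      proof -
        have "A powr (qp i - 1) * (A / (2 * K)) powr (\<gamma> + 1) = (1 / (2 * K)) powr (\<gamma> + 1) * A powr (qp i + \<gamma>)"
        proof -
          have "(A / (2 * K)) powr (\<gamma> + 1) = (1 / (2 * K)) powr (\<gamma> + 1) * A powr (\<gamma> + 1)"
            using AL c by (simp flip: powr_mult)
          moreover have "A powr (qp i - 1) * A powr (\<gamma> + 1) = A powr (qp i + \<gamma>)" by (simp flip: powr_add)
          ultimately show ?thesis by (simp add: ac_simps)
        qed
        then have "\<kappa> * p i x powr (qp i + \<gamma>) = (1 + \<gamma>) * (c * A powr (qp i - 1) * (A / (2 * K)) powr (\<gamma> + 1))"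
          by (simp add: \<kappa>_def A_def ac_simps)
        then show ?thesis using \<gamma> c by (simp add: ennreal_mult)
      qed
      also have "\<dots> \<le> ennreal (1 + \<gamma>) * (\<integral>\<^sup>+h. ennreal (indicator {0<..<\<epsilon>} h * (h powr (- \<gamma> - 1) * (max (LBINT r. indicator {0..h} r * P r) 0 powr \<gamma> * D h))) \<partial>lborel)"
      proof (intro mult_left_mono scale_selection[OF _ V0 h1 AL(2) c(2) AL(3)])
        show "integrable lborel (\<lambda>r. indicator {0..\<epsilon>} r * P r)" using elim(3) by (simp add: P_def)
        show "0 \<le> D r" for r unfolding D_def by (rule f'_mono)
        show "c * A powr (qp i - 1) * (A / K - P r) \<le> D r" for r unfolding D_def by (rule gain[OF AL(1)])
      qed (use \<gamma> c in auto)
      also have "\<dots> = (\<integral>\<^sup>+h. ennreal (1 + \<gamma>) * ennreal (indicator {0<..<\<epsilon>} h * (h powr (- \<gamma> - 1) * (max (LBINT r. indicator {0..h} r * P r) 0 powr \<gamma> * D h))) \<partial>lborel)"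
      proof (rule nn_integral_cmult[symmetric])
        have [measurable]: "(\<lambda>h. \<integral>r. indicator {0..h} r * P r \<partial>lborel) \<in> borel_measurable borel"
        proof -
          have [measurable]: "P \<in> borel_measurable borel" unfolding P_def by measurable
          have "(\<lambda>h. \<integral>r. indicator {0..h} r * P r \<partial>lborel) = (\<lambda>h. \<integral>r. (if 0 \<le> r \<and> r \<le> h then P r else 0) \<partial>lborel)"
            by (auto simp: indicator_def intro!: Bochner_Integration.integral_cong)
          also have "\<dots> \<in> borel_measurable borel" by measurable
          finally show ?thesis .
        qed
        have [measurable]: "D \<in> borel_measurable borel" unfolding D_def P_def by measurable
        show "(\<lambda>h. ennreal (indicator {0<..<\<epsilon>} h * (h powr (- \<gamma> - 1) * (max (LBINT r. indicator {0..h} r * P r) 0 powr \<gamma> * D h)))) \<in> borel_measurable lborel"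
          by measurable
      qed
      also have "\<dots> = difference_energy i \<gamma> z \<epsilon> x"
        unfolding difference_energy_def
      proof (rule nn_integral_cong_AE)
        have Dp: "0 \<le> D h" for h unfolding D_def by (rule f'_mono)
        have De: "(f' i (p i (x + h *\<^sub>R ?e)) - f' i (p i x)) * (p i (x + h *\<^sub>R ?e) - p i x) = D h" for h
          by (simp add: D_def P_def A_def algebra_simps)
        show "AE h in lborel. ennreal (1 + \<gamma>) * ennreal (indicator {0<..<\<epsilon>} h * (h powr (- \<gamma> - 1) * (max (LBINT r. indicator {0..h} r * P r) 0 powr \<gamma> * D h)))
          = ennreal (indicator {0<..<\<epsilon>} h * (h powr (- \<gamma> - 1) * (bump_at \<zeta> z \<epsilon> x *
        ((1 + \<gamma>) * max (u (x + h *\<^sub>R ?e) - u x) 0 powr \<gamma>) *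
        ((f' i (p i (x + h *\<^sub>R ?e)) - f' i (p i x)) * (p i (x + h *\<^sub>R ?e) - p i x)))))"
          (is "AE h in lborel. ?eq h")
          using elim(2)
        proof (rule eventually_mono)
          fix h assume hh: "0 < h \<and> h < \<epsilon> \<and> x \<in> ball z (4 * \<epsilon>) \<longrightarrow> u (x + h *\<^sub>R ?e) - u x = line_int (p i) i h x"
          show "?eq h"
          proof (cases "h \<in> {0<..<\<epsilon>}")
            case True
            then have "u (x + h *\<^sub>R ?e) - u x = (LBINT r. indicator {0..h} r * P r)" using hh x4 by (simp add: Veq)
            then show ?thesis
              unfolding De \<eta>1 using \<gamma> Dp[of h] True by (subst ennreal_mult[symmetric]) (auto simp: ac_simps)
          qed simp
        qed
      qed
      finally show "ennreal (\<kappa> * p i x powr (qp i + \<gamma>)) \<le>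
     difference_energy i \<gamma> z \<epsilon> x" .
    qed
  qed
  then show ?thesis using \<kappa> \<Lambda> by blast
qed

text \<open>The pointwise gain is integrated over the set where p_i is large; where it lies between
  0 and \<open>\<Lambda>\<close> the integrand is bounded. The power \<open>qp i + \<gamma>\<close>
  of p_i is the power \<open>1 + b'\<close> of \<open>p i x powr qp i\<close>, hence the new
  exponent for the energy density.\<close>

lemma higher_integrability_pos:
  fixes z :: "real ^ 'n" and i :: 'n
  assumes b: "b \<ge> 0" and LI: "local_int b" and z: "z \<in> \<Omega>"
  shows "\<exists>d>0. (\<integral>\<^sup>+x. ennreal (indicator (ball z d) x * (if p i x \<ge> 0 then (1 + f i (p i x)) powr (1 + (b + 1 / (2 * Q))) else 0)) \<partial>lborel) < \<infinity>"
proof -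
  obtain d0 where d0: "d0 > 0" "cball z d0 \<subseteq> \<Omega>" using open_\<Omega> z by (auto simp: open_contains_cball)
  define \<epsilon> where "\<epsilon> = d0 / 5"
  have \<epsilon>: "\<epsilon> > 0" "cball z (5 * \<epsilon>) \<subseteq> \<Omega>" using d0 by (auto simp: \<epsilon>_def)
  \<comment> \<open>The reserve \<open>1 / Q\<close> is shared equally: one half raises
    \<open>b\<close>, the other becomes \<open>e\<close>, the margin for the integral over the
    scales. Since \<open>qp i \<le> Q\<close>, this \<open>e\<close> is at most 1.\<close>
  define b' where "b' = b + 1 / (2 * Q)"
  define \<gamma> where "\<gamma> = qp i * b'"
  define e where "e = qp i / (2 * Q)"
  have \<gamma>: "\<gamma> > 0" "e > 0" "e \<le> 1" "\<gamma> + e = qp i * (b + 1 / Q)"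
  proof -
    have "b' > 0" using b Q_gt_1 by (simp add: b'_def add_nonneg_pos)
    then show "\<gamma> > 0" using q(1)[of i] by (simp add: \<gamma>_def)
    show "e > 0" "e \<le> 1" using q(1,3)[of i] Q_gt_1 by (auto simp: e_def)
    show "\<gamma> + e = qp i * (b + 1 / Q)" using Q_gt_1 by (simp add: \<gamma>_def e_def b'_def field_simps)
  qed
  obtain \<kappa> \<Lambda> where \<kappa>: "\<kappa> > 0" "\<Lambda> > 0" and gain: "AE x in lborel. x \<in> ball z \<epsilon> \<longrightarrow> \<Lambda> \<le> p i x \<longrightarrow>
     ennreal (\<kappa> * p i x powr (qp i + \<gamma>)) \<le>
     difference_energy i \<gamma> z \<epsilon> x"
    using pointwise_gain[OF \<epsilon> \<gamma>(1), of i] by blast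
  obtain C4 where C4: "C4 \<ge> 0" "\<And>t. t \<ge> 0 \<Longrightarrow> f i t \<le> C4 * (1 + t powr qp i)"
    using power_growth_compare[OF f_C1 f_growth q(1)] by blast
  define g where "g x = indicator (ball z \<epsilon>) x * (if \<Lambda> \<le> p i x then \<kappa> * p i x powr (qp i + \<gamma>) else 0)" for x
  have [measurable]: "ball z \<epsilon> \<in> sets borel" by simp
  have [measurable]: "g \<in> borel_measurable borel" unfolding g_def by measurable
  have "(\<integral>\<^sup>+x. ennreal (g x) \<partial>lborel) \<le> (\<integral>\<^sup>+x. difference_energy i \<gamma> z \<epsilon> x \<partial>lborel)"
  proof (rule nn_integral_mono_AE)
    show "AE x in lborel. ennreal (g x) \<le> difference_energy i \<gamma> z \<epsilon> x"
      using gain by (rule eventually_mono) (auto simp: g_def indicator_def)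
  qed
  also have "\<dots> < \<infinity>" by (rule difference_energy_finite[OF \<epsilon> b LI \<gamma>])
  finally have gfin: "(\<integral>\<^sup>+x. ennreal (g x) \<partial>lborel) < \<infinity>" .
  define B where "B = (1 + 2 * C4) powr (1 + b')"
  have b': "1 + b' > 0" using b Q_gt_1 by (simp add: b'_def add_nonneg_pos)
  have pt: "(1 + f i t) powr (1 + b') \<le> B * (1 + t powr (qp i + \<gamma>))" if t: "t \<ge> 0" for t
  proof -
    define m where "m = max 1 (t powr qp i)"
    have m: "m \<ge> 1" "t powr qp i \<le> m" by (auto simp: m_def)
    have "1 + f i t \<le> 1 + C4 * (1 + t powr qp i)" using C4(2)[OF t] by simp
    also have "\<dots> \<le> m + C4 * (m + m)" using m C4 by (intro add_mono mult_left_mono) auto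
    also have "\<dots> = (1 + 2 * C4) * m" by (simp add: algebra_simps)
    finally have "(1 + f i t) powr (1 + b') \<le> ((1 + 2 * C4) * m) powr (1 + b')"
      using f_nonneg[of i t] b' by (intro powr_mono2) auto
    also have "\<dots> = B * m powr (1 + b')" using m C4 by (simp add: B_def powr_mult)
    also have "m powr (1 + b') \<le> 1 + t powr (qp i + \<gamma>)"
    proof (cases "t powr qp i \<le> 1")
      case True then show ?thesis by (simp add: m_def)
    next
      case False
      then have "m powr (1 + b') = t powr (qp i * (1 + b'))" by (simp add: m_def powr_powr)
      also have "qp i * (1 + b') = qp i + \<gamma>" by (simp add: \<gamma>_def algebra_simps)
      finally show ?thesis by simp
    qed
    finally show ?thesis by (simp add: B_def mult_left_mono)
  qed
  have B0: "B \<ge> 0" by (simp add: B_def)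
  \<comment> \<open>Bounds the integrand where p_i is at most \<open>\<Lambda>\<close>, and also
    absorbs the constant summand where it is larger.\<close>
  define B2 where "B2 = B * (1 + \<Lambda> powr (qp i + \<gamma>))"
  have B20: "B2 \<ge> 0" using B0 by (simp add: B2_def)
  have "(\<integral>\<^sup>+x. ennreal (indicator (ball z \<epsilon>) x * (if p i x \<ge> 0 then (1 + f i (p i x)) powr (1 + b') else 0)) \<partial>lborel)
     \<le> (\<integral>\<^sup>+x. ennreal B2 * indicator (ball z \<epsilon>) x + ennreal (B / \<kappa>) * ennreal (g x) \<partial>lborel)"
  proof (rule nn_integral_mono)
    fix x
    have "(1 + f i (p i x)) powr (1 + b') \<le> B2 + B / \<kappa> * (if \<Lambda> \<le> p i x then \<kappa> * p i x powr (qp i + \<gamma>) else 0)" if "p i x \<ge> 0"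
    proof (cases "\<Lambda> \<le> p i x")
      case True
      have "(1 + f i (p i x)) powr (1 + b') \<le> B * (1 + p i x powr (qp i + \<gamma>))" by (rule pt[OF that])
      also have "\<dots> \<le> B2 + B * p i x powr (qp i + \<gamma>)" using B0 by (simp add: B2_def algebra_simps)
      finally show ?thesis using True \<kappa> by simp
    next
      case False
      have "p i x powr (qp i + \<gamma>) \<le> \<Lambda> powr (qp i + \<gamma>)" using False that q(1)[of i] \<gamma> by (intro powr_mono2) auto
      then have "B * (1 + p i x powr (qp i + \<gamma>)) \<le> B2" unfolding B2_def using B0 by (intro mult_left_mono) auto
      then show ?thesis using pt[OF that] False by simp
    qed
    then have "indicator (ball z \<epsilon>) x * (if p i x \<ge> 0 then (1 + f i (p i x)) powr (1 + b') else 0) \<le> B2 * indicator (ball z \<epsilon>) x + B / \<kappa> * g x"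
      using B20 B0 \<kappa> by (auto simp: g_def indicator_def)
    then have "ennreal (indicator (ball z \<epsilon>) x * (if p i x \<ge> 0 then (1 + f i (p i x)) powr (1 + b') else 0)) \<le> ennreal (B2 * indicator (ball z \<epsilon>) x + B / \<kappa> * g x)"
      by (rule ennreal_leI)
    also have "\<dots> = ennreal B2 * indicator (ball z \<epsilon>) x + ennreal (B / \<kappa>) * ennreal (g x)"
    proof -
      have g0: "g x \<ge> 0" using \<kappa> by (simp add: g_def)
      have "ennreal (B2 * indicator (ball z \<epsilon>) x + B / \<kappa> * g x) = ennreal (B2 * indicator (ball z \<epsilon>) x) + ennreal (B / \<kappa> * g x)"
        using B20 B0 \<kappa> g0 by (intro ennreal_plus) auto
      also have "ennreal (B / \<kappa> * g x) = ennreal (B / \<kappa>) * ennreal (g x)"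
        using B0 \<kappa> g0 by (intro ennreal_mult) auto
      also have "ennreal (B2 * indicator (ball z \<epsilon>) x) = ennreal B2 * indicator (ball z \<epsilon>) x"
        by (simp add: indicator_def)
      finally show ?thesis .
    qed
    finally show "ennreal (indicator (ball z \<epsilon>) x * (if p i x \<ge> 0 then (1 + f i (p i x)) powr (1 + b') else 0)) \<le> ennreal B2 * indicator (ball z \<epsilon>) x + ennreal (B / \<kappa>) * ennreal (g x)" .
  qed
  also have "\<dots> = ennreal B2 * emeasure lborel (ball z \<epsilon>) + ennreal (B / \<kappa>) * (\<integral>\<^sup>+x. ennreal (g x) \<partial>lborel)"
    by (simp add: nn_integral_add nn_integral_cmult)
  also have "\<dots> < \<infinity>"
    using gfin emeasure_bounded_finite[OF bounded_ball, of z \<epsilon>] by (simp add: ennreal_mult_less_top)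
  finally show ?thesis using \<epsilon> unfolding b'_def by blast
qed

end

text \<open>Changing the sign of \<open>u\<close> exchanges the two half-lines and preserves
  minimality, so an estimate on the set where p_i is nonnegative transfers to the set where it is
  nonpositive.\<close>

lemma (in split_minimizer) reflect:
  "split_minimizer \<Omega> (\<lambda>j t. f j (- t)) (\<lambda>j t. - f' j (- t)) qm qp Q M (\<lambda>x. - u x) (\<lambda>j x. - p j x) \<zeta>"
proof unfold_locales
  show "split_energy \<Omega> (\<lambda>j t. f j (- t)) (\<lambda>j x. - p j x) < \<infinity>"
    using energy_finite by (simp add: split_energy_def)
  fix \<phi> \<psi>
  assume adm: "admissible_variation \<Omega> \<phi> \<psi>" and fin: "split_energy \<Omega> (\<lambda>j t. f j (- t)) (\<lambda>j x. - p j x + \<psi> j x) < \<infinity>"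
  have adm': "admissible_variation \<Omega> (\<lambda>x. (- 1) * \<phi> x) (\<lambda>j x. (- 1) * \<psi> j x)"
    by (rule admissible_variation_scale[OF adm])
  have eq: "split_energy \<Omega> (\<lambda>j t. f j (- t)) (\<lambda>j x. - p j x + \<psi> j x) = split_energy \<Omega> f (\<lambda>j x. p j x + (- 1) * \<psi> j x)"
    by (simp add: split_energy_def)
  show "split_energy \<Omega> (\<lambda>j t. f j (- t)) (\<lambda>j x. - p j x) \<le> split_energy \<Omega> (\<lambda>j t. f j (- t)) (\<lambda>j x. - p j x + \<psi> j x)"
    using minimal[OF adm'] fin unfolding eq by (simp add: split_energy_def)
next
  show "weak_pd \<Omega> (\<lambda>x. - u x) (\<lambda>x. - p j x) j" for j
    using p_weak[of j] by (simp add: weak_pd_def)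
qed (use open_\<Omega> bump q u_int u_bound p_int convex_C1_reflect[OF f_C1] power_growth_reflect[OF f_growth] in auto)

section \<open>Iteration of the gain\<close>

context split_minimizer
begin

text \<open>The one-sided estimate is applied to the minimizer and to its reflection; finitely many
  of the resulting balls cover a compact set.\<close>

lemma local_int_step:
  assumes b: "b \<ge> 0" and LI: "local_int b"
  shows "local_int (b + 1 / (2 * Q))"
proof -
  interpret R: split_minimizer \<Omega> "\<lambda>j t. f j (- t)" "\<lambda>j t. - f' j (- t)" qm qp Q M "\<lambda>x. - u x" "\<lambda>j x. - p j x" \<zeta>
    by (rule reflect)
  have LIR: "R.local_int b" using LI unfolding local_int_def R.local_int_def by simp
  define g where "g j x = (1 + f j (p j x)) powr (1 + (b + 1 / (2 * Q)))" for j x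
  have [measurable]: "g j \<in> borel_measurable borel" for j unfolding g_def by measurable
  have g0: "g j x \<ge> 0" for j x by (simp add: g_def)
  have loc: "\<exists>d>0. (\<integral>\<^sup>+x. ennreal (indicator (ball z d) x * g j x) \<partial>lborel) < \<infinity>" if z: "z \<in> \<Omega>" for z j
  proof -
    obtain d1 where d1: "d1 > 0" "(\<integral>\<^sup>+x. ennreal (indicator (ball z d1) x * (if p j x \<ge> 0 then g j x else 0)) \<partial>lborel) < \<infinity>"
      using higher_integrability_pos[OF b LI z, of j] unfolding g_def by blast
    obtain d2 where d2: "d2 > 0" "(\<integral>\<^sup>+x. ennreal (indicator (ball z d2) x * (if - p j x \<ge> 0 then g j x else 0)) \<partial>lborel) < \<infinity>"
      using R.higher_integrability_pos[OF b LIR z, of j] unfolding g_def by (simp only: minus_minus) blast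
    define d where "d = min d1 d2"
    have [measurable]: "ball z d1 \<in> sets borel" "ball z d2 \<in> sets borel" by simp_all
    have "(\<integral>\<^sup>+x. ennreal (indicator (ball z d) x * g j x) \<partial>lborel)
      \<le> (\<integral>\<^sup>+x. ennreal (indicator (ball z d1) x * (if p j x \<ge> 0 then g j x else 0)) + ennreal (indicator (ball z d2) x * (if - p j x \<ge> 0 then g j x else 0)) \<partial>lborel)"
    proof (rule nn_integral_mono)
      fix x
      show "ennreal (indicator (ball z d) x * g j x) \<le> ennreal (indicator (ball z d1) x * (if p j x \<ge> 0 then g j x else 0)) + ennreal (indicator (ball z d2) x * (if - p j x \<ge> 0 then g j x else 0))"
      proof (cases "x \<in> ball z d")
        case True
        then have "x \<in> ball z d1" "x \<in> ball z d2" by (auto simp: d_def)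
        moreover have "indicator (ball z d) x = (1 :: real)" using True by simp
        ultimately show ?thesis by (cases "p j x \<ge> 0") (auto simp: add_increasing2)
      qed simp
    qed
    also have "\<dots> = (\<integral>\<^sup>+x. ennreal (indicator (ball z d1) x * (if p j x \<ge> 0 then g j x else 0)) \<partial>lborel) + (\<integral>\<^sup>+x. ennreal (indicator (ball z d2) x * (if - p j x \<ge> 0 then g j x else 0)) \<partial>lborel)"
      by (rule nn_integral_add) measurable
    also have "\<dots> < \<infinity>" using d1 d2 by simp
    finally show ?thesis using d1 d2 by (intro exI[of _ d]) (auto simp: d_def)
  qed
  show ?thesis
    unfolding local_int_def g_def[symmetric]
  proof (intro allI impI)
    fix K j assume K: "compact K" "K \<subseteq> \<Omega>"
    obtain d where d: "\<And>z. z \<in> \<Omega> \<Longrightarrow> d z > 0 \<and> (\<integral>\<^sup>+x. ennreal (indicator (ball z (d z)) x * g j x) \<partial>lborel) < \<infinity>"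
      using loc[of _ j] by metis
    obtain F where F: "F \<subseteq> K" "finite F" "K \<subseteq> (\<Union>z\<in>F. ball z (d z))"
      using compactE_image[OF K(1), of K "\<lambda>z. ball z (d z)"] d K(2) by force
    have "(\<integral>\<^sup>+x. ennreal (indicator K x * g j x) \<partial>lborel) \<le> (\<integral>\<^sup>+x. (\<Sum>z\<in>F. ennreal (indicator (ball z (d z)) x * g j x)) \<partial>lborel)"
    proof (rule nn_integral_mono)
      fix x
      show "ennreal (indicator K x * g j x) \<le> (\<Sum>z\<in>F. ennreal (indicator (ball z (d z)) x * g j x))"
      proof (cases "x \<in> K")
        case True
        then obtain z where z: "z \<in> F" "x \<in> ball z (d z)" using F by blast
        have "ennreal (indicator K x * g j x) = ennreal (indicator (ball z (d z)) x * g j x)" using True z by simp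
        also have "\<dots> \<le> (\<Sum>z\<in>F. ennreal (indicator (ball z (d z)) x * g j x))" by (rule member_le_sum[OF z(1)]) (use F in auto)
        finally show ?thesis .
      qed simp
    qed
    also have "\<dots> = (\<Sum>z\<in>F. \<integral>\<^sup>+x. ennreal (indicator (ball z (d z)) x * g j x) \<partial>lborel)"
    proof (rule nn_integral_sum)
      fix z assume "z \<in> F"
      have [measurable]: "ball z (d z) \<in> sets borel" by simp
      show "(\<lambda>x. ennreal (indicator (ball z (d z)) x * g j x)) \<in> borel_measurable lborel" by simp
    qed
    also have "\<dots> < \<infinity>" using F K d by (auto simp: subset_iff)
    finally show "(\<integral>\<^sup>+x. ennreal (indicator K x * g j x) \<partial>lborel) < \<infinity>" .
  qed
qed

text \<open>The iteration starts from the finiteness of the energy.\<close>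

lemma local_int_0: "local_int 0"
  unfolding local_int_def
proof (intro allI impI)
  fix K j assume K: "compact K" "K \<subseteq> \<Omega>"
  have [measurable]: "K \<in> sets borel" using K by (simp add: borel_compact)
  have "integrable lborel (\<lambda>x. indicator K x + indicator K x * f j (p j x))"
    using K by (intro Bochner_Integration.integrable_add f_integrable_subset integrable_indicator_compact) auto
  then have "(\<integral>\<^sup>+x. ennreal (norm (indicator K x + indicator K x * f j (p j x))) \<partial>lborel) < \<infinity>"
    by (simp add: integrable_iff_bounded)
  moreover have "norm (indicator K x + indicator K x * f j (p j x)) = indicator K x * (1 + f j (p j x)) powr (1 + 0)" for x
    using f_nonneg[of j "p j x"] by (simp add: indicator_def)
  ultimately show "(\<integral>\<^sup>+x. ennreal (indicator K x * (1 + f j (p j x)) powr (1 + 0)) \<partial>lborel) < \<infinity>" by simp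
qed

text \<open>The gain is the same at every stage, so finitely many steps reach any prescribed
  exponent.\<close>

lemma local_int_multiple: "local_int (real k / (2 * Q))"
proof (induction k)
  case (Suc k)
  have "local_int (real k / (2 * Q) + 1 / (2 * Q))"
    using Q_gt_1 by (intro local_int_step Suc) auto
  then show ?case by (simp add: add_divide_distrib add.commute)
qed (simp add: local_int_0)

end

section \<open>Local minimizers\<close>

text \<open>Functions on \<open>\<Omega>\<close> that are measurable for the completed measure are
  exchanged for Borel functions on the whole space, extended by zero up to a null set, for which
  translations and product measures are convenient.\<close>

lemma borel_version:
  fixes h :: "real ^ 'n \<Rightarrow> real"
  assumes \<Omega>: "\<Omega> \<in> sets borel" and h: "h \<in> borel_measurable (lebesgue_on \<Omega>)"
  obtains h' where "h' \<in> borel_measurable borel" "AE x in lborel. h' x = indicator \<Omega> x * h x"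
proof -
  have "(\<lambda>x. indicator \<Omega> x * h x) \<in> borel_measurable lebesgue"
    using h \<Omega> by (subst (asm) borel_measurable_restrict_space_iff) auto
  from completion_ex_borel_measurable_real[OF this] show ?thesis using that by (auto simp: eq_commute)
qed

lemma LINT_lebesgue_on_eq:
  fixes F F' :: "real ^ 'n \<Rightarrow> real"
  assumes \<Omega>: "\<Omega> \<in> sets borel" and F: "F \<in> borel_measurable (lebesgue_on \<Omega>)"
    and F': "F' \<in> borel_measurable borel" and eq: "AE x in lborel. F' x = indicator \<Omega> x * F x"
  shows "(LINT x|lebesgue_on \<Omega>. F x) = (LBINT x. F' x)"
    and "integrable (lebesgue_on \<Omega>) F \<longleftrightarrow> integrable lborel F'"
proof -
  have [measurable]: "(\<lambda>x. indicator \<Omega> x * F x) \<in> borel_measurable lebesgue"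
    using F \<Omega> by (subst (asm) borel_measurable_restrict_space_iff) auto
  have F'2: "F' \<in> borel_measurable lebesgue" using F' by (simp add: measurable_completion)
  have eq2: "AE x in lebesgue. indicator \<Omega> x * F x = F' x"
    using AE_completion[OF eq] by (auto elim!: eventually_mono)
  have "(LINT x|lebesgue_on \<Omega>. F x) = (\<integral>x. indicator \<Omega> x * F x \<partial>lebesgue)"
    using \<Omega> by (subst integral_restrict_space) auto
  also have "\<dots> = (\<integral>x. F' x \<partial>lebesgue)" using eq2 F'2 by (intro integral_cong_AE) auto
  also have "\<dots> = (LBINT x. F' x)" using F' by (intro integral_completion) auto
  finally show "(LINT x|lebesgue_on \<Omega>. F x) = (LBINT x. F' x)" .
  have "integrable (lebesgue_on \<Omega>) F \<longleftrightarrow> integrable lebesgue (\<lambda>x. indicator \<Omega> x * F x)"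
    using \<Omega> by (subst integrable_restrict_space) auto
  also have "\<dots> \<longleftrightarrow> integrable lebesgue F'" using eq2 F'2 by (intro integrable_cong_AE) auto
  also have "\<dots> \<longleftrightarrow> integrable lborel F'" using F' by (intro integrable_completion) auto
  finally show "integrable (lebesgue_on \<Omega>) F \<longleftrightarrow> integrable lborel F'" .
qed

lemma borel_measurable_lebesgue_onI: "g \<in> borel_measurable borel \<Longrightarrow> g \<in> borel_measurable (lebesgue_on \<Omega>)"
  by (intro measurable_restrict_space1 measurable_completion) simp

lemma integrable_vec_nth: "integrable M g \<Longrightarrow> integrable M (\<lambda>x. g x $ j :: real)"
  by (rule integrable_bounded_linear[OF bounded_linear_vec_nth])

lemma integrable_vec_lambda:
  fixes \<psi> :: "'n::finite \<Rightarrow> 'a \<Rightarrow> real"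
  assumes "\<And>j. integrable M (\<psi> j)"
  shows "integrable M (\<lambda>x. \<chi> j. \<psi> j x)"
proof -
  have "(\<lambda>x. \<chi> j. \<psi> j x) = (\<lambda>x. \<Sum>j\<in>UNIV. \<psi> j x *\<^sub>R axis j 1)"
  proof
    fix x
    show "(\<chi> j. \<psi> j x) = (\<Sum>j\<in>UNIV. \<psi> j x *\<^sub>R axis j 1)"
      using basis_expansion[of "\<chi> j. \<psi> j x"] by (simp add: scalar_mult_eq_scaleR)
  qed
  then show ?thesis using assms by simp
qed

text \<open>The difference of two weak gradients is orthogonal to all test functions. Uniqueness
  ties \<open>weak_grad\<close>, which is an arbitrary choice, to gradients that are constructed
  explicitly.\<close>

lemma weak_gradient_unique:
  fixes \<zeta> w :: "real ^ 'n \<Rightarrow> real"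
  assumes \<zeta>: "std_bump \<zeta>" and \<Omega>: "open \<Omega>"
    and g1: "has_L1_weak_gradient \<Omega> w g1" and g2: "has_L1_weak_gradient \<Omega> w g2"
  shows "AE x in lborel. x \<in> \<Omega> \<longrightarrow> (\<forall>j. g1 x $ j = g2 x $ j)"
proof -
  have \<Omega>b: "\<Omega> \<in> sets borel" using \<Omega> by simp
  have i: "integrable (lebesgue_on \<Omega>) (\<lambda>x. g1 x $ j)" "integrable (lebesgue_on \<Omega>) (\<lambda>x. g2 x $ j)" for j
    using g1 g2 by (auto simp: has_L1_weak_gradient_def intro: integrable_vec_nth)
  have "AE x in lborel. x \<in> \<Omega> \<longrightarrow> g1 x $ j = g2 x $ j" for j
  proof -
    let ?d = "\<lambda>x. g1 x $ j - g2 x $ j"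
    have di: "integrable (lebesgue_on \<Omega>) ?d" using i by simp
    then have dm: "?d \<in> borel_measurable (lebesgue_on \<Omega>)" by auto
    obtain d where d[measurable]: "d \<in> borel_measurable borel" and de: "AE x in lborel. d x = indicator \<Omega> x * ?d x"
      by (rule borel_version[OF \<Omega>b dm])
    have "integrable lborel d" using LINT_lebesgue_on_eq(2)[OF \<Omega>b dm d de] di by simp
    then have "AE x in lborel. x \<in> \<Omega> \<longrightarrow> d x = 0"
    proof (rule fundamental_lemma_calculus_of_variations[OF \<zeta> _ \<Omega>])
      fix \<phi> assume \<phi>: "\<phi> \<in> test_functions \<Omega>"
      have \<phi>m[measurable]: "\<phi> \<in> borel_measurable borel"
        by (rule test_function_borel[OF \<phi>])
      have \<phi>m2: "\<phi> \<in> borel_measurable (lebesgue_on \<Omega>)" by (rule borel_measurable_lebesgue_onI[OF \<phi>m])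
      obtain C where C: "\<And>x. \<bar>\<phi> x\<bar> \<le> C" using test_function_bounded[OF \<phi>] by metis
      have ib: "integrable (lebesgue_on \<Omega>) (\<lambda>x. h x * \<phi> x)" if "integrable (lebesgue_on \<Omega>) h" for h :: "real ^ 'n \<Rightarrow> real"
      proof (rule Bochner_Integration.integrable_bound[OF integrable_mult_left[OF that, of C]])
        show "AE x in lebesgue_on \<Omega>. norm (h x * \<phi> x) \<le> norm (h x * C)"
          using C by (intro AE_I2) (auto simp: abs_mult intro!: mult_left_mono intro: order_trans[OF _ abs_ge_self])
      qed (use that \<phi>m2 in auto)
      have "(LBINT x. d x * \<phi> x) = (LINT x|lebesgue_on \<Omega>. ?d x * \<phi> x)"
      proof (rule LINT_lebesgue_on_eq(1)[symmetric, OF \<Omega>b])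
        show "(\<lambda>x. ?d x * \<phi> x) \<in> borel_measurable (lebesgue_on \<Omega>)" using dm \<phi>m2 by simp
        show "AE x in lborel. d x * \<phi> x = indicator \<Omega> x * (?d x * \<phi> x)" using de by (rule eventually_mono) simp
      qed simp
      also have "\<dots> = (LINT x|lebesgue_on \<Omega>. g1 x $ j * \<phi> x) - (LINT x|lebesgue_on \<Omega>. g2 x $ j * \<phi> x)"
        using ib[OF i(1)] ib[OF i(2)] by (simp add: left_diff_distrib)
      also have "\<dots> = 0"
      proof -
        have "(LINT x|lebesgue_on \<Omega>. w x * grad \<phi> x $ j) = - (LINT x|lebesgue_on \<Omega>. g1 x $ j * \<phi> x)"
          "(LINT x|lebesgue_on \<Omega>. w x * grad \<phi> x $ j) = - (LINT x|lebesgue_on \<Omega>. g2 x $ j * \<phi> x)"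
          using g1 g2 \<phi> unfolding has_L1_weak_gradient_def by blast+
        then show ?thesis by linarith
      qed
      finally show "(LBINT x. d x * \<phi> x) = 0" .
    qed
    with de show ?thesis by eventually_elim auto
  qed
  then have "AE x in lborel. \<forall>j. x \<in> \<Omega> \<longrightarrow> g1 x $ j = g2 x $ j" by (subst AE_all_countable) blast
  then show ?thesis by (rule eventually_mono) auto
qed

lemma weak_grad_works: "w \<in> W11 \<Omega> \<Longrightarrow> has_L1_weak_gradient \<Omega> w (weak_grad \<Omega> w)"
  unfolding W11_def weak_grad_def by (auto intro: someI[of "has_L1_weak_gradient \<Omega> w"])

lemma J_energy_eq_split_energy:
  assumes "AE x in lborel. x \<in> \<Omega> \<longrightarrow> (\<forall>j. weak_grad \<Omega> w x $ j = P j x)"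
  shows "J_energy \<Omega> f w = split_energy \<Omega> f P"
proof -
  have "J_energy \<Omega> f w = (\<integral>\<^sup>+x. ennreal (\<Sum>i\<in>UNIV. f i (weak_grad \<Omega> w x $ i)) * indicator \<Omega> x \<partial>lborel)"
    unfolding J_energy_def by (rule nn_integral_completion)
  also have "\<dots> = split_energy \<Omega> f P"
    unfolding split_energy_def
    by (rule nn_integral_cong_AE) (use assms in \<open>auto elim!: eventually_mono simp: indicator_def\<close>)
  finally show ?thesis .
qed

lemma ess_support_subset:
  assumes "closed K" "\<And>x. x \<notin> K \<Longrightarrow> v x = 0"
  shows "ess_support \<Omega> v \<subseteq> K"
proof
  fix x assume x: "x \<in> ess_support \<Omega> v"
  show "x \<in> K"
  proof (rule ccontr)
    assume "x \<notin> K"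
    then obtain e where e: "e > 0" "ball x e \<subseteq> - K"
      using assms(1) open_contains_ball[of "- K"] by (auto simp: open_Compl)
    have "AE y in lebesgue_on (\<Omega> \<inter> ball x e). v y = 0"
      by (rule AE_I2) (use e assms(2) in \<open>auto simp: space_restrict_space\<close>)
    then show False using x e(1) by (auto simp: ess_support_def)
  qed
qed

section \<open>From the growth hypotheses to \<open>power_growth\<close> and
  \<open>convex_C1\<close>\<close>

lemma power_growth_Gam:
  assumes "\<exists>c4>0. \<exists>c5>0. \<forall>\<^sub>F t in at_infinity.
        (t < 0 \<longrightarrow> c4 * Gam \<bar>t\<bar> powr (qm / 2) \<le> f t \<and> f t \<le> c5 * Gam \<bar>t\<bar> powr (qm / 2)) \<and>
        (t \<ge> 0 \<longrightarrow> c4 * Gam \<bar>t\<bar> powr (qp / 2) \<le> f t \<and> f t \<le> c5 * Gam \<bar>t\<bar> powr (qp / 2))"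
    and q: "qp > 1" "qm > 1"
  shows "power_growth f qp qm"
proof -
  obtain c4 c5 B where c: "c4 > 0" "c5 > 0"
    and neg: "\<And>t. \<bar>t\<bar> \<ge> B \<Longrightarrow> t < 0 \<Longrightarrow> c4 * Gam \<bar>t\<bar> powr (qm / 2) \<le> f t \<and> f t \<le> c5 * Gam \<bar>t\<bar> powr (qm / 2)"
    and pos: "\<And>t. \<bar>t\<bar> \<ge> B \<Longrightarrow> t \<ge> 0 \<Longrightarrow> c4 * Gam \<bar>t\<bar> powr (qp / 2) \<le> f t \<and> f t \<le> c5 * Gam \<bar>t\<bar> powr (qp / 2)"
    using assms(1) unfolding eventually_at_infinity real_norm_def by metis
  \<comment> \<open>For \<open>t \<ge> 1\<close> the value \<open>Gam t\<close> lies between the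
    square of \<open>t\<close> and twice that square, so powers of \<open>Gam\<close> and of
    \<open>t\<close> agree up to constants.\<close>
  have G: "t powr q \<le> Gam \<bar>t\<bar> powr (q / 2)" "Gam \<bar>t\<bar> powr (q / 2) \<le> 2 powr (q / 2) * t powr q" if t: "t \<ge> 1" "q > 0" for t q :: real
  proof -
    have e: "t powr q = (t\<^sup>2) powr (q / 2)" using t by (simp add: powr_powr flip: powr_numeral)
    show "t powr q \<le> Gam \<bar>t\<bar> powr (q / 2)" unfolding e Gam_def using t by (intro powr_mono2) auto
    have "1 + \<bar>t\<bar>\<^sup>2 \<le> 2 * t\<^sup>2" using t by (simp add: one_le_power)
    then have "Gam \<bar>t\<bar> powr (q / 2) \<le> (2 * t\<^sup>2) powr (q / 2)" unfolding Gam_def using t by (intro powr_mono2) auto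
    then show "Gam \<bar>t\<bar> powr (q / 2) \<le> 2 powr (q / 2) * t powr q" unfolding e by (simp add: powr_mult)
  qed
  define T where "T = max 1 B"
  define C where "C = c5 * (2 powr (qp / 2) + 2 powr (qm / 2))"
  have C: "C > 0" using c by (simp add: C_def add_pos_pos)
  have CG: "c5 * Gam \<bar>t\<bar> powr (q / 2) \<le> C * t powr q" if "t \<ge> 1" "q = qp \<or> q = qm" for t q
  proof -
    have "Gam \<bar>t\<bar> powr (q / 2) \<le> 2 powr (q / 2) * t powr q" using that assms(2,3) by (intro G(2)) auto
    also have "\<dots> \<le> (2 powr (qp / 2) + 2 powr (qm / 2)) * t powr q" using that(2) by (intro mult_right_mono) auto
    finally show ?thesis using c by (simp add: C_def mult.assoc)
  qed
  have "c4 * t powr qp \<le> f t \<and> f t \<le> C * t powr qp" if t: "t \<ge> T" for t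
  proof -
    have t1: "t \<ge> 1" "\<bar>t\<bar> \<ge> B" "t \<ge> 0" using t by (auto simp: T_def)
    have "c4 * t powr qp \<le> c4 * Gam \<bar>t\<bar> powr (qp / 2)" using G(1)[OF t1(1), of qp] q c by simp
    then show ?thesis using pos[OF t1(2,3)] CG[OF t1(1), of qp] by auto
  qed
  moreover have "c4 * t powr qm \<le> f (- t) \<and> f (- t) \<le> C * t powr qm" if t: "t \<ge> T" for t
  proof -
    have t1: "t \<ge> 1" "\<bar>- t\<bar> \<ge> B" "- t < 0" using t by (auto simp: T_def)
    have "c4 * t powr qm \<le> c4 * Gam \<bar>t\<bar> powr (qm / 2)" using G(1)[OF t1(1), of qm] q c by simp
    then show ?thesis using neg[OF t1(2,3)] CG[OF t1(1), of qm] by auto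
  qed
  moreover have "T \<ge> 1" by (simp add: T_def)
  ultimately show ?thesis unfolding power_growth_def using c(1) C by blast
qed

lemma convex_C1_deriv:
  fixes f :: "real \<Rightarrow> real"
  assumes "\<And>t. f t \<ge> 0" "\<And>t. f differentiable (at t)" "\<And>t. deriv f differentiable (at t)" "\<And>t. deriv (deriv f) t > 0"
  shows "convex_C1 f (deriv f)"
  unfolding convex_C1_def
proof (intro conjI allI)
  show "(f has_real_derivative deriv f t) (at t)" for t using assms(2) by (simp add: DERIV_deriv_iff_real_differentiable)
  have D: "(deriv f has_real_derivative deriv (deriv f) t) (at t)" for t using assms(3) by (simp add: DERIV_deriv_iff_real_differentiable)
  then show "continuous_on UNIV (deriv f)"
    using DERIV_isCont continuous_at_imp_continuous_on by blast
  show "mono (deriv f)"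
  proof
    fix x y :: real assume "x \<le> y"
    then show "deriv f x \<le> deriv f y"
      by (rule DERIV_nonneg_imp_nondecreasing) (use D assms(4) less_imp_le in blast)
  qed
qed (use assms in auto)

text \<open>Exponents above 1 force at least linear growth: |t| is bounded by a multiple of 1 + f t,
  and the factor \<open>Gam\<close> costs two further powers. This determines the exponent that the
  iteration has to reach.\<close>

lemma Gam_le_growth:
  assumes f: "convex_C1 f f'" and g: "power_growth f qp qm" and q: "1 < qp" "1 < qm"
  shows "\<exists>C\<ge>0. \<forall>t. f t * Gam \<bar>t\<bar> \<le> C * (1 + f t) powr 3"
proof -
  have nn: "\<And>t. f t \<ge> 0" using f by (auto simp: convex_C1_def)
  obtain C1 where C1: "C1 \<ge> 0" "\<And>t. t \<ge> 0 \<Longrightarrow> t powr qp \<le> C1 * (1 + f t)"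
    using power_growth_compare[OF f g q(1)] by blast
  obtain C2 where C2: "C2 \<ge> 0" "\<And>t. t \<ge> 0 \<Longrightarrow> t powr qm \<le> C2 * (1 + f (- t))"
    using power_growth_compare[OF convex_C1_reflect[OF f] power_growth_reflect[OF g] q(2)] by blast
  define D where "D = 1 + C1 + C2"
  have D: "D \<ge> 1" using C1 C2 by (simp add: D_def)
  have "\<bar>t\<bar> \<le> D * (1 + f t)" for t
  proof (cases "\<bar>t\<bar> \<le> 1")
    case True
    have "1 * 1 \<le> D * (1 + f t)" using D nn[of t] by (intro mult_mono) auto
    then show ?thesis using True by simp
  next
    case False
    show ?thesis
    proof (cases "t \<ge> 0")
      case True
      then have "t powr 1 \<le> t powr qp" using False q by (intro powr_mono) auto
      also have "\<dots> \<le> C1 * (1 + f t)" by (rule C1(2)[OF True])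
      also have "\<dots> \<le> D * (1 + f t)" using C2 nn[of t] by (intro mult_right_mono) (auto simp: D_def)
      finally show ?thesis using True by simp
    next
      case neg: False
      then have "(- t) powr 1 \<le> (- t) powr qm" using False q by (intro powr_mono) auto
      also have "\<dots> \<le> C2 * (1 + f t)" using C2(2)[of "- t"] neg by simp
      also have "\<dots> \<le> D * (1 + f t)" using C1 nn[of t] by (intro mult_right_mono) (auto simp: D_def)
      finally show ?thesis using neg by simp
    qed
  qed
  then have t2: "t\<^sup>2 \<le> (D * (1 + f t))\<^sup>2" for t using power_mono[of "\<bar>t\<bar>" "D * (1 + f t)" 2] by simp
  have "f t * Gam \<bar>t\<bar> \<le> (1 + D\<^sup>2) * (1 + f t) powr 3" for t
  proof -
    have "1 \<le> (1 + f t)\<^sup>2" using nn[of t] by (simp add: one_le_power)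
    then have "Gam \<bar>t\<bar> \<le> (1 + f t)\<^sup>2 + (D * (1 + f t))\<^sup>2" using t2[of t] by (simp add: Gam_def)
    also have "\<dots> = (1 + D\<^sup>2) * (1 + f t)\<^sup>2" unfolding power_mult_distrib by (simp add: distrib_right)
    finally have "f t * Gam \<bar>t\<bar> \<le> (1 + f t) * ((1 + D\<^sup>2) * (1 + f t)\<^sup>2)"
      using nn[of t] by (intro mult_mono) (auto simp: Gam_def)
    also have "\<dots> = (1 + D\<^sup>2) * (1 + f t) ^ 3" by (simp add: power2_eq_square power3_eq_cube)
    finally show ?thesis using nn[of t] by (simp add: powr_numeral)
  qed
  then show ?thesis by (intro exI[of _ "1 + D\<^sup>2"]) auto
qed

text \<open>Borel representatives of \<open>u\<close> and of its gradient satisfy the abstract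
  assumptions; an admissible variation \<open>\<phi>\<close> corresponds to the competitor
  \<open>u + \<phi>\<close>, which differs from \<open>u\<close> only on a compact subset of
  \<open>\<Omega>\<close>.\<close>

lemma local_minimizer_split_minimizer:
  fixes \<Omega> :: "(real ^ 'n) set"
  assumes \<Omega>: "open \<Omega>" and \<zeta>: "std_bump \<zeta>"
    and f: "\<And>j. convex_C1 (f j) (f' j)" "\<And>j. power_growth (f j) (qp j) (qm j)"
    and q: "\<And>j. 1 < qp j" "\<And>j. 1 < qm j"
    and u: "u \<in> Linfty \<Omega>" "local_minimizer \<Omega> f u"
  obtains Q M v p where "split_minimizer \<Omega> f f' qp qm Q M v p \<zeta>"
    "AE x in lborel. x \<in> \<Omega> \<longrightarrow> (\<forall>j. weak_grad \<Omega> u x $ j = p j x)"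
proof -
  have \<Omega>b[measurable]: "\<Omega> \<in> sets borel" using \<Omega> by simp
  have uE: "u \<in> energy_class \<Omega> f" and uW: "u \<in> W11 \<Omega>" using u(2) by (auto simp: local_minimizer_def energy_class_def)
  define g where "g = weak_grad \<Omega> u"
  have g: "has_L1_weak_gradient \<Omega> u g" unfolding g_def by (rule weak_grad_works[OF uW])
  have ui: "integrable (lebesgue_on \<Omega>) u" using uW by (simp add: W11_def)
  then have um: "u \<in> borel_measurable (lebesgue_on \<Omega>)" by auto
  have gi: "integrable (lebesgue_on \<Omega>) (\<lambda>x. g x $ j)" for j
    using g by (auto simp: has_L1_weak_gradient_def intro: integrable_vec_nth)
  then have gm: "(\<lambda>x. g x $ j) \<in> borel_measurable (lebesgue_on \<Omega>)" for j by auto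
  obtain M0 where M0: "AE x in lebesgue_on \<Omega>. \<bar>u x\<bar> \<le> M0" using u(1) by (auto simp: Linfty_def)
  define M where "M = max M0 0"
  obtain u1 where u1[measurable]: "u1 \<in> borel_measurable borel" and u1e: "AE x in lborel. u1 x = indicator \<Omega> x * u x"
    by (rule borel_version[OF \<Omega>b um])
  \<comment> \<open>Truncation alters \<open>u1\<close> only on a null set and turns the essential
    bound into a bound at every point; \<open>M \<ge> 0\<close> ensures that the value 0 is left
    unchanged.\<close>
  define v where "v x = max (- M) (min M (u1 x))" for x
  have v[measurable]: "v \<in> borel_measurable borel" unfolding v_def by measurable
  have vM: "\<bar>v x\<bar> \<le> M" for x by (auto simp: v_def M_def)
  have M1: "AE x in lborel. x \<in> \<Omega> \<longrightarrow> \<bar>u x\<bar> \<le> M0"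
    using M0 \<Omega>b by (subst (asm) AE_restrict_space_iff) (auto simp: AE_completion_iff)
  have ve: "AE x in lborel. v x = indicator \<Omega> x * u x"
    using M1 u1e by eventually_elim (auto simp: v_def M_def indicator_def split: if_splits)
  have "\<forall>j. \<exists>pj. pj \<in> borel_measurable borel \<and> (AE x in lborel. pj x = indicator \<Omega> x * g x $ j)"
  proof
    fix j
    obtain pj where "pj \<in> borel_measurable borel" "AE x in lborel. pj x = indicator \<Omega> x * g x $ j"
      by (rule borel_version[OF \<Omega>b gm])
    then show "\<exists>pj. pj \<in> borel_measurable borel \<and> (AE x in lborel. pj x = indicator \<Omega> x * g x $ j)" by blast
  qed
  from choice[OF this] obtain p where p[measurable]: "\<And>j. p j \<in> borel_measurable borel"
    and pe: "\<And>j. AE x in lborel. p j x = indicator \<Omega> x * g x $ j"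
    by blast
  have vi: "integrable lborel v" using LINT_lebesgue_on_eq(2)[OF \<Omega>b um v ve] ui by simp
  have pi: "integrable lborel (p j)" for j using LINT_lebesgue_on_eq(2)[OF \<Omega>b gm p pe] gi by simp
  have gp: "AE x in lborel. x \<in> \<Omega> \<longrightarrow> (\<forall>j. g x $ j = p j x)"
  proof -
    have "AE x in lborel. \<forall>j. p j x = indicator \<Omega> x * g x $ j" using pe by (simp add: AE_all_countable)
    then show ?thesis by (rule eventually_mono) auto
  qed
  have Ju: "J_energy \<Omega> f u = split_energy \<Omega> f p" using gp unfolding g_def by (rule J_energy_eq_split_energy)
  have tm: "\<phi> \<in> borel_measurable borel" "(\<lambda>x. grad \<phi> x $ j) \<in> borel_measurable borel" if "\<phi> \<in> test_functions \<Omega>" for \<phi> and j :: 'n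
    by (rule test_function_borel[OF that] test_function_grad_borel[OF that])+
  have eqL: "(LINT x|lebesgue_on \<Omega>. h x * \<phi> x) = (LBINT x. h' x * \<phi> x)"
    if "h \<in> borel_measurable (lebesgue_on \<Omega>)" "h' \<in> borel_measurable borel" "AE x in lborel. h' x = indicator \<Omega> x * h x" "\<phi> \<in> borel_measurable borel"
    for h h' \<phi> :: "real ^ 'n \<Rightarrow> real"
  proof (rule LINT_lebesgue_on_eq(1)[OF \<Omega>b])
    show "(\<lambda>x. h x * \<phi> x) \<in> borel_measurable (lebesgue_on \<Omega>)" using that(1) borel_measurable_lebesgue_onI[OF that(4)] by simp
    show "AE x in lborel. h' x * \<phi> x = indicator \<Omega> x * (h x * \<phi> x)" using that(3) by (rule eventually_mono) simp
  qed (use that in simp)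
  have wpd: "weak_pd \<Omega> v (p j) j" for j
    unfolding weak_pd_def
  proof
    fix \<phi> assume \<phi>: "\<phi> \<in> test_functions \<Omega>"
    show "(LBINT x. v x * grad \<phi> x $ j) = - (LBINT x. p j x * \<phi> x)"
    proof -
      have "(LINT x|lebesgue_on \<Omega>. u x * grad \<phi> x $ j) = - (LINT x|lebesgue_on \<Omega>. g x $ j * \<phi> x)"
        using g \<phi> unfolding has_L1_weak_gradient_def by blast
      then show ?thesis
        using eqL[OF um v ve tm(2)[OF \<phi>, of j]] eqL[OF gm p pe tm(1)[OF \<phi>], of j] by simp
    qed
  qed
  \<comment> \<open>The sum of all exponents is a common upper bound, since each of them is
    positive.\<close>
  define Q where "Q = (\<Sum>j\<in>UNIV. qp j + qm j)"
  have Q: "qp j \<le> Q" "qm j \<le> Q" for j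
  proof -
    have "0 \<le> qp k + qm k" for k using q(1)[of k] q(2)[of k] by linarith
    then have "qp j + qm j \<le> Q" unfolding Q_def by (intro member_le_sum) auto
    then show "qp j \<le> Q" "qm j \<le> Q" using q(1)[of j] q(2)[of j] by auto
  qed
  have min: "split_energy \<Omega> f p \<le> split_energy \<Omega> f (\<lambda>j x. p j x + \<psi> j x)"
    if adm: "admissible_variation \<Omega> \<phi> \<psi>" and fin: "split_energy \<Omega> f (\<lambda>j x. p j x + \<psi> j x) < \<infinity>" for \<phi> \<psi>
  proof -
    have \<phi>m: "\<phi> \<in> borel_measurable borel" and \<psi>i: "\<And>j. integrable lborel (\<psi> j)" and wd: "\<And>j. weak_pd \<Omega> \<phi> (\<psi> j) j"
      using adm by (auto simp: admissible_variation_def)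
    obtain B where B: "\<And>x. \<bar>\<phi> x\<bar> \<le> B" using adm by (auto simp: admissible_variation_def)
    obtain K where K: "compact K" "K \<subseteq> \<Omega>" "\<And>x. x \<notin> K \<Longrightarrow> \<phi> x = 0" "\<And>x j. x \<notin> K \<Longrightarrow> \<psi> j x = 0"
      using adm unfolding admissible_variation_def by blast
    have \<psi>m: "\<psi> j \<in> borel_measurable borel" for j using \<psi>i[of j] by auto
    have \<phi>e: "AE x in lborel. \<phi> x = indicator \<Omega> x * \<phi> x" using K by (intro AE_I2) (auto simp: indicator_def)
    have \<psi>e: "AE x in lborel. \<psi> j x = indicator \<Omega> x * \<psi> j x" for j using K by (intro AE_I2) (auto simp: indicator_def)
    have \<phi>m2: "\<phi> \<in> borel_measurable (lebesgue_on \<Omega>)" by (rule borel_measurable_lebesgue_onI[OF \<phi>m])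
    have \<psi>m2: "\<psi> j \<in> borel_measurable (lebesgue_on \<Omega>)" for j by (rule borel_measurable_lebesgue_onI[OF \<psi>m])
    have "integrable lborel \<phi>" by (rule integrable_compact_support[OF \<phi>m K(1) B K(3)])
    then have \<phi>i: "integrable (lebesgue_on \<Omega>) \<phi>" using LINT_lebesgue_on_eq(2)[OF \<Omega>b \<phi>m2 \<phi>m \<phi>e] by simp
    have \<psi>i2: "integrable (lebesgue_on \<Omega>) (\<psi> j)" for j using LINT_lebesgue_on_eq(2)[OF \<Omega>b \<psi>m2 \<psi>m \<psi>e] \<psi>i by simp
    define w where "w x = u x + \<phi> x" for x
    define G where "G x = g x + (\<chi> j. \<psi> j x)" for x
    have wi: "integrable (lebesgue_on \<Omega>) w" unfolding w_def using ui \<phi>i by simp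
    have wG: "has_L1_weak_gradient \<Omega> w G"
      unfolding has_L1_weak_gradient_def
    proof (intro conjI ballI allI)
      show "integrable (lebesgue_on \<Omega>) G"
        unfolding G_def using g \<psi>i2 by (intro Bochner_Integration.integrable_add integrable_vec_lambda) (auto simp: has_L1_weak_gradient_def)
      fix \<Theta> j assume \<Theta>: "\<Theta> \<in> test_functions \<Omega>"
      obtain C where C: "\<And>x. \<bar>\<Theta> x\<bar> \<le> C" "\<And>x j. \<bar>grad \<Theta> x $ j\<bar> \<le> C" using test_function_bounded[OF \<Theta>] by metis
      have ib: "integrable (lebesgue_on \<Omega>) (\<lambda>x. h x * k x)" if h: "integrable (lebesgue_on \<Omega>) h" and k: "k \<in> borel_measurable borel" "\<And>x. \<bar>k x\<bar> \<le> C"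
        for h k :: "real ^ 'n \<Rightarrow> real"
      proof (rule Bochner_Integration.integrable_bound[OF integrable_mult_left[OF h, of C]])
        show "AE x in lebesgue_on \<Omega>. norm (h x * k x) \<le> norm (h x * C)"
          using k(2) by (intro AE_I2) (auto simp: abs_mult intro!: mult_left_mono intro: order_trans[OF _ abs_ge_self])
      qed (use h borel_measurable_lebesgue_onI[OF k(1)] in auto)
      have "(LINT x|lebesgue_on \<Omega>. w x * grad \<Theta> x $ j) = (LINT x|lebesgue_on \<Omega>. u x * grad \<Theta> x $ j) + (LINT x|lebesgue_on \<Omega>. \<phi> x * grad \<Theta> x $ j)"
        using ib[OF ui tm(2)[OF \<Theta>] C(2)] ib[OF \<phi>i tm(2)[OF \<Theta>] C(2)] by (simp add: w_def distrib_right)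
      also have "(LINT x|lebesgue_on \<Omega>. \<phi> x * grad \<Theta> x $ j) = (LBINT x. \<phi> x * grad \<Theta> x $ j)" by (rule eqL[OF \<phi>m2 \<phi>m \<phi>e tm(2)[OF \<Theta>]])
      also have "\<dots> = - (LBINT x. \<psi> j x * \<Theta> x)" using wd[of j] \<Theta> unfolding weak_pd_def by blast
      also have "(LBINT x. \<psi> j x * \<Theta> x) = (LINT x|lebesgue_on \<Omega>. \<psi> j x * \<Theta> x)" by (rule eqL[symmetric, OF \<psi>m2 \<psi>m \<psi>e tm(1)[OF \<Theta>]])
      also have "(LINT x|lebesgue_on \<Omega>. u x * grad \<Theta> x $ j) = - (LINT x|lebesgue_on \<Omega>. g x $ j * \<Theta> x)" using g \<Theta> unfolding has_L1_weak_gradient_def by blast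
      also have "- (LINT x|lebesgue_on \<Omega>. g x $ j * \<Theta> x) + - (LINT x|lebesgue_on \<Omega>. \<psi> j x * \<Theta> x) = - (LINT x|lebesgue_on \<Omega>. G x $ j * \<Theta> x)"
        using ib[OF gi tm(1)[OF \<Theta>] C(1)] ib[OF \<psi>i2 tm(1)[OF \<Theta>] C(1)] by (simp add: G_def distrib_right)
      finally show "(LINT x|lebesgue_on \<Omega>. w x * grad \<Theta> x $ j) = - (LINT x|lebesgue_on \<Omega>. G x $ j * \<Theta> x)" .
    qed
    have wW: "w \<in> W11 \<Omega>" using wi wG by (auto simp: W11_def)
    \<comment> \<open>The chosen weak gradient of the competitor is identified with the explicit
      \<open>G\<close>, and through it its energy with \<open>split_energy\<close>.\<close>
    have "AE x in lborel. x \<in> \<Omega> \<longrightarrow> (\<forall>j. weak_grad \<Omega> w x $ j = G x $ j)"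
      by (rule weak_gradient_unique[OF \<zeta> \<Omega> weak_grad_works[OF wW] wG])
    then have "AE x in lborel. x \<in> \<Omega> \<longrightarrow> (\<forall>j. weak_grad \<Omega> w x $ j = p j x + \<psi> j x)"
      using gp by eventually_elim (auto simp: G_def)
    then have Jw: "J_energy \<Omega> f w = split_energy \<Omega> f (\<lambda>j x. p j x + \<psi> j x)" by (rule J_energy_eq_split_energy)
    have wE: "w \<in> energy_class \<Omega> f" using wW fin Jw by (simp add: energy_class_def)
    have "ess_support \<Omega> (\<lambda>x. u x - w x) \<subseteq> K"
      by (rule ess_support_subset) (use K compact_imp_closed in \<open>auto simp: w_def\<close>)
    then have "closure (ess_support \<Omega> (\<lambda>x. u x - w x)) \<subseteq> K" using K(1) by (simp add: closure_minimal compact_imp_closed)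
    then have "compactly_contained (ess_support \<Omega> (\<lambda>x. u x - w x)) \<Omega>"
      unfolding compactly_contained_def using K
      by (meson bounded_subset closed_closure compact_eq_bounded_closed order_trans)
    then have "J_energy \<Omega> f u \<le> J_energy \<Omega> f w" using u(2) wE unfolding local_minimizer_def by blast
    then show ?thesis by (simp only: Ju Jw)
  qed
  have "split_minimizer \<Omega> f f' qp qm Q M v p \<zeta>"
  proof
    show "split_energy \<Omega> f p < \<infinity>" using uE Ju by (simp add: energy_class_def)
  qed (use \<Omega> \<zeta> f q Q v vi vM pi wpd min in auto)
  then show ?thesis using that gp unfolding g_def by blast
qed

theorem theorem2p1:
  fixes \<Omega> :: "(real ^ 'n::{finite,linorder}) set"
    and f :: "'n \<Rightarrow> real \<Rightarrow> real"
    and qp qm qlow qup \<delta>i \<theta>i :: "'n \<Rightarrow> real"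
    and u :: "real ^ 'n::{finite,linorder} \<Rightarrow> real"
  assumes domain: "bounded_lipschitz_domain \<Omega>"
    and qp: "\<And>i. qp i > 1"
    and qm: "\<And>i. qm i > 1"
    and qlow: "\<And>i. qlow i = min (qp i) (qm i)"
    and qup: "\<And>i. qup i = max (qp i) (qm i)"
    and f_nonneg: "\<And>i t. f i t \<ge> 0"
    and f_C2: "\<And>i t. f i differentiable (at t)"
              "\<And>i t. deriv (f i) differentiable (at t)"
              "\<And>i. continuous_on UNIV (deriv (deriv (f i)))"
    and f_convex: "\<And>i t. deriv (deriv (f i)) t > 0"
    and f'_top: "\<And>i. filterlim (\<lambda>t. \<bar>deriv (f i) t\<bar>) at_top at_top"
    and f'_bot: "\<And>i. filterlim (\<lambda>t. \<bar>deriv (f i) t\<bar>) at_top at_bot"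
    and f_growth: "\<And>i. \<exists>s>0. \<exists>c. \<forall>\<^sub>F t in at_infinity. f i t \<le> c * \<bar>t\<bar> powr s"
    and \<delta>i: "\<And>i. \<delta>i i \<ge> 0"
    and \<theta>i: "\<And>i. \<theta>i i \<ge> 0"
    and \<theta>i_\<delta>i: "\<And>i. \<theta>i i < 1 - \<delta>i i"
    and f_ii: "\<And>i. \<exists>c1>0. \<exists>c2>0. \<exists>c3>0. \<forall>\<^sub>F t in at_infinity.
        c1 * Gam \<bar>t\<bar> powr (1 - \<delta>i i) * deriv (deriv (f i)) t \<le> f i t \<and>
        f i t \<le> c2 * deriv (deriv (f i)) t * Gam \<bar>t\<bar> powr (1 + \<theta>i i) \<and>
        \<bar>deriv (f i) t\<bar>\<^sup>2 \<le> c3 * deriv (deriv (f i)) t * f i t * Gam \<bar>t\<bar> powr (\<theta>i i)"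
    and f_iii: "\<And>i. \<exists>c4>0. \<exists>c5>0. \<forall>\<^sub>F t in at_infinity.
        (t < 0 \<longrightarrow> c4 * Gam \<bar>t\<bar> powr (qm i / 2) \<le> f i t \<and> f i t \<le> c5 * Gam \<bar>t\<bar> powr (qm i / 2)) \<and>
        (t \<ge> 0 \<longrightarrow> c4 * Gam \<bar>t\<bar> powr (qp i / 2) \<le> f i t \<and> f i t \<le> c5 * Gam \<bar>t\<bar> powr (qp i / 2))"
    and q_above: "\<And>i j. i < j \<Longrightarrow>
        qup j < 2 * qlow i * (1 - \<delta>i i) / (1 + 2 * \<theta>i i) + 2 * (1 - \<delta>i i)"
    and q_below: "\<And>i j. j < i \<Longrightarrow>
        qup j < 2 / (1 + 2 * \<theta>i i) *
            (qlow i / 2 * (1 - \<delta>i i) * (2 + 1 / (1 - \<delta>i i)) - \<theta>i i * (1 + qup j))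
          + 2 * (1 - \<delta>i i)"
    and u_bounded: "u \<in> Linfty \<Omega> \<inter> energy_class \<Omega> f"
    and u_min: "local_minimizer \<Omega> f u"
  shows "\<exists>\<delta>>-1/2. \<forall>i x0. \<forall>r>0. \<forall>\<eta> C.
      compactly_contained (ball x0 (2 * r)) \<Omega> \<longrightarrow>
      \<eta> \<in> test_functions (ball x0 (2 * r)) \<longrightarrow>
      (\<forall>x. 0 \<le> \<eta> x \<and> \<eta> x \<le> 1) \<longrightarrow>
      (\<forall>x\<in>ball x0 r. \<eta> x = 1) \<longrightarrow>
      (\<forall>x. norm (grad \<eta> x) \<le> C / r) \<longrightarrow>
      (\<forall>\<^sub>F k::real in at_top. \<exists>c::real.
        (\<integral>\<^sup>+x\<in>ball x0 (2 * r).
            ennreal (f i (weak_grad \<Omega> u x $ i) * Gam \<bar>weak_grad \<Omega> u x $ i\<bar> powr (1 + \<delta>)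
              * \<eta> x powr (2 * k)) \<partial>lebesgue) \<le> ennreal c)"
proof (intro exI[of _ 0] conjI allI impI)
  fix i x0 and r :: real and \<eta> C
  assume r: "r > 0" and cc: "compactly_contained (ball x0 (2 * r)) \<Omega>"
    and \<eta>T: "\<eta> \<in> test_functions (ball x0 (2 * r))" and \<eta>01: "\<forall>x. 0 \<le> \<eta> x \<and> \<eta> x \<le> 1"
    and \<eta>1: "\<forall>x\<in>ball x0 r. \<eta> x = 1"
  have \<Omega>: "open \<Omega>" using domain by (auto simp: bounded_lipschitz_domain_def)
  have fc: "convex_C1 (f j) (deriv (f j))" for j by (rule convex_C1_deriv[OF f_nonneg f_C2(1,2) f_convex])
  have fg: "power_growth (f j) (qp j) (qm j)" for j by (rule power_growth_Gam[OF f_iii qp qm])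
  \<comment> \<open>The given \<eta>, rescaled, serves as the profile of all cutoffs in the
    regularity argument.\<close>
  obtain Q M v p where sm: "split_minimizer \<Omega> f (\<lambda>j. deriv (f j)) qp qm Q M v p (\<lambda>x. \<eta> (r *\<^sub>R x + x0))"
    and gp: "AE x in lborel. x \<in> \<Omega> \<longrightarrow> (\<forall>j. weak_grad \<Omega> u x $ j = p j x)"
    by (rule local_minimizer_split_minimizer[OF \<Omega> test_function_std_bump[OF r \<eta>T \<eta>01 \<eta>1] fc fg qp qm _ u_min])
      (use u_bounded in auto)
  interpret split_minimizer \<Omega> f "\<lambda>j. deriv (f j)" qp qm Q M v p "\<lambda>x. \<eta> (r *\<^sub>R x + x0)" by (rule sm)
  \<comment> \<open>\<open>n \<ge> 4 * Q\<close> gives \<open>b \<ge> 2\<close>, hence an exponent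
    \<open>1 + b\<close> of at least 3, which is what \<open>Gam_le_growth\<close> asks for with the
    witness \<delta> = 0.\<close>
  define n where "n = nat \<lceil>4 * Q\<rceil>"
  define b where "b = real n / (2 * Q)"
  have b: "b \<ge> 2" using Q_gt_1 by (simp add: b_def n_def field_simps)
  have LI: "local_int b" unfolding b_def by (rule local_int_multiple)
  define K where "K = closure (ball x0 (2 * r))"
  have K: "compact K" "K \<subseteq> \<Omega>" "ball x0 (2 * r) \<subseteq> K"
    using cc closure_subset by (auto simp: compactly_contained_def K_def)
  have [measurable]: "K \<in> sets borel" by (simp add: K_def)
  obtain D where D: "D \<ge> 0" "\<And>t. f i t * Gam \<bar>t\<bar> \<le> D * (1 + f i t) powr 3"
    using Gam_le_growth[OF fc fg qp qm, of i] by blast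
  have fin: "(\<integral>\<^sup>+x. ennreal D * ennreal (indicator K x * (1 + f i (p i x)) powr (1 + b)) \<partial>lborel) < \<infinity>"
  proof -
    have "(\<integral>\<^sup>+x. ennreal (indicator K x * (1 + f i (p i x)) powr (1 + b)) \<partial>lborel) < \<infinity>"
      using LI K unfolding local_int_def by blast
    then show ?thesis by (subst nn_integral_cmult) (auto simp: ennreal_mult_less_top)
  qed
  show "\<forall>\<^sub>F k::real in at_top. \<exists>c::real.
        (\<integral>\<^sup>+x\<in>ball x0 (2 * r).
            ennreal (f i (weak_grad \<Omega> u x $ i) * Gam \<bar>weak_grad \<Omega> u x $ i\<bar> powr (1 + 0)
              * \<eta> x powr (2 * k)) \<partial>lebesgue) \<le> ennreal c"
    using eventually_ge_at_top[of 0]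
  proof (rule eventually_mono)
    \<comment> \<open>For \<open>k \<ge> 0\<close> the factor with \<eta> is at most 1, so one bound
      serves all such \<open>k\<close>.\<close>
    fix k :: real assume k: "k \<ge> 0"
    let ?I = "\<integral>\<^sup>+x\<in>ball x0 (2 * r). ennreal (f i (weak_grad \<Omega> u x $ i) * Gam \<bar>weak_grad \<Omega> u x $ i\<bar> powr (1 + 0) * \<eta> x powr (2 * k)) \<partial>lebesgue"
    have "?I = (\<integral>\<^sup>+x. ennreal (f i (weak_grad \<Omega> u x $ i) * Gam \<bar>weak_grad \<Omega> u x $ i\<bar> powr (1 + 0) * \<eta> x powr (2 * k)) * indicator (ball x0 (2 * r)) x \<partial>lborel)"
      by (rule nn_integral_completion)
    also have "\<dots> \<le> (\<integral>\<^sup>+x. ennreal D * ennreal (indicator K x * (1 + f i (p i x)) powr (1 + b)) \<partial>lborel)"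
    proof (rule nn_integral_mono_AE)
      show "AE x in lborel. ennreal (f i (weak_grad \<Omega> u x $ i) * Gam \<bar>weak_grad \<Omega> u x $ i\<bar> powr (1 + 0) * \<eta> x powr (2 * k)) * indicator (ball x0 (2 * r)) x
         \<le> ennreal D * ennreal (indicator K x * (1 + f i (p i x)) powr (1 + b))"
        using gp
      proof (rule eventually_mono)
        fix x assume x: "x \<in> \<Omega> \<longrightarrow> (\<forall>j. weak_grad \<Omega> u x $ j = p j x)"
        show "ennreal (f i (weak_grad \<Omega> u x $ i) * Gam \<bar>weak_grad \<Omega> u x $ i\<bar> powr (1 + 0) * \<eta> x powr (2 * k)) * indicator (ball x0 (2 * r)) x
         \<le> ennreal D * ennreal (indicator K x * (1 + f i (p i x)) powr (1 + b))"
        proof (cases "x \<in> ball x0 (2 * r)")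
          case True
          then have xK: "x \<in> K" and e: "weak_grad \<Omega> u x $ i = p i x" using K x by auto
          define t where "t = p i x"
          have G: "Gam \<bar>t\<bar> powr (1 + 0) = Gam \<bar>t\<bar>" by (simp add: Gam_def add_nonneg_nonneg)
          have \<eta>k: "0 \<le> \<eta> x powr (2 * k)" "\<eta> x powr (2 * k) \<le> 1" using \<eta>01 k by (auto intro: powr_le1)
          have "f i t * Gam \<bar>t\<bar> powr (1 + 0) * \<eta> x powr (2 * k) \<le> f i t * Gam \<bar>t\<bar> * 1"
            unfolding G using \<eta>k f_nonneg[of i t] by (intro mult_left_mono) (auto simp: Gam_def)
          also have "\<dots> \<le> D * (1 + f i t) powr 3" using D(2)[of t] by simp
          also have "\<dots> \<le> D * (1 + f i t) powr (1 + b)" using D(1) b f_nonneg[of i t] by (intro mult_left_mono powr_mono) auto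
          finally have "ennreal (f i t * Gam \<bar>t\<bar> powr (1 + 0) * \<eta> x powr (2 * k)) \<le> ennreal (D * (1 + f i t) powr (1 + b))"
            by (rule ennreal_leI)
          also have "\<dots> = ennreal D * ennreal ((1 + f i t) powr (1 + b))" using D(1) by (simp add: ennreal_mult)
          finally show ?thesis unfolding e t_def using True xK by simp
        qed simp
      qed
    qed
    finally have "?I < \<infinity>" using fin le_less_trans by blast
    then show "\<exists>c::real. ?I \<le> ennreal c" by (cases ?I) auto
  qed
qed simp

end
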